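(* Let $a(t)$ be a real analytic quasi-periodic function on $D_\rho$ (for some $\rho>0$) with frequencies $\omega=(\omega_1,\dots,\omega_r)$ and with average $\bar a>0$. Suppose that $\omega$ satisfies the Diophantine condition $$\big|\langle k,\omega\rangle\big|\ge\frac{\alpha}{|k|^\tau}\qquad\text{for all }k\in\mathbb{Z}^r\setminus\{0\},$$ where $\alpha>0$ is a small constant and $\tau>r-1$. Then, for most sufficiently small $\varepsilon>0$, all solutions of the quasi-periodic Hill's equation $$\ddot x+\varepsilon a(t)x=0$$ are quasi-periodic with frequencies $\Omega=(\omega_1,\dots,\omega_r,\sqrt b)$, where $b=b(\varepsilon)>0$ is a number (defined for these $\varepsilon$) satisfying $b=\bar a\varepsilon+O(\varepsilon^2)$ as $\varepsilon\to0$, such that $\pm\sqrt{-1}\sqrt b$ are the eigenvalues of a constant matrix $B$ to which the equivalent first-order system is reduced.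
   Context: For $\rho>0$, $D_\rho=\{\theta\in\mathbb{C}^r:|\mathrm{Im}\,\theta_j|\le\rho,\ j=1,\dots,r\}$. A function $f(t)$ is quasi-periodic with basic frequencies $\omega=(\omega_1,\dots,\omega_r)$ if $f(t)=F(\omega_1t,\dots,\omega_rt)$ where $F(\theta_1,\dots,\theta_r)$ is $2\pi$-periodic in each argument; it is analytic quasi-periodic on $D_\rho$ if moreover $F$ is analytic on $D_\rho$. A matrix is (analytic) quasi-periodic if all its entries are. The average of $a$ is $\bar a=\lim_{T\to\infty}\frac1{2T}\int_{-T}^Ta(t)\,dt$. For $k\in\mathbb{Z}^r$, $|k|=|k_1|+\dots+|k_r|$ and $\langle k,\omega\rangle=\sum_jk_j\omega_j$. The equivalent first-order system is $\dot z=\begin{pmatrix}0&1\\-\varepsilon a(t)&0\end{pmatrix}z$ with $z=(x,\dot x)^T$. It is reduced to the constant matrix $B$ if there is an analytic quasi-periodic symplectic transformation $z=\psi(t)w$ (that is, $\psi(t)^TJ\psi(t)=J$ for all $t$, $J=\begin{pmatrix}0&1\\-1&0\end{pmatrix}$), with $\psi$ having frequencies $\omega$, which changes it into the Hamiltonian system $\dot w=Bw$. A property holds "for most sufficiently small $\varepsilon>0$" if for every sufficiently small $\varepsilon_0>0$ there is a set $E_{\varepsilon_0}\subset(0,\varepsilon_0)$ of positive Lebesgue measure such that the property holds for all $\varepsilon\in E_{\varepsilon_0}$, and $\operatorname{meas}(E_{\varepsilon_0})/\varepsilon_0\to1$ as $\varepsilon_0\to0$. *)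

theory Defs
  imports "HOL-Analysis.Analysis" "HOL-Library.Landau_Symbols"
begin

section \<open>Quasi-periodic functions\<close>

definition strip :: "real \<Rightarrow> (complex ^ 'i) set" where
  "strip \<rho> = {\<theta>. \<forall>j. \<bar>Im (\<theta> $ j)\<bar> \<le> \<rho>}"

text \<open>Functions of several complex variables: Frechet differentiability with a complex-linear
  derivative (the library's \<open>has_derivative\<close> only asks for real linearity).\<close>

definition holomorphic_at :: "(complex ^ 'i \<Rightarrow> complex) \<Rightarrow> complex ^ 'i \<Rightarrow> bool" where
  "holomorphic_at F \<theta> \<longleftrightarrow>
     (\<exists>D. (F has_derivative D) (at \<theta>) \<and> (\<forall>c v. D (c *s v) = c * D v))"

text \<open>As for the library's \<open>analytic_on\<close>, analyticity on a set that is not open means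
  holomorphy on an open neighbourhood of it.\<close>

definition analytic_several_on :: "(complex ^ 'i \<Rightarrow> complex) \<Rightarrow> (complex ^ 'i) set \<Rightarrow> bool" where
  "analytic_several_on F S \<longleftrightarrow> (\<exists>U. open U \<and> S \<subseteq> U \<and> (\<forall>\<theta>\<in>U. holomorphic_at F \<theta>))"

text \<open>Continuity of the hull function \<open>F\<close> is part of the notion: if the entries of \<open>\<omega>\<close> are
  rationally independent and there are at least two of them, then \<open>t \<mapsto> t \<omega>\<close> is injective
  modulo the periods, and without continuity every function would be quasi-periodic.\<close>

definition quasi_periodic :: "real ^ 'i \<Rightarrow> (real \<Rightarrow> real) \<Rightarrow> bool" where
  "quasi_periodic \<omega> f \<longleftrightarrow>
     (\<exists>F :: real ^ 'i \<Rightarrow> real. continuous_on UNIV F \<and>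
        (\<forall>\<theta> j. F (\<theta> + axis j (2 * pi)) = F \<theta>) \<and>
        (\<forall>t. f t = F (\<chi> j. \<omega> $ j * t)))"

definition analytic_quasi_periodic :: "real \<Rightarrow> real ^ 'i \<Rightarrow> (real \<Rightarrow> real) \<Rightarrow> bool" where
  "analytic_quasi_periodic \<rho> \<omega> f \<longleftrightarrow>
     (\<exists>F :: complex ^ 'i \<Rightarrow> complex. analytic_several_on F (strip \<rho>) \<and>
        (\<forall>\<theta>\<in>strip \<rho>. \<forall>j. F (\<theta> + axis j (of_real (2 * pi))) = F \<theta>) \<and>
        (\<forall>t. complex_of_real (f t) = F (\<chi> j. of_real (\<omega> $ j * t))))"

definition analytic_quasi_periodic_matrix ::
    "real \<Rightarrow> real ^ 'i \<Rightarrow> (real \<Rightarrow> real ^ 'n ^ 'm) \<Rightarrow> bool" where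
  "analytic_quasi_periodic_matrix \<rho> \<omega> \<psi> \<longleftrightarrow>
     (\<forall>i j. analytic_quasi_periodic \<rho> \<omega> (\<lambda>t. \<psi> t $ i $ j))"

definition has_average :: "(real \<Rightarrow> real) \<Rightarrow> real \<Rightarrow> bool" where
  "has_average a m \<longleftrightarrow> ((\<lambda>T. (1 / (2 * T)) * integral {-T..T} a) \<longlongrightarrow> m) at_top"

definition diophantine :: "real ^ 'i \<Rightarrow> real \<Rightarrow> real \<Rightarrow> bool" where
  "diophantine \<omega> \<alpha> \<tau> \<longleftrightarrow>
     (\<forall>k :: int ^ 'i. k \<noteq> 0 \<longrightarrow>
        \<bar>\<Sum>j\<in>UNIV. of_int (k $ j) * \<omega> $ j\<bar> \<ge> \<alpha> / (of_int (\<Sum>j\<in>UNIV. \<bar>k $ j\<bar>) powr \<tau>))"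

text \<open>The frequency vector \<open>(\<omega>\<^sub>1, \<dots>, \<omega>\<^sub>r, c)\<close>; the additional index is \<open>None\<close>.\<close>

definition append_frequency :: "real ^ 'i \<Rightarrow> real \<Rightarrow> real ^ ('i option)" where
  "append_frequency \<omega> c = (\<chi> i. case i of None \<Rightarrow> c | Some j \<Rightarrow> \<omega> $ j)"


section \<open>Hill's equation and its reduction\<close>

definition hill_solution :: "(real \<Rightarrow> real) \<Rightarrow> real \<Rightarrow> (real \<Rightarrow> real) \<Rightarrow> bool" where
  "hill_solution a \<epsilon> x \<longleftrightarrow>
     (\<exists>x' x''. \<forall>t. (x has_real_derivative x' t) (at t) \<and>
                   (x' has_real_derivative x'' t) (at t) \<and>
                   x'' t + \<epsilon> * a t * x t = 0)"

definition hill_matrix :: "(real \<Rightarrow> real) \<Rightarrow> real \<Rightarrow> real \<Rightarrow> real ^ 2 ^ 2" where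
  "hill_matrix a \<epsilon> t = vector [vector [0, 1], vector [- \<epsilon> * a t, 0]]"

definition linear_system_solution :: "(real \<Rightarrow> real ^ 'n ^ 'n) \<Rightarrow> (real \<Rightarrow> real ^ 'n) \<Rightarrow> bool" where
  "linear_system_solution A z \<longleftrightarrow> (\<forall>t. (z has_vector_derivative (A t *v z t)) (at t))"

definition J2 :: "real ^ 2 ^ 2" where
  "J2 = vector [vector [0, 1], vector [-1, 0]]"

text \<open>The linear system with matrix \<open>B\<close> is Hamiltonian, with Hamiltonian
  \<open>H w = (w \<bullet> (S *v w)) / 2\<close>.\<close>

definition hamiltonian_matrix :: "real ^ 2 ^ 2 \<Rightarrow> bool" where
  "hamiltonian_matrix B \<longleftrightarrow> (\<exists>S. transpose S = S \<and> B = J2 ** S)"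

definition reduced_to :: "real ^ 'i \<Rightarrow> (real \<Rightarrow> real ^ 2 ^ 2) \<Rightarrow> real ^ 2 ^ 2 \<Rightarrow> bool" where
  "reduced_to \<omega> A B \<longleftrightarrow> hamiltonian_matrix B \<and>
     (\<exists>\<psi> \<rho>. \<rho> > 0 \<and> analytic_quasi_periodic_matrix \<rho> \<omega> \<psi> \<and>
        (\<forall>t. transpose (\<psi> t) ** J2 ** \<psi> t = J2) \<and>
        (\<forall>w. linear_system_solution A (\<lambda>t. \<psi> t *v w t) \<longleftrightarrow>
             linear_system_solution (\<lambda>t. B) w))"

definition complex_eigenvalues :: "real ^ 'n ^ 'n \<Rightarrow> complex set" where
  "complex_eigenvalues B =
     {\<mu>. \<exists>v. v \<noteq> 0 \<and> (\<chi> i j. complex_of_real (B $ i $ j)) *v v = \<mu> *s v}"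


section \<open>Most small parameters\<close>

definition for_most_small :: "(real \<Rightarrow> bool) \<Rightarrow> bool" where
  "for_most_small P \<longleftrightarrow>
     (\<exists>E. (\<forall>\<^sub>F \<epsilon>\<^sub>0 in at_right 0.
             E \<epsilon>\<^sub>0 \<subseteq> {0<..<\<epsilon>\<^sub>0} \<and> E \<epsilon>\<^sub>0 \<in> lmeasurable \<and> measure lebesgue (E \<epsilon>\<^sub>0) > 0 \<and>
             (\<forall>\<epsilon>\<in>E \<epsilon>\<^sub>0. P \<epsilon>)) \<and>
          ((\<lambda>\<epsilon>\<^sub>0. measure lebesgue (E \<epsilon>\<^sub>0) / \<epsilon>\<^sub>0) \<longlongrightarrow> 1) (at_right 0))"

end

theory Submission
  imports Defs "HOL-Complex_Analysis.Cauchy_Integral_Theorem"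
begin

text \<open>A solution \<open>exp (\<i> \<nu> t + w t)\<close> of Hill's equation with quasi-periodic \<open>w\<close> amounts to a
  quasi-periodic solution \<open>v = w'\<close> with mean \<open>0\<close> of the Riccati equation
  \<open>v' + 2 \<i> \<nu> v + v\<^sup>2 - \<nu>\<^sup>2 + \<epsilon> a = 0\<close>. The exponent \<open>\<nu>\<close> is fixed, under a Diophantine condition on
  \<open>d k + 2 \<nu>\<close> with \<open>d k = \<langle>k, \<omega>\<rangle>\<close>, and \<open>\<epsilon>\<close> is the counterterm that makes the mean vanish. The
  equation is solved by Newton's method: after an error \<open>E\<close> the linearized equation
  \<open>h' + 2 (\<i> \<nu> + v) h + E + \<eta> a = 0\<close> is solved exactly, with integrating factor \<open>exp (2 w)\<close>, and the
  new error is exactly \<open>h\<^sup>2\<close>. This gives \<open>\<epsilon> = \<nu>\<^sup>2 / abar + O(\<nu>\<^sup>4)\<close>, and \<open>b = \<nu>\<^sup>2\<close>. The Wronskian of two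
  such solutions shows that \<open>\<epsilon>\<close> is real and a Lipschitz function of \<open>\<nu>\<close>. Since \<open>\<omega>\<close> is Diophantine,
  the resonant \<open>\<nu> \<le> x\<close> have measure \<open>O(x\<^sup>3)\<close>, hence so have the missing \<open>\<epsilon>\<close>, and the remaining
  ones have density \<open>1\<close> at \<open>0\<close>.\<close>

section \<open>Absolutely convergent quasi-periodic series\<close>

text \<open>Fixing \<open>\<nu>\<close> rather than \<open>\<epsilon>\<close> keeps the small
  divisors \<open>d k + 2 * \<nu>\<close> the same in every Newton step: nothing is discarded along
  the iteration, and all exclusions are made once, on the line of the \<nu>. The price is that
  \<open>\<epsilon>\<close> becomes an unknown. Its correction \<open>\<eta>\<close> serves one
  purpose: \<open>h\<close> must have mean 0, since otherwise its primitive is no longer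
  quasi-periodic. The mean responds to \<open>\<eta>\<close> at a rate of size about
  \<open>abar / (2 * \<nu>)\<close>, so \<open>abar > 0\<close> makes this solvable. The other
  obstacle is the divisor \<open>2 * \<nu>\<close> at index 0, which is itself small. It costs one
  factor \<open>1 / \<nu>\<close>: an error of order \<open>\<nu> ^ 4\<close> gives \<open>h\<close>
  of order \<open>\<nu> ^ 3\<close> and a new error of order \<open>\<nu> ^ 6\<close>, which is
  still a gain. Of the dependence of \<open>\<epsilon>\<close> on \<open>\<nu>\<close> only the
  Lipschitz bound is used. It controls the measure of images, and continuity of a Lipschitz
  extension provides enough values. The cube in the measure estimate stems from the exponent
  \<open>m\<close> of the nonresonance condition, which can be chosen large.\<close>

locale frequency_group =
  fixes d len :: "'k::ab_group_add \<Rightarrow> real"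
  assumes d_add: "d (k + l) = d k + d l"
    and d_nonzero: "k \<noteq> 0 \<Longrightarrow> d k \<noteq> 0"
    and len_nonneg: "0 \<le> len k"
    and len_zero: "len 0 = 0"
    and len_triangle: "len (k + l) \<le> len k + len l"
    and len_minus: "len (- k) = len k"
begin

lemma d_zero: "d 0 = 0"
  using d_add[of 0 0] by simp

lemma d_minus: "d (- k) = - d k"
  using d_add[of k "- k"] by (simp add: d_zero)

text \<open>The frequencies \<open>\<kappa> n\<close> need not be distinct. Products and sums of series are thus obtained by
  reindexing alone, without collecting terms.\<close>

definition fourier_rep :: "real \<Rightarrow> (nat \<Rightarrow> complex) \<Rightarrow> (nat \<Rightarrow> 'k) \<Rightarrow> real \<Rightarrow> (real \<Rightarrow> complex) \<Rightarrow> bool" where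
  "fourier_rep \<sigma> a \<kappa> M f \<longleftrightarrow>
     (\<lambda>n. cmod (a n) * exp (\<sigma> * len (\<kappa> n))) summable_on UNIV \<and>
     (\<Sum>\<^sub>\<infinity>n. cmod (a n) * exp (\<sigma> * len (\<kappa> n))) \<le> M \<and>
     (\<forall>t. ((\<lambda>n. a n * cis (d (\<kappa> n) * t)) has_sum f t) UNIV)"

text \<open>Membership in a weighted Wiener algebra with norm at most \<open>M\<close>. The norm
  itself is never formed; it is carried along as an explicit bound, so that later estimates are
  arithmetic with such bounds.\<close>

definition wiener :: "real \<Rightarrow> real \<Rightarrow> (real \<Rightarrow> complex) \<Rightarrow> bool" where
  "wiener \<sigma> M f \<longleftrightarrow> (\<exists>a \<kappa>. fourier_rep \<sigma> a \<kappa> M f)"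

lemma fourier_repI:
  assumes "(u has_sum S) UNIV" and "S \<le> M"
    and "\<And>n. cmod (a n) * exp (\<sigma> * len (\<kappa> n)) \<le> u n"
    and "\<And>t. ((\<lambda>n. a n * cis (d (\<kappa> n) * t)) has_sum f t) UNIV"
  shows "fourier_rep \<sigma> a \<kappa> M f"
proof -
  have u: "u summable_on UNIV" using assms(1) by (rule has_sum_imp_summable)
  have s: "(\<lambda>n. cmod (a n) * exp (\<sigma> * len (\<kappa> n))) summable_on UNIV"
    by (rule summable_on_comparison_test[OF u]) (use assms(3) in auto)
  have "(\<Sum>\<^sub>\<infinity>n. cmod (a n) * exp (\<sigma> * len (\<kappa> n))) \<le> infsum u UNIV"
    by (rule infsum_mono[OF s u]) (use assms(3) in auto)
  also have "\<dots> \<le> M" using assms(1,2) by (simp add: infsumI)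
  finally show ?thesis using s assms(4) by (simp add: fourier_rep_def)
qed

text \<open>Sums and products of series arrive as double series; \<open>prod_decode\<close> turns
  them into series over \<open>nat\<close> without identifying equal frequencies.\<close>

lemma wienerI_pairs:
  fixes a :: "nat \<times> nat \<Rightarrow> complex"
  assumes "(u has_sum S) UNIV" and "S \<le> M"
    and "\<And>i. cmod (a i) * exp (\<sigma> * len (\<kappa> i)) \<le> u i"
    and "\<And>t. ((\<lambda>i. a i * cis (d (\<kappa> i) * t)) has_sum f t) UNIV"
  shows "wiener \<sigma> M f"
proof -
  have b: "bij_betw prod_decode UNIV UNIV" using bij_prod_decode by simp
  have "fourier_rep \<sigma> (\<lambda>n. a (prod_decode n)) (\<lambda>n. \<kappa> (prod_decode n)) M f"
  proof (rule fourier_repI)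
    show "((\<lambda>n. u (prod_decode n)) has_sum S) UNIV"
      using assms(1) has_sum_reindex_bij_betw[OF b, of u] by simp
    show "((\<lambda>n. a (prod_decode n) * cis (d (\<kappa> (prod_decode n)) * t)) has_sum f t) UNIV" for t
      using assms(4)[of t] has_sum_reindex_bij_betw[OF b, of "\<lambda>i. a i * cis (d (\<kappa> i) * t)"] by simp
  qed (use assms in auto)
  then show ?thesis unfolding wiener_def by blast
qed

lemma fourier_rep_abs_summable:
  assumes "fourier_rep \<sigma> a \<kappa> M f" "0 \<le> \<sigma>"
  shows "(\<lambda>n. cmod (a n)) summable_on UNIV" "(\<Sum>\<^sub>\<infinity>n. cmod (a n)) \<le> M"
proof -
  have s: "(\<lambda>n. cmod (a n) * exp (\<sigma> * len (\<kappa> n))) summable_on UNIV"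
    using assms by (simp add: fourier_rep_def)
  have le: "cmod (a n) \<le> cmod (a n) * exp (\<sigma> * len (\<kappa> n))" for n
    using assms(2) len_nonneg[of "\<kappa> n"] mult_left_mono[of 1 "exp (\<sigma> * len (\<kappa> n))" "cmod (a n)"] by simp
  show s': "(\<lambda>n. cmod (a n)) summable_on UNIV"
    by (rule summable_on_comparison_test[OF s]) (use le in auto)
  have "(\<Sum>\<^sub>\<infinity>n. cmod (a n)) \<le> (\<Sum>\<^sub>\<infinity>n. cmod (a n) * exp (\<sigma> * len (\<kappa> n)))"
    by (rule infsum_mono[OF s' s]) (use le in auto)
  also have "\<dots> \<le> M" using assms by (simp add: fourier_rep_def)
  finally show "(\<Sum>\<^sub>\<infinity>n. cmod (a n)) \<le> M" .
qed

lemma wiener_bound: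
  assumes "wiener \<sigma> M f" "0 \<le> \<sigma>" shows "cmod (f t) \<le> M"
proof -
  obtain a \<kappa> where r: "fourier_rep \<sigma> a \<kappa> M f" using assms by (auto simp: wiener_def)
  have "cmod (f t) \<le> (\<Sum>\<^sub>\<infinity>n. cmod (a n))"
  proof (rule norm_has_sum_bound)
    show "((\<lambda>n. norm (a n * cis (d (\<kappa> n) * t))) has_sum (\<Sum>\<^sub>\<infinity>n. cmod (a n))) UNIV"
      using fourier_rep_abs_summable(1)[OF r assms(2)] by (simp add: norm_mult)
    show "((\<lambda>n. a n * cis (d (\<kappa> n) * t)) has_sum f t) UNIV" using r by (simp add: fourier_rep_def)
  qed
  then show ?thesis using fourier_rep_abs_summable(2)[OF r assms(2)] by simp
qed

lemma wiener_nonneg: "wiener \<sigma> M f \<Longrightarrow> 0 \<le> M"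
  unfolding wiener_def fourier_rep_def
  by (smt (verit) infsum_nonneg norm_ge_zero exp_ge_zero mult_nonneg_nonneg)

lemma wiener_mono:
  assumes "wiener \<sigma> M f" "\<sigma>' \<le> \<sigma>" "M \<le> M'" shows "wiener \<sigma>' M' f"
proof -
  obtain a \<kappa> where r: "fourier_rep \<sigma> a \<kappa> M f" using assms by (auto simp: wiener_def)
  have "fourier_rep \<sigma>' a \<kappa> M' f"
  proof (rule fourier_repI)
    show "((\<lambda>n. cmod (a n) * exp (\<sigma> * len (\<kappa> n))) has_sum
        (\<Sum>\<^sub>\<infinity>n. cmod (a n) * exp (\<sigma> * len (\<kappa> n)))) UNIV"
      using r by (simp add: fourier_rep_def)
    show "(\<Sum>\<^sub>\<infinity>n. cmod (a n) * exp (\<sigma> * len (\<kappa> n))) \<le> M'" using r assms(3) by (simp add: fourier_rep_def)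
    show "cmod (a n) * exp (\<sigma>' * len (\<kappa> n)) \<le> cmod (a n) * exp (\<sigma> * len (\<kappa> n))" for n
      using assms(2) len_nonneg[of "\<kappa> n"] by (intro mult_left_mono) (auto intro: mult_right_mono)
  qed (use r in \<open>auto simp: fourier_rep_def\<close>)
  then show ?thesis by (auto simp: wiener_def)
qed

lemma wiener_const: "wiener \<sigma> (cmod c) (\<lambda>t. c)"
proof -
  have fin: "((\<lambda>n::nat. if n = 0 then x else 0) has_sum x) UNIV" for x :: "'c::{topological_comm_monoid_add,t2_space}"
    by (rule has_sum_finite_neutralI[of "{0}"]) auto
  have "fourier_rep \<sigma> (\<lambda>n. if n = 0 then c else 0) (\<lambda>n. 0) (cmod c) (\<lambda>t. c)"
    by (rule fourier_repI[OF fin[of "cmod c"]]) (auto simp: len_zero d_zero fin)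
  then show ?thesis by (auto simp: wiener_def)
qed

lemma wiener_zero: "wiener \<sigma> 0 (\<lambda>t. 0)"
  using wiener_const[of \<sigma> 0] by simp

text \<open>Completeness in a usable form: the double family of coefficients is absolutely summable
  with total at most \<open>suminf M\<close>, so the iterated sum may be read as one series over
  pairs. Sums, exponentials and the limits of the Newton iteration are instances of it.\<close>

lemma wiener_suminf:
  assumes w: "\<And>n. wiener \<sigma> (M n) (f n)" and M: "summable M" and \<sigma>: "0 \<le> \<sigma>"
  shows "wiener \<sigma> (suminf M) (\<lambda>t. \<Sum>n. f n t)" and "\<And>t. (\<lambda>n. f n t) sums (\<Sum>n. f n t)"
proof -
  have M0: "0 \<le> M n" for n using w wiener_nonneg by blast
  show sums: "(\<lambda>n. f n t) sums (\<Sum>n. f n t)" for t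
    by (rule summable_sums[OF summable_comparison_test'[OF M, of 0]])
       (use wiener_bound[OF w \<sigma>] in auto)
  have "\<forall>n. \<exists>p. fourier_rep \<sigma> (fst p) (snd p) (M n) (f n)"
    using w by (auto simp: wiener_def)
  then obtain p where p: "\<And>n. fourier_rep \<sigma> (fst (p n)) (snd (p n)) (M n) (f n)" by metis
  define a \<kappa> where "a i = fst (p (fst i)) (snd i)" and "\<kappa> i = snd (p (fst i)) (snd i)" for i
  define u where "u i = cmod (a i) * exp (\<sigma> * len (\<kappa> i))" for i
  define m where "m n = (\<Sum>\<^sub>\<infinity>j. u (n, j))" for n
  have um: "((\<lambda>j. u (n, j)) has_sum m n) UNIV" for n
    using p[of n] by (simp add: u_def m_def a_def \<kappa>_def fourier_rep_def)
  have mM: "m n \<le> M n" for n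
    using p[of n] by (simp add: u_def m_def a_def \<kappa>_def fourier_rep_def)
  have m0: "0 \<le> m n" for n unfolding m_def by (rule infsum_nonneg) (simp add: u_def)
  have MS: "(M has_sum suminf M) UNIV"
    by (rule sums_nonneg_imp_has_sum[OF summable_sums[OF M] M0])
  have ms: "m summable_on UNIV"
    by (rule summable_on_comparison_test[OF has_sum_imp_summable[OF MS]]) (use mM m0 in auto)
  have us: "u summable_on (UNIV \<times> UNIV)"
    by (rule summable_on_SigmaI[OF um ms]) (simp add: u_def)
  have uS: "(u has_sum infsum m UNIV) UNIV"
    using has_sum_SigmaI[of UNIV u "\<lambda>_. UNIV" m, OF um has_sum_infsum[OF ms] us] by simp
  show "wiener \<sigma> (suminf M) (\<lambda>t. \<Sum>n. f n t)"
  proof (rule wienerI_pairs[OF uS])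
    show "infsum m UNIV \<le> suminf M"
      using has_sum_mono[OF has_sum_infsum[OF ms] MS] mM by auto
    show "cmod (a i) * exp (\<sigma> * len (\<kappa> i)) \<le> u i" for i by (simp add: u_def)
    fix t
    have le: "cmod (a i) \<le> u i" for i
      using \<sigma> len_nonneg[of "\<kappa> i"] mult_left_mono[of 1 "exp (\<sigma> * len (\<kappa> i))" "cmod (a i)"]
      by (simp add: u_def)
    have "(\<lambda>i. cmod (a i * cis (d (\<kappa> i) * t))) summable_on UNIV"
      by (rule summable_on_comparison_test[OF has_sum_imp_summable[OF uS]])
         (use le in \<open>auto simp: norm_mult\<close>)
    then have S: "((\<lambda>i. a i * cis (d (\<kappa> i) * t)) has_sum (\<Sum>\<^sub>\<infinity>i. a i * cis (d (\<kappa> i) * t))) (UNIV \<times> UNIV)"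
      using has_sum_infsum[OF abs_summable_summable] by simp
    have "((\<lambda>n. f n t) has_sum (\<Sum>\<^sub>\<infinity>i. a i * cis (d (\<kappa> i) * t))) UNIV"
      by (rule has_sum_SigmaD[OF S]) (use p in \<open>auto simp: fourier_rep_def a_def \<kappa>_def\<close>)
    then have "(\<lambda>n. f n t) sums (\<Sum>\<^sub>\<infinity>i. a i * cis (d (\<kappa> i) * t))" by (rule has_sum_imp_sums)
    then have "(\<Sum>\<^sub>\<infinity>i. a i * cis (d (\<kappa> i) * t)) = (\<Sum>n. f n t)" using sums sums_unique2 by blast
    then show "((\<lambda>i. a i * cis (d (\<kappa> i) * t)) has_sum (\<Sum>n. f n t)) UNIV" using S by simp
  qed
qed

lemma wiener_add:
  assumes f: "wiener \<sigma> M f" and g: "wiener \<sigma> N g" and \<sigma>: "0 \<le> \<sigma>"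
  shows "wiener \<sigma> (M + N) (\<lambda>t. f t + g t)"
proof -
  \<comment> \<open>Padding with zero functions makes a binary sum an instance of
    \<open>wiener_suminf\<close>.\<close>
  define F where "F n = (if n = 0 then f else if n = Suc 0 then g else (\<lambda>t. 0))" for n
  define B where "B n = (if n = 0 then M else if n = Suc 0 then N else 0)" for n
  have B: "B sums (M + N)"
    using sums_finite[of "{0, Suc 0}" B] by (simp add: B_def)
  have F: "(\<lambda>n. F n t) sums (f t + g t)" for t
    using sums_finite[of "{0, Suc 0}" "\<lambda>n. F n t"] by (simp add: F_def)
  have "wiener \<sigma> (B n) (F n)" for n
    using f g wiener_zero by (simp add: F_def B_def)
  from wiener_suminf(1)[OF this sums_summable[OF B] \<sigma>] show ?thesis
    using B F by (simp add: sums_iff)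
qed

text \<open>The Cauchy product, with frequencies added; \<open>len_triangle\<close> makes the weight
  submultiplicative, hence the bounds multiply.\<close>

lemma wiener_mult:
  assumes f: "wiener \<sigma> M f" and g: "wiener \<sigma> N g" and \<sigma>: "0 \<le> \<sigma>"
  shows "wiener \<sigma> (M * N) (\<lambda>t. f t * g t)"
proof -
  obtain a \<kappa> where r: "fourier_rep \<sigma> a \<kappa> M f" using f by (auto simp: wiener_def)
  obtain b \<mu> where s: "fourier_rep \<sigma> b \<mu> N g" using g by (auto simp: wiener_def)
  define u where "u n = cmod (a n) * exp (\<sigma> * len (\<kappa> n))" for n
  define v where "v n = cmod (b n) * exp (\<sigma> * len (\<mu> n))" for n
  have u: "(u has_sum infsum u UNIV) UNIV" "infsum u UNIV \<le> M"
    using r by (auto simp: u_def[abs_def] fourier_rep_def)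
  have v: "(v has_sum infsum v UNIV) UNIV" "infsum v UNIV \<le> N"
    using s by (auto simp: v_def[abs_def] fourier_rep_def)
  have u0: "0 \<le> u n" "0 \<le> v n" for n by (auto simp: u_def v_def)
  have prod: "((\<lambda>(n, m). x n * y m) has_sum X * Y) UNIV"
    if "(x has_sum X) UNIV" "(y has_sum Y) UNIV" "(\<lambda>(n, m). x n * y m) summable_on UNIV \<times> UNIV"
    for x y :: "nat \<Rightarrow> 'c::real_normed_algebra" and X Y
    using has_sum_SigmaI[of UNIV "\<lambda>(n, m). x n * y m" "\<lambda>_. UNIV" "\<lambda>n. x n * Y" "X * Y"] that
    by (auto intro: has_sum_cmult_left has_sum_cmult_right)
  have uv: "(\<lambda>(n, m). u n * v m) summable_on UNIV \<times> UNIV"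
  proof (rule summable_on_SigmaI)
    show "((\<lambda>y. case (x, y) of (n, m) \<Rightarrow> u n * v m) has_sum u x * infsum v UNIV) UNIV" for x
      using v(1) by (auto intro: has_sum_cmult_right)
    show "(\<lambda>x. u x * infsum v UNIV) summable_on UNIV"
      using has_sum_cmult_left[OF u(1)] by (rule has_sum_imp_summable)
  qed (use u0 in auto)
  show ?thesis
  proof (rule wienerI_pairs[OF prod[OF u(1) v(1) uv], where a = "\<lambda>(n, m). a n * b m"
        and \<kappa> = "\<lambda>(n, m). \<kappa> n + \<mu> m"])
    show "infsum u UNIV * infsum v UNIV \<le> M * N"
      using u(2) v(2) u0 wiener_nonneg[OF f] by (intro mult_mono) (auto intro: infsum_nonneg)
    show le: "cmod (case i of (n, m) \<Rightarrow> a n * b m) * exp (\<sigma> * len (case i of (n, m) \<Rightarrow> \<kappa> n + \<mu> m))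
        \<le> (case i of (n, m) \<Rightarrow> u n * v m)" for i
    proof (cases i)
      case (Pair n m)
      have "exp (\<sigma> * len (\<kappa> n + \<mu> m)) \<le> exp (\<sigma> * len (\<kappa> n)) * exp (\<sigma> * len (\<mu> m))"
        using mult_left_mono[OF len_triangle \<sigma>, of "\<kappa> n" "\<mu> m"]
        by (simp add: exp_add[symmetric] ring_distribs)
      then have "cmod (a n * b m) * exp (\<sigma> * len (\<kappa> n + \<mu> m)) \<le>
          cmod (a n * b m) * (exp (\<sigma> * len (\<kappa> n)) * exp (\<sigma> * len (\<mu> m)))"
        by (intro mult_left_mono) auto
      then show ?thesis by (simp add: Pair u_def v_def norm_mult mult_ac)
    qed
    fix t
    have *: "(case i of (n, m) \<Rightarrow> a n * b m) * cis (d (case i of (n, m) \<Rightarrow> \<kappa> n + \<mu> m) * t) =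
        (case i of (n, m) \<Rightarrow> (a n * cis (d (\<kappa> n) * t)) * (b m * cis (d (\<mu> m) * t)))" for i
      by (simp add: split_beta d_add ring_distribs cis_mult[symmetric] mult_ac)
    have "(\<lambda>i. cmod (case i of (n, m) \<Rightarrow> (a n * cis (d (\<kappa> n) * t)) * (b m * cis (d (\<mu> m) * t))))
        summable_on UNIV \<times> UNIV"
    proof (rule summable_on_comparison_test[OF uv])
      fix i :: "nat \<times> nat"
      have "1 \<le> exp (\<sigma> * len (case i of (n, m) \<Rightarrow> \<kappa> n + \<mu> m))"
        using \<sigma> len_nonneg by simp
      then have "cmod (case i of (n, m) \<Rightarrow> a n * b m) \<le>
          cmod (case i of (n, m) \<Rightarrow> a n * b m) * exp (\<sigma> * len (case i of (n, m) \<Rightarrow> \<kappa> n + \<mu> m))"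
        using mult_left_mono[of 1 _ "cmod (case i of (n, m) \<Rightarrow> a n * b m)"] by simp
      also note le
      finally show "cmod (case i of (n, m) \<Rightarrow> (a n * cis (d (\<kappa> n) * t)) * (b m * cis (d (\<mu> m) * t)))
          \<le> (case i of (n, m) \<Rightarrow> u n * v m)"
        by (simp add: split_beta norm_mult)
    qed auto
    then have "(\<lambda>i. case i of (n, m) \<Rightarrow> (a n * cis (d (\<kappa> n) * t)) * (b m * cis (d (\<mu> m) * t)))
        summable_on UNIV \<times> UNIV" by (rule abs_summable_summable)
    from prod[OF _ _ this, of "f t" "g t"] r s
    show "((\<lambda>i. (case i of (n, m) \<Rightarrow> a n * b m) * cis (d (case i of (n, m) \<Rightarrow> \<kappa> n + \<mu> m) * t))
        has_sum f t * g t) UNIV"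
      unfolding * by (simp add: fourier_rep_def)
  qed
qed

lemma wiener_cmult:
  assumes "wiener \<sigma> M f" "0 \<le> \<sigma>" shows "wiener \<sigma> (cmod c * M) (\<lambda>t. c * f t)"
  using wiener_mult[OF wiener_const assms] .

lemma wiener_uminus:
  assumes "wiener \<sigma> M f" "0 \<le> \<sigma>" shows "wiener \<sigma> M (\<lambda>t. - f t)"
  using wiener_cmult[OF assms, of "-1"] by simp

lemma wiener_diff:
  assumes f: "wiener \<sigma> M f" and g: "wiener \<sigma> N g" and \<sigma>: "0 \<le> \<sigma>"
  shows "wiener \<sigma> (M + N) (\<lambda>t. f t - g t)"
  using wiener_add[OF f wiener_uminus[OF g \<sigma>] \<sigma>] by simp

lemma wiener_power:
  assumes "wiener \<sigma> M f" "0 \<le> \<sigma>" shows "wiener \<sigma> (M ^ n) (\<lambda>t. f t ^ n)"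
proof (induction n)
  case 0 then show ?case using wiener_const[of \<sigma> 1] by simp
next
  case (Suc n) then show ?case using wiener_mult[OF assms(1) Suc assms(2)] by simp
qed

text \<open>The series starts at power 1, so the bound \<open>exp M - 1\<close> vanishes with
  \<open>M\<close>. This allows \<open>exp (2 * w)\<close> to be treated as a perturbation of
  1.\<close>

lemma wiener_exp_minus_1:
  assumes f: "wiener \<sigma> M f" and \<sigma>: "0 \<le> \<sigma>" shows "wiener \<sigma> (exp M - 1) (\<lambda>t. exp (f t) - 1)"
proof -
  define F where "F n t = f t ^ (n + 1) /\<^sub>R fact (n + 1)" for n t
  define B where "B n = M ^ (n + 1) /\<^sub>R fact (n + 1)" for n
  have B: "B sums (exp M - 1)"
    using sums_split_initial_segment[OF exp_converges[of M], of 1] unfolding B_def by simp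
  have F: "(\<lambda>n. F n t) sums (exp (f t) - 1)" for t
    using sums_split_initial_segment[OF exp_converges[of "f t"], of 1] unfolding F_def by simp
  have "wiener \<sigma> (B n) (F n)" for n
    using wiener_cmult[OF wiener_power[OF f \<sigma>, of "n + 1"] \<sigma>, of "of_real (inverse (fact (n + 1)))"]
    by (simp only: F_def[abs_def] B_def scaleR_conv_of_real norm_of_real) simp
  from wiener_suminf(1)[OF this sums_summable[OF B] \<sigma>] show ?thesis
    using B F by (simp add: sums_iff)
qed

lemma wiener_exp:
  assumes f: "wiener \<sigma> M f" and \<sigma>: "0 \<le> \<sigma>" shows "wiener \<sigma> (exp M) (\<lambda>t. exp (f t))"
  using wiener_add[OF wiener_exp_minus_1[OF f \<sigma>] wiener_const[of \<sigma> 1] \<sigma>] by simp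

lemma wiener_cnj:
  assumes "wiener \<sigma> M f" shows "wiener \<sigma> M (\<lambda>t. cnj (f t))"
proof -
  obtain a \<kappa> where r: "fourier_rep \<sigma> a \<kappa> M f" using assms by (auto simp: wiener_def)
  have "((\<lambda>n. cnj (a n) * cis (d (- \<kappa> n) * t)) has_sum cnj (f t)) UNIV" for t
    using has_sum_cnj_iff[of "\<lambda>n. a n * cis (d (\<kappa> n) * t)" UNIV "f t"] r
    by (simp add: fourier_rep_def d_minus cis_cnj)
  then have "fourier_rep \<sigma> (\<lambda>n. cnj (a n)) (\<lambda>n. - \<kappa> n) M (\<lambda>t. cnj (f t))"
    using r by (simp add: fourier_rep_def len_minus)
  then show ?thesis by (auto simp: wiener_def)
qed

end

section \<open>Averages and small divisors\<close>

definition has_mean :: "(real \<Rightarrow> complex) \<Rightarrow> complex \<Rightarrow> bool" where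
  "has_mean f \<mu> \<longleftrightarrow> ((\<lambda>T. integral {-T..T} f / of_real (2 * T)) \<longlongrightarrow> \<mu>) at_top"

definition mean :: "(real \<Rightarrow> complex) \<Rightarrow> complex" where
  "mean f = (THE \<mu>. has_mean f \<mu>)"

lemma has_mean_unique: "has_mean f \<mu> \<Longrightarrow> has_mean f \<nu> \<Longrightarrow> \<mu> = \<nu>"
  unfolding has_mean_def by (rule tendsto_unique[OF trivial_limit_at_top_linorder])

lemma mean_eq: "has_mean f \<mu> \<Longrightarrow> mean f = \<mu>"
  unfolding mean_def using has_mean_unique by blast

lemma continuous_integrable: "continuous_on UNIV f \<Longrightarrow> f integrable_on {a..b::real}"
  for f :: "real \<Rightarrow> complex"
  by (rule integrable_continuous_real) (rule continuous_on_subset, auto)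

lemma has_mean_add:
  assumes "has_mean f \<mu>" "has_mean g \<nu>" "continuous_on UNIV f" "continuous_on UNIV g"
  shows "has_mean (\<lambda>t. f t + g t) (\<mu> + \<nu>)"
  using tendsto_add[OF assms(1,2)[unfolded has_mean_def]] continuous_integrable assms(3,4)
  by (simp add: has_mean_def integral_add add_divide_distrib)

lemma has_mean_cmult: "has_mean f \<mu> \<Longrightarrow> has_mean (\<lambda>t. c * f t) (c * \<mu>)"
  using tendsto_mult_left[of _ \<mu> at_top c] unfolding has_mean_def
  by (simp flip: times_divide_eq_right)

lemma has_mean_const: "has_mean (\<lambda>t. c) c"
proof -
  have "\<forall>\<^sub>F T::real in at_top. integral {-T..T} (\<lambda>t. c) / of_real (2 * T) = c"
    using eventually_gt_at_top[of 0] by eventually_elim (simp add: scaleR_conv_of_real)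
  then show ?thesis unfolding has_mean_def by (rule tendsto_eventually)
qed

lemma has_mean_bound:
  assumes "has_mean f \<mu>" "continuous_on UNIV f" "\<And>t. cmod (f t) \<le> M"
  shows "cmod \<mu> \<le> M"
proof (rule tendsto_upperbound[OF tendsto_norm[OF assms(1)[unfolded has_mean_def]]])
  show "\<forall>\<^sub>F T in at_top. cmod (integral {-T..T} f / of_real (2 * T)) \<le> M"
    using eventually_gt_at_top[of 0]
  proof eventually_elim
    case (elim T)
    have "cmod (integral {-T..T} f) \<le> M * (T - (-T))"
      by (rule integral_bound) (use elim assms in \<open>auto intro: continuous_on_subset\<close>)
    then show ?case using elim by (simp add: norm_divide norm_mult divide_simps mult_ac)
  qed
qed simp

lemma has_mean_derivative:
  assumes d: "\<And>t. (F has_vector_derivative f t) (at t)" and b: "\<And>t. cmod (F t) \<le> M"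
  shows "has_mean f 0"
  unfolding has_mean_def
proof (rule Lim_null_comparison)
  show "\<forall>\<^sub>F T in at_top. cmod (integral {-T..T} f / of_real (2 * T)) \<le> M / T"
    using eventually_gt_at_top[of 0]
  proof eventually_elim
    case (elim T)
    have "(f has_integral (F T - F (-T))) {-T..T}"
      by (rule fundamental_theorem_of_calculus) (use elim d in \<open>auto intro: has_vector_derivative_at_within\<close>)
    then have "integral {-T..T} f = F T - F (-T)" by (rule integral_unique)
    moreover have "cmod (F T - F (-T)) \<le> 2 * M"
      using norm_triangle_ineq4[of "F T" "F (-T)"] b[of T] b[of "-T"] by simp
    ultimately show ?case using elim by (simp add: norm_divide norm_mult divide_simps)
  qed
  show "((\<lambda>T. M / T) \<longlongrightarrow> 0) at_top" by real_asymp
qed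

lemma has_vector_derivative_cis: "((\<lambda>t. cis (x * t)) has_vector_derivative \<i> * of_real x * cis (x * t)) (at t within S)"
  unfolding has_vector_derivative_def
  by (rule derivative_eq_intros refl | simp)+ (simp add: fun_eq_iff scaleR_conv_of_real mult_ac)

lemma has_mean_cis: "has_mean (\<lambda>t. cis (x * t)) (if x = 0 then 1 else 0)"
proof (cases "x = 0")
  case True then show ?thesis using has_mean_const[of 1] by simp
next
  case False
  have "has_mean (\<lambda>t. \<i> * of_real x * cis (x * t)) 0"
    by (rule has_mean_derivative[OF has_vector_derivative_cis, where M = 1]) simp
  from has_mean_cmult[OF this, of "1 / (\<i> * of_real x)"] False show ?thesis by simp
qed

text \<open>Tannery's theorem: the average of each term is bounded by its coefficient uniformly in
  \<open>T\<close>, so the limit may be taken termwise, and only frequency 0 survives.\<close>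

lemma has_mean_series:
  fixes a :: "nat \<Rightarrow> complex" and x :: "nat \<Rightarrow> real"
  assumes a: "summable (\<lambda>n. cmod (a n))" and f: "\<And>t. (\<lambda>n. a n * cis (x n * t)) sums f t"
  shows "has_mean f (\<Sum>n. a n * (if x n = 0 then 1 else 0))" and "continuous_on UNIV f"
proof -
  have ul: "uniform_limit UNIV (\<lambda>n t. \<Sum>i<n. a i * cis (x i * t)) f sequentially"
    using Weierstrass_m_test[of UNIV "\<lambda>n t. a n * cis (x n * t)" "\<lambda>n. cmod (a n)"] a f
    by (simp add: norm_mult sums_iff)
  show "continuous_on UNIV f"
    by (rule uniform_limit_theorem[OF _ ul]) (auto intro!: continuous_intros always_eventually)
  define A where "A k T = a k * (integral {-T..T} (\<lambda>t. cis (x k * t)) / of_real (2 * T))" for k T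
  have "((\<lambda>T. suminf (\<lambda>k. A k T)) \<longlongrightarrow> (\<Sum>n. a n * (if x n = 0 then 1 else 0))) at_top"
  proof (rule tannerys_theorem[THEN conjunct2, THEN conjunct2, OF _ _ a])
    show "((\<lambda>T. A k T) \<longlongrightarrow> a k * (if x k = 0 then 1 else 0)) at_top" for k
      unfolding A_def using has_mean_cis[of "x k"] unfolding has_mean_def by (rule tendsto_mult_left)
    have b: "cmod (A k T) \<le> cmod (a k)" if "0 < T" for k T
    proof -
      have "cmod (integral {-T..T} (\<lambda>t. cis (x k * t))) \<le> 1 * (T - (-T))"
        by (rule integral_bound) (use that in \<open>auto intro!: continuous_intros\<close>)
      then have "cmod (integral {-T..T} (\<lambda>t. cis (x k * t)) / of_real (2 * T)) \<le> 1"
        using that by (simp add: norm_divide norm_mult)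
      then show ?thesis unfolding A_def norm_mult using mult_left_le[OF _ norm_ge_zero] by blast
    qed
    show "\<forall>\<^sub>F (k, T) in at_top \<times>\<^sub>F at_top. cmod (A k T) \<le> cmod (a k)"
      unfolding eventually_prod_filter
      by (rule exI[of _ "\<lambda>_. True"], rule exI[of _ "\<lambda>T. 0 < T"]) (use b eventually_gt_at_top in auto)
  qed simp
  moreover have "suminf (\<lambda>k. A k T) = integral {-T..T} f / of_real (2 * T)" for T
  proof -
    have "uniform_limit {-T..T} (\<lambda>n t. \<Sum>i<n. a i * cis (x i * t)) f sequentially"
      using ul by (rule uniform_limit_on_subset) simp
    then obtain I J where I: "\<And>n. ((\<lambda>t. \<Sum>i<n. a i * cis (x i * t)) has_integral I n) {-T..T}"
      and J: "(f has_integral J) {-T..T}" "I \<longlonglongrightarrow> J"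
      by (rule uniform_limit_integral) (auto intro!: continuous_intros)
    have "I n = (\<Sum>i<n. a i * integral {-T..T} (\<lambda>t. cis (x i * t)))" for n
    proof -
      have "I n = integral {-T..T} (\<lambda>t. \<Sum>i<n. a i * cis (x i * t))"
        by (rule integral_unique[OF I, symmetric])
      also have "\<dots> = (\<Sum>i<n. integral {-T..T} (\<lambda>t. a i * cis (x i * t)))"
        by (rule integral_sum) (auto intro!: continuous_integrable continuous_intros)
      finally show ?thesis by simp
    qed
    then have "I = (\<lambda>n. \<Sum>i<n. a i * integral {-T..T} (\<lambda>t. cis (x i * t)))" by (rule ext)
    then have "(\<lambda>i. a i * integral {-T..T} (\<lambda>t. cis (x i * t))) sums J"
      using J(2) unfolding sums_def by metis
    from sums_divide[OF this, of "of_real (2 * T)"] show ?thesis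
      using J(1) by (simp add: A_def sums_iff integral_unique)
  qed
  ultimately show "has_mean f (\<Sum>n. a n * (if x n = 0 then 1 else 0))"
    by (simp add: has_mean_def)
qed

lemma series_has_vector_derivative:
  fixes a :: "nat \<Rightarrow> complex" and x :: "nat \<Rightarrow> real"
  assumes b: "summable (\<lambda>n. cmod (a n) * \<bar>x n\<bar>)"
    and f: "\<And>t. (\<lambda>n. a n * cis (x n * t)) sums f t"
    and g: "\<And>t. (\<lambda>n. a n * (\<i> * of_real (x n) * cis (x n * t))) sums g t"
  shows "(f has_vector_derivative g t) (at t)"
proof -
  have ul: "uniform_limit UNIV (\<lambda>n t. \<Sum>i<n. a i * (\<i> * of_real (x i) * cis (x i * t))) g sequentially"
    using Weierstrass_m_test[of UNIV "\<lambda>n t. a n * (\<i> * of_real (x n) * cis (x n * t))" "\<lambda>n. cmod (a n) * \<bar>x n\<bar>"] b g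
    by (simp add: norm_mult sums_iff)
  have "\<exists>h. \<forall>t\<in>UNIV. (\<lambda>n. a n * cis (x n * t)) sums h t \<and>
      (h has_derivative (\<lambda>y. y *\<^sub>R g t)) (at t within UNIV)"
  proof (rule has_derivative_series[where f = "\<lambda>n t. a n * cis (x n * t)" and
      f' = "\<lambda>n t y. y *\<^sub>R (a n * (\<i> * of_real (x n) * cis (x n * t)))", OF _ _ _ _ f[of 0]])
    show "((\<lambda>t. a n * cis (x n * t)) has_derivative (\<lambda>y. y *\<^sub>R (a n * (\<i> * of_real (x n) * cis (x n * t))))) (at t within UNIV)" for n t
      using has_vector_derivative_mult_right[OF has_vector_derivative_cis, of "a n" "x n" t UNIV]
      by (simp add: has_vector_derivative_def)
    fix e :: real assume "e > 0"
    then have "\<forall>\<^sub>F n in sequentially. \<forall>t\<in>UNIV. dist (\<Sum>i<n. a i * (\<i> * of_real (x i) * cis (x i * t))) (g t) < e"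
      using ul by (simp add: uniform_limit_iff)
    then show "\<forall>\<^sub>F n in sequentially. \<forall>t\<in>UNIV. \<forall>h. norm ((\<Sum>i<n. h *\<^sub>R (a i * (\<i> * of_real (x i) * cis (x i * t)))) - h *\<^sub>R g t) \<le> e * norm h"
    proof eventually_elim
      case (elim n)
      have "norm ((\<Sum>i<n. h *\<^sub>R (a i * (\<i> * of_real (x i) * cis (x i * t)))) - h *\<^sub>R g t) \<le> e * norm h" for h t
        using elim[rule_format, of t]
        mult_left_mono[of "dist (\<Sum>i<n. a i * (\<i> * of_real (x i) * cis (x i * t))) (g t)" e "\<bar>h\<bar>"]
        by (simp add: scaleR_sum_right[symmetric] scaleR_diff_right[symmetric] dist_norm mult.commute[of e])
      then show ?case by blast
    qed
  qed auto
  then obtain h where h: "\<And>t. (\<lambda>n. a n * cis (x n * t)) sums h t"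
    "\<And>t. (h has_derivative (\<lambda>y. y *\<^sub>R g t)) (at t)" by auto
  have "h = f" using h(1) f sums_unique2 by blast
  then show ?thesis using h(2) by (simp add: has_vector_derivative_def)
qed

text \<open>A single term of the exponential series is at most its sum. The inequality trades a
  power of the index length, caused by a small divisor, for a piece \<open>\<delta>\<close> of the
  analyticity width.\<close>

lemma power_times_exp_le:
  fixes x \<delta> :: real assumes "0 \<le> x" "0 < \<delta>"
  shows "x ^ m \<le> fact m / \<delta> ^ m * exp (\<delta> * x)"
proof -
  have "(\<delta> * x) ^ m / fact m \<le> exp (\<delta> * x)"
  proof -
    have "(\<Sum>n\<in>{m}. (\<delta> * x) ^ n /\<^sub>R fact n) \<le> (\<Sum>n. (\<delta> * x) ^ n /\<^sub>R fact n)"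
      by (rule sum_le_suminf[OF summable_exp_generic]) (use assms in auto)
    then show ?thesis by (simp add: exp_def divide_inverse mult_ac)
  qed
  then show ?thesis using assms by (simp add: power_mult_distrib divide_simps mult_ac)
qed

context frequency_group
begin

lemma fourier_rep_sums:
  assumes "fourier_rep \<sigma> a \<kappa> M f" "0 \<le> \<sigma>"
  shows "summable (\<lambda>n. cmod (a n))" "(\<lambda>n. a n * cis (d (\<kappa> n) * t)) sums f t"
proof -
  show "summable (\<lambda>n. cmod (a n))"
    using fourier_rep_abs_summable(1)[OF assms] by (rule summable_on_imp_summable)
  show "(\<lambda>n. a n * cis (d (\<kappa> n) * t)) sums f t"
    using assms by (auto simp: fourier_rep_def intro: has_sum_imp_sums)
qed

lemma wiener_continuous: "wiener \<sigma> M f \<Longrightarrow> 0 \<le> \<sigma> \<Longrightarrow> continuous_on UNIV f"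
  unfolding wiener_def using has_mean_series(2) fourier_rep_sums by metis

text \<open>Since \<open>d\<close> is additive and nonzero off 0, frequency 0 occurs only at index
  0, so the mean collects exactly the coefficients with \<open>\<kappa> n = 0\<close>.\<close>

lemma fourier_rep_mean:
  assumes "fourier_rep \<sigma> a \<kappa> M f" "0 \<le> \<sigma>"
  shows "has_mean f (\<Sum>n. a n * (if \<kappa> n = 0 then 1 else 0))"
proof -
  have "d k = 0 \<longleftrightarrow> k = 0" for k using d_nonzero d_zero by blast
  then show ?thesis using has_mean_series(1)[OF fourier_rep_sums[OF assms]] by simp
qed

lemma wiener_has_mean: "wiener \<sigma> M f \<Longrightarrow> 0 \<le> \<sigma> \<Longrightarrow> has_mean f (mean f)"
  unfolding wiener_def using fourier_rep_mean mean_eq by metis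

lemma wiener_mean_bound:
  assumes "wiener \<sigma> M f" "0 \<le> \<sigma>" shows "cmod (mean f) \<le> M"
  using has_mean_bound[OF wiener_has_mean[OF assms] wiener_continuous[OF assms]] wiener_bound[OF assms] by blast

lemma mean_add:
  assumes "wiener \<sigma> M f" "wiener \<sigma>' N g" "0 \<le> \<sigma>" "0 \<le> \<sigma>'"
  shows "mean (\<lambda>t. f t + g t) = mean f + mean g"
  by (intro mean_eq has_mean_add wiener_has_mean[OF assms(1,3)] wiener_has_mean[OF assms(2,4)]
      wiener_continuous[OF assms(1,3)] wiener_continuous[OF assms(2,4)])

lemma mean_cmult:
  assumes "wiener \<sigma> M f" "0 \<le> \<sigma>" shows "mean (\<lambda>t. c * f t) = c * mean f"
  by (intro mean_eq has_mean_cmult wiener_has_mean[OF assms])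

text \<open>The factor \<open>fact m / (\<gamma> \<delta>\<^sup>m)\<close> bounds \<open>len k ^ m * exp (- \<delta> * len k) / \<gamma>\<close>:
  dividing by the small divisors \<open>d k + \<xi>\<close> costs a width \<open>\<delta>\<close> of analyticity.\<close>

lemma solve_small_divisors:
  assumes f: "wiener \<sigma> M f" and div: "\<And>k. k \<noteq> 0 \<Longrightarrow> \<gamma> \<le> \<bar>d k + \<xi>\<bar> * len k ^ m"
    and \<gamma>: "0 < \<gamma>" and \<sigma>: "0 < \<sigma>"
  shows "\<exists>y. (\<forall>\<delta>. 0 < \<delta> \<and> \<delta> \<le> \<sigma> \<longrightarrow> wiener (\<sigma> - \<delta>) (fact m / (\<gamma> * \<delta> ^ m) * M) y) \<and> mean y = 0 \<and>
     (\<forall>t. (y has_vector_derivative f t - mean f - \<i> * of_real \<xi> * y t) (at t))"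
proof -
  obtain a \<kappa> where r: "fourier_rep \<sigma> a \<kappa> M f" using f by (auto simp: wiener_def)
  define C where "C \<delta> = fact m / (\<gamma> * \<delta> ^ m)" for \<delta>
  have C: "0 < C \<delta>" if "0 < \<delta>" for \<delta> using \<gamma> that by (simp add: C_def)
  have \<sigma>0: "0 \<le> \<sigma>" using \<sigma> by simp
  \<comment> \<open>Index 0 is left out: the divisor there would be \<open>\<xi>\<close>, which may
    be 0. Hence \<open>mean y = 0\<close>, and the equation is solved for
    \<open>f - mean f\<close>.\<close>
  define b where "b n = (if \<kappa> n = 0 then 0 else a n / (\<i> * of_real (d (\<kappa> n) + \<xi>)))" for n
  have nz: "d k + \<xi> \<noteq> 0" if "k \<noteq> 0" for k using div[OF that] \<gamma> by auto
  have inv: "1 / \<bar>d k + \<xi>\<bar> \<le> C \<delta> * exp (\<delta> * len k)" if "k \<noteq> 0" "0 < \<delta>" for k \<delta>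
  proof -
    have "1 / \<bar>d k + \<xi>\<bar> \<le> len k ^ m / \<gamma>" using div[OF that(1)] nz[OF that(1)] \<gamma> by (simp add: divide_simps mult_ac)
    also have "\<dots> \<le> (fact m / \<delta> ^ m * exp (\<delta> * len k)) / \<gamma>"
      using power_times_exp_le[OF len_nonneg that(2)] \<gamma> by (intro divide_right_mono) auto
    finally show "1 / \<bar>d k + \<xi>\<bar> \<le> C \<delta> * exp (\<delta> * len k)" by (simp add: C_def mult_ac)
  qed
  define u where "u n = cmod (a n) * exp (\<sigma> * len (\<kappa> n))" for n
  have bu: "cmod (b n) * exp ((\<sigma> - \<delta>) * len (\<kappa> n)) \<le> C \<delta> * u n" if "0 < \<delta>" for n \<delta>
  proof (cases "\<kappa> n = 0")
    case True then show ?thesis using C[OF that] by (simp add: b_def u_def)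
  next
    case False
    have "cmod (b n) = cmod (a n) * (1 / \<bar>d (\<kappa> n) + \<xi>\<bar>)"
      using False by (simp add: b_def norm_divide norm_mult flip: of_real_add)
    also have "\<dots> \<le> cmod (a n) * (C \<delta> * exp (\<delta> * len (\<kappa> n)))"
      by (intro mult_left_mono inv False that) auto
    finally have "cmod (b n) * exp ((\<sigma> - \<delta>) * len (\<kappa> n)) \<le>
        cmod (a n) * (C \<delta> * exp (\<delta> * len (\<kappa> n))) * exp ((\<sigma> - \<delta>) * len (\<kappa> n))"
      by (rule mult_right_mono) simp
    also have "\<dots> = C \<delta> * (cmod (a n) * (exp (\<delta> * len (\<kappa> n)) * exp ((\<sigma> - \<delta>) * len (\<kappa> n))))"
      by (simp only: mult_ac)
    also have "\<dots> = C \<delta> * u n" by (simp add: u_def exp_add[symmetric] algebra_simps)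
    finally show ?thesis .
  qed
  have u: "u summable_on UNIV" "infsum u UNIV \<le> M" using r by (auto simp: fourier_rep_def u_def[abs_def])
  \<comment> \<open>Spending the whole width, \<open>\<delta> = \<sigma>\<close>, leaves plain
    absolute summability of \<open>b\<close>, which defines \<open>y\<close> independently of
    \<open>\<delta>\<close>.\<close>
  have b_le: "cmod (b n) \<le> C \<sigma> * u n" for n using bu[OF \<sigma>, of n] by simp
  have us: "summable u" using u(1) by (rule summable_on_imp_summable)
  have b_abs: "summable (\<lambda>n. cmod (b n))"
    by (rule summable_comparison_test'[OF summable_mult[OF us, of "C \<sigma>"], of 0]) (use b_le in auto)
  define y where "y t = (\<Sum>n. b n * cis (d (\<kappa> n) * t))" for t
  have bs: "summable (\<lambda>n. norm (b n * cis (d (\<kappa> n) * t)))" for t using b_abs by (simp add: norm_mult)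
  have y: "(\<lambda>n. b n * cis (d (\<kappa> n) * t)) sums y t" for t
    unfolding y_def by (rule summable_sums[OF summable_norm_cancel[OF bs]])
  have rep: "fourier_rep (\<sigma> - \<delta>) b \<kappa> (C \<delta> * M) y" if "0 < \<delta>" for \<delta>
  proof (rule fourier_repI)
    show "((\<lambda>n. C \<delta> * u n) has_sum C \<delta> * infsum u UNIV) UNIV" using u(1) by (intro has_sum_cmult_right) simp
    show "C \<delta> * infsum u UNIV \<le> C \<delta> * M" using u(2) C[OF that] by simp
    show "((\<lambda>n. b n * cis (d (\<kappa> n) * t)) has_sum y t) UNIV" for t
      using norm_summable_imp_has_sum[OF bs y] .
  qed (rule bu[OF that])
  have zero: "(\<lambda>n. b n * (if \<kappa> n = 0 then 1 else 0)) = (\<lambda>n. 0)" by (auto simp: b_def)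
  have "mean y = 0" using mean_eq[OF fourier_rep_mean[OF rep[OF \<sigma>]]] unfolding zero by simp
  moreover have "(y has_vector_derivative f t - mean f - \<i> * of_real \<xi> * y t) (at t)" for t
  proof (rule series_has_vector_derivative[OF _ y])
    \<comment> \<open>The differential equation read off coefficientwise. It also shows that
      \<open>b\<close> stays summable after multiplication by the frequencies, which may be
      unbounded.\<close>
    have alg: "b n * (\<i> * of_real (d (\<kappa> n))) = a n - a n * (if \<kappa> n = 0 then 1 else 0) - \<i> * of_real \<xi> * b n" for n
    proof (cases "\<kappa> n = 0")
      case True then show ?thesis by (simp add: b_def)
    next
      case False
      have "b n * (\<i> * of_real (d (\<kappa> n))) + \<i> * of_real \<xi> * b n = b n * (\<i> * of_real (d (\<kappa> n) + \<xi>))"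
        by (simp add: ring_distribs mult_ac)
      also have "\<dots> = a n" using False nz[of "\<kappa> n"] by (simp add: b_def flip: of_real_add)
      finally show ?thesis using False by (simp add: algebra_simps)
    qed
    have a_abs: "summable (\<lambda>n. cmod (a n))" using fourier_rep_sums(1)[OF r \<sigma>0] .
    have "cmod (b n) * \<bar>d (\<kappa> n)\<bar> \<le> cmod (a n) + \<bar>\<xi>\<bar> * cmod (b n)" for n
    proof -
      have "cmod (b n) * \<bar>d (\<kappa> n)\<bar> = cmod (b n * (\<i> * of_real (d (\<kappa> n))))" by (simp add: norm_mult)
      also have "\<dots> \<le> cmod (a n - a n * (if \<kappa> n = 0 then 1 else 0)) + cmod (\<i> * of_real \<xi> * b n)"
        unfolding alg by (rule norm_triangle_ineq4)
      also have "\<dots> \<le> cmod (a n) + \<bar>\<xi>\<bar> * cmod (b n)" by (simp add: norm_mult)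
      finally show ?thesis .
    qed
    then show "summable (\<lambda>n. cmod (b n) * \<bar>d (\<kappa> n)\<bar>)"
      by (intro summable_comparison_test'[OF summable_add[OF a_abs summable_mult[OF b_abs, of "\<bar>\<xi>\<bar>"]], of 0]) auto
    fix t
    have m0: "(\<lambda>n. a n * (if \<kappa> n = 0 then 1 else 0)) sums mean f"
      unfolding mean_eq[OF fourier_rep_mean[OF r \<sigma>0]]
      by (rule summable_sums, rule summable_norm_cancel, rule summable_comparison_test'[OF a_abs, of 0]) auto
    have "(\<lambda>n. a n * cis (d (\<kappa> n) * t) - a n * (if \<kappa> n = 0 then 1 else 0) - \<i> * of_real \<xi> * (b n * cis (d (\<kappa> n) * t)))
        sums (f t - mean f - \<i> * of_real \<xi> * y t)"
      by (intro sums_diff sums_mult fourier_rep_sums(2)[OF r \<sigma>0] m0 y)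
    moreover have "a n * cis (d (\<kappa> n) * t) - a n * (if \<kappa> n = 0 then 1 else 0) - \<i> * of_real \<xi> * (b n * cis (d (\<kappa> n) * t))
        = b n * (\<i> * of_real (d (\<kappa> n)) * cis (d (\<kappa> n) * t))" for n
    proof -
      have "b n * (\<i> * of_real (d (\<kappa> n)) * cis (d (\<kappa> n) * t)) =
          (b n * (\<i> * of_real (d (\<kappa> n)))) * cis (d (\<kappa> n) * t)" by (simp only: mult_ac)
      also have "\<dots> = a n * cis (d (\<kappa> n) * t) - a n * (if \<kappa> n = 0 then 1 else 0) * cis (d (\<kappa> n) * t)
          - \<i> * of_real \<xi> * (b n * cis (d (\<kappa> n) * t))"
        unfolding alg by (simp add: algebra_simps)
      finally show ?thesis by (simp add: d_zero)
    qed
    ultimately show "(\<lambda>n. b n * (\<i> * of_real (d (\<kappa> n)) * cis (d (\<kappa> n) * t)))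
        sums (f t - mean f - \<i> * of_real \<xi> * y t)" by simp
  qed
  ultimately show ?thesis using rep unfolding C_def wiener_def by blast
qed

end

section \<open>The Newton step\<close>

lemma has_vector_derivative_exp:
  fixes w :: "real \<Rightarrow> complex"
  assumes "(w has_vector_derivative v) (at t)"
  shows "((\<lambda>t. exp (c * w t)) has_vector_derivative c * v * exp (c * w t)) (at t)"
  using field_vector_diff_chain_at[OF has_vector_derivative_mult_right[OF assms, of c] DERIV_exp]
  by (simp add: o_def)

lemma exp_minus_one_le: "0 \<le> x \<Longrightarrow> x \<le> 1 \<Longrightarrow> exp x - 1 \<le> 2 * (x::real)"
  using exp_bound[of x] by (simp add: power2_eq_square) (smt (verit) mult_left_le)

locale hill_frequency_group = frequency_group d len
  for d len :: "'k::ab_group_add \<Rightarrow> real" +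
  fixes a :: "real \<Rightarrow> real" and abar \<sigma>\<^sub>0 A \<gamma> :: real and m :: nat
  assumes a: "wiener \<sigma>\<^sub>0 A (\<lambda>t. of_real (a t))"
    and a_mean: "has_mean (\<lambda>t. of_real (a t)) (of_real abar)"
    and abar: "0 < abar" and \<sigma>\<^sub>0: "0 < \<sigma>\<^sub>0" "\<sigma>\<^sub>0 \<le> 1" and \<gamma>: "0 < \<gamma>"
    and small_divisors: "k \<noteq> 0 \<Longrightarrow> \<gamma> \<le> \<bar>d k\<bar> * len k ^ m"
begin

lemma abar_le: "abar \<le> A"
  using wiener_mean_bound[OF a] mean_eq[OF a_mean] abar \<sigma>\<^sub>0 by simp

lemma A_pos: "0 < A" using abar_le abar by simp

text \<open>Index 0 is excluded because its divisor \<open>2 * \<nu>\<close> shrinks with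
  \<open>\<nu>\<close> and is tracked as an explicit factor. The constants \<open>\<gamma>\<close>
  and \<open>m\<close> are those of \<open>small_divisors\<close>, so both kinds of equation obey
  the same estimate.\<close>

definition nonresonant :: "real \<Rightarrow> bool" where
  "nonresonant \<nu> \<longleftrightarrow> (\<forall>k. k \<noteq> 0 \<longrightarrow> \<gamma> \<le> \<bar>d k + 2 * \<nu>\<bar> * len k ^ m)"

text \<open>Up to the error \<open>E\<close>, \<open>exp (\<i> \<nu> t + w t)\<close> solves Hill's equation.\<close>

definition approx_floquet ::
  "real \<Rightarrow> complex \<Rightarrow> (real \<Rightarrow> complex) \<Rightarrow> (real \<Rightarrow> complex) \<Rightarrow> (real \<Rightarrow> complex) \<Rightarrow> bool" where
  "approx_floquet \<nu> \<epsilon> E w v \<longleftrightarrow>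
     (\<forall>t. (w has_vector_derivative v t) (at t) \<and>
          (v has_vector_derivative
             E t - 2 * \<i> * of_real \<nu> * v t - (v t)\<^sup>2 + (of_real \<nu>)\<^sup>2 - \<epsilon> * of_real (a t)) (at t))"

text \<open>One summand for the indices other than 0, where division costs
  \<open>fact m / (\<gamma> * \<delta> ^ m)\<close>, and one for the mean, which is divided by
  \<open>2 * \<nu>\<close>.\<close>

definition C\<^sub>0 :: real where "C\<^sub>0 = fact m / \<gamma> + 1"

text \<open>The size allowed for \<open>w\<close>. It gives
  \<open>4 * \<beta>\<^sub>0 * A = abar / 8\<close> and
  \<open>4 * \<beta>\<^sub>0 \<le> 1 / 8\<close>, so that replacing \<open>exp (2 * w)\<close> or
  \<open>exp (- 2 * w)\<close> by 1 changes the relevant means by at most one eighth.\<close>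

definition \<beta>\<^sub>0 :: real where "\<beta>\<^sub>0 = abar / (32 * A)"

text \<open>Bounds \<open>\<eta> = - p / q\<close> in the Newton step: \<open>4 * C\<^sub>0\<close>
  from the bound of \<open>p\<close>, divided by \<open>abar / 4\<close> from the lower bound of
  \<open>q\<close>; the factors \<open>1 / \<nu>\<close> cancel.\<close>

definition C\<^sub>1 :: real where "C\<^sub>1 = 16 * C\<^sub>0 / abar"

text \<open>Bounds \<open>h\<close> in the Newton step: \<open>4 * C\<^sub>0\<close> for the source
  \<open>E\<close>, and \<open>4 * C\<^sub>0 * C\<^sub>1 * A\<close> for the source
  \<open>\<eta> * a\<close>.\<close>

definition C\<^sub>2 :: real where "C\<^sub>2 = 4 * C\<^sub>0 * (1 + C\<^sub>1 * A)"

text \<open>Up to this size of \<open>\<nu>\<close>, and for widths of at least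
  \<open>\<sigma>\<^sub>0 / 2\<close>, the indices other than 0 contribute at most
  \<open>abar / (8 * \<nu>)\<close> to the parameter derivative.\<close>

definition \<nu>\<^sub>0 :: real where "\<nu>\<^sub>0 = min 1 (abar * \<gamma> * (\<sigma>\<^sub>0 / 2) ^ m / (32 * A * fact m))"

lemma C\<^sub>0: "1 \<le> C\<^sub>0" using \<gamma> by (simp add: C\<^sub>0_def)

lemma C\<^sub>1: "0 < C\<^sub>1" using C\<^sub>0 abar by (simp add: C\<^sub>1_def)

lemma C\<^sub>2: "0 < C\<^sub>2" using C\<^sub>0 C\<^sub>1 A_pos unfolding C\<^sub>2_def by (intro mult_pos_pos add_pos_pos) auto

lemma \<beta>\<^sub>0: "0 < \<beta>\<^sub>0" "\<beta>\<^sub>0 \<le> 1 / 32" "4 * \<beta>\<^sub>0 * A = abar / 8"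
  using abar abar_le A_pos by (simp_all add: \<beta>\<^sub>0_def divide_simps)

lemma \<nu>\<^sub>0: "0 < \<nu>\<^sub>0" "\<nu>\<^sub>0 \<le> 1"
  using abar A_pos \<gamma> \<sigma>\<^sub>0 by (simp_all add: \<nu>\<^sub>0_def)

lemma exp_small:
  assumes "wiener \<sigma> \<beta> w" "0 \<le> \<sigma>" "\<beta> \<le> \<beta>\<^sub>0" "cmod c \<le> 2"
  shows "wiener \<sigma> 2 (\<lambda>t. exp (c * w t))" "wiener \<sigma> (4 * \<beta>\<^sub>0) (\<lambda>t. exp (c * w t) - 1)"
proof -
  have \<beta>: "0 \<le> \<beta>" using assms(1) wiener_nonneg by blast
  have w: "wiener \<sigma> (2 * \<beta>\<^sub>0) (\<lambda>t. c * w t)"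
    by (rule wiener_mono[OF wiener_cmult[OF assms(1,2)]])
       (use assms \<beta> mult_mono[OF assms(4,3)] in auto)
  have "exp (2 * \<beta>\<^sub>0) - 1 \<le> 4 * \<beta>\<^sub>0"
    using exp_minus_one_le[of "2 * \<beta>\<^sub>0"] \<beta>\<^sub>0 by simp
  then show 1: "wiener \<sigma> (4 * \<beta>\<^sub>0) (\<lambda>t. exp (c * w t) - 1)"
    by (intro wiener_mono[OF wiener_exp_minus_1[OF w assms(2)]]) auto
  show "wiener \<sigma> 2 (\<lambda>t. exp (c * w t))"
    by (rule wiener_mono[OF wiener_exp[OF w assms(2)]])
       (use \<beta>\<^sub>0 exp_minus_one_le[of "2 * \<beta>\<^sub>0"] in auto)
qed

text \<open>\<open>y\<close> carries the indices other than 0 and its bound is free of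
  \<open>1 / \<nu>\<close>; only the constant \<open>mean f / (2 * \<i> * of_real \<nu>)\<close>
  pays for the divisor at index 0. Both bounds are stated: the first serves where \<open>y\<close>
  must be negligible against \<open>1 / \<nu>\<close>, the second in the Newton step.\<close>

lemma solve_shifted:
  assumes f: "wiener \<sigma> M f" and nr: "nonresonant \<nu>" and \<nu>: "0 < \<nu>" "\<nu> \<le> 1" and \<sigma>: "0 < \<sigma>"
  obtains y where "\<And>\<delta>. 0 < \<delta> \<Longrightarrow> \<delta> \<le> \<sigma> \<Longrightarrow> wiener (\<sigma> - \<delta>) (fact m / (\<gamma> * \<delta> ^ m) * M) y"
    and "mean y = 0"
    and "\<And>t. ((\<lambda>t. y t + mean f / (2 * \<i> * of_real \<nu>)) has_vector_derivative
           f t - 2 * \<i> * of_real \<nu> * (y t + mean f / (2 * \<i> * of_real \<nu>))) (at t)"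
    and "\<And>\<delta>. 0 < \<delta> \<Longrightarrow> \<delta> \<le> \<sigma> \<Longrightarrow> \<delta> \<le> 1 \<Longrightarrow>
           wiener (\<sigma> - \<delta>) (C\<^sub>0 / (\<nu> * \<delta> ^ m) * M) (\<lambda>t. y t + mean f / (2 * \<i> * of_real \<nu>))"
proof -
  have "\<exists>y. (\<forall>\<delta>. 0 < \<delta> \<and> \<delta> \<le> \<sigma> \<longrightarrow> wiener (\<sigma> - \<delta>) (fact m / (\<gamma> * \<delta> ^ m) * M) y) \<and> mean y = 0 \<and>
     (\<forall>t. (y has_vector_derivative f t - mean f - \<i> * of_real (2 * \<nu>) * y t) (at t))"
    by (rule solve_small_divisors[OF f _ \<gamma> \<sigma>]) (use nr in \<open>simp add: nonresonant_def\<close>)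
  then obtain y where y: "\<And>\<delta>. 0 < \<delta> \<Longrightarrow> \<delta> \<le> \<sigma> \<Longrightarrow> wiener (\<sigma> - \<delta>) (fact m / (\<gamma> * \<delta> ^ m) * M) y"
    "mean y = 0" "\<And>t. (y has_vector_derivative f t - mean f - \<i> * of_real (2 * \<nu>) * y t) (at t)" by blast
  have M: "0 \<le> M" using f wiener_nonneg by blast
  show thesis
  proof (rule that[OF y(1,2)])
    show "((\<lambda>t. y t + mean f / (2 * \<i> * of_real \<nu>)) has_vector_derivative
        f t - 2 * \<i> * of_real \<nu> * (y t + mean f / (2 * \<i> * of_real \<nu>))) (at t)" for t
      using has_vector_derivative_add[OF y(3)[of t] has_vector_derivative_const[of "mean f / (2 * \<i> * of_real \<nu>)"]] \<nu>
      by (simp add: ring_distribs mult_ac algebra_simps)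
    fix \<delta> :: real assume \<delta>: "0 < \<delta>" "\<delta> \<le> \<sigma>" "\<delta> \<le> 1"
    have dm: "0 < \<delta> ^ m" "\<delta> ^ m \<le> 1" using \<delta> by (auto simp: power_le_one)
    have "cmod (mean f / (2 * \<i> * of_real \<nu>)) \<le> 1 / \<nu> * M"
      using wiener_mean_bound[OF f] \<sigma> \<nu> M by (simp add: norm_divide norm_mult divide_simps)
    also have "\<dots> \<le> 1 / (\<nu> * \<delta> ^ m) * M"
      using \<nu> dm M by (intro mult_right_mono divide_left_mono) (auto simp: mult_left_le)
    finally have 1: "cmod (mean f / (2 * \<i> * of_real \<nu>)) \<le> 1 / (\<nu> * \<delta> ^ m) * M" .
    have "fact m / (\<gamma> * \<delta> ^ m) * M = fact m / \<gamma> * (1 / \<delta> ^ m) * M" by simp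
    also have "\<dots> \<le> fact m / \<gamma> * (1 / (\<nu> * \<delta> ^ m)) * M"
      using \<nu> dm M \<gamma> by (intro mult_right_mono mult_left_mono divide_left_mono) auto
    finally have 2: "fact m / (\<gamma> * \<delta> ^ m) * M \<le> fact m / \<gamma> * (1 / (\<nu> * \<delta> ^ m)) * M" .
    show "wiener (\<sigma> - \<delta>) (C\<^sub>0 / (\<nu> * \<delta> ^ m) * M) (\<lambda>t. y t + mean f / (2 * \<i> * of_real \<nu>))"
    proof (rule wiener_mono[OF wiener_add[OF y(1)[OF \<delta>(1,2)] wiener_const]])
      have "C\<^sub>0 / (\<nu> * \<delta> ^ m) * M = fact m / \<gamma> * (1 / (\<nu> * \<delta> ^ m)) * M + 1 / (\<nu> * \<delta> ^ m) * M"
        by (simp add: C\<^sub>0_def ring_distribs add_divide_distrib)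
      then show "fact m / (\<gamma> * \<delta> ^ m) * M + cmod (mean f / (2 * \<i> * of_real \<nu>)) \<le> C\<^sub>0 / (\<nu> * \<delta> ^ m) * M"
        using 1 2 by linarith
    qed (use \<delta> in auto)
  qed
qed

text \<open>The quantity \<open>mean (exp (- 2 w) Y)\<close> is the derivative of the mean of the corrected
  \<open>v\<close> with respect to the parameter \<open>\<epsilon>\<close>; it is close to \<open>\<i> * abar / (2 \<nu>)\<close>.\<close>

lemma parameter_derivative_lower_bound:
  assumes w: "wiener \<sigma> \<beta> w" "\<beta> \<le> \<beta>\<^sub>0" and \<sigma>: "\<sigma>\<^sub>0 / 2 \<le> \<sigma>" "\<sigma> \<le> \<sigma>\<^sub>0"
    and \<nu>: "0 < \<nu>" "\<nu> \<le> \<nu>\<^sub>0" and f: "\<And>t. f t = - (exp (2 * w t) * of_real (a t))"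
    and y: "\<And>\<delta>. 0 < \<delta> \<Longrightarrow> \<delta> \<le> \<sigma> \<Longrightarrow> wiener (\<sigma> - \<delta>) (fact m / (\<gamma> * \<delta> ^ m) * (2 * A)) y"
  shows "abar / (4 * \<nu>) \<le> cmod (mean (\<lambda>t. exp (- 2 * w t) * (y t + mean f / (2 * \<i> * of_real \<nu>))))"
proof -
  have \<sigma>pos: "0 < \<sigma>" "0 \<le> \<sigma>" using \<sigma> \<sigma>\<^sub>0 by auto
  have a': "wiener \<sigma> A (\<lambda>t. of_real (a t))" using wiener_mono[OF a \<sigma>(2)] by simp
  have e: "wiener \<sigma> 2 (\<lambda>t. exp (- 2 * w t))" "wiener \<sigma> (4 * \<beta>\<^sub>0) (\<lambda>t. exp (- 2 * w t) - 1)"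
    "wiener \<sigma> (4 * \<beta>\<^sub>0) (\<lambda>t. exp (2 * w t) - 1)"
    using exp_small[OF w(1) \<sigma>pos(2) w(2), of "-2"] exp_small[OF w(1) \<sigma>pos(2) w(2), of 2] by auto
  have e0: "wiener 0 2 (\<lambda>t. exp (- 2 * w t))" using wiener_mono[OF e(1) \<sigma>pos(2)] by simp
  define Cs where "Cs = fact m / (\<gamma> * \<sigma> ^ m)"
  \<comment> \<open>A mean needs no analyticity, so the full width is spent here with
    \<open>\<delta> = \<sigma>\<close>.\<close>
  have y0: "wiener 0 (Cs * (2 * A)) y" using y[of \<sigma>] \<sigma>pos by (simp add: Cs_def)
  have Y1: "cmod (mean (\<lambda>t. exp (- 2 * w t) * y t)) \<le> 2 * (Cs * (2 * A))"
    by (rule wiener_mean_bound[OF wiener_mult[OF e0 y0]]) auto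
  have Cs: "Cs \<le> fact m / (\<gamma> * (\<sigma>\<^sub>0 / 2) ^ m)"
    unfolding Cs_def using \<gamma> \<sigma>\<^sub>0 \<sigma> by (intro divide_left_mono mult_left_mono power_mono mult_pos_pos) auto
  have "4 * A * Cs \<le> 4 * A * (fact m / (\<gamma> * (\<sigma>\<^sub>0 / 2) ^ m))" using Cs A_pos by (intro mult_left_mono) auto
  also have "\<dots> \<le> abar / (8 * \<nu>)"
  proof -
    have "\<nu> \<le> abar * \<gamma> * (\<sigma>\<^sub>0 / 2) ^ m / (32 * A * fact m)" using \<nu>(2) by (simp add: \<nu>\<^sub>0_def)
    then have "\<nu> * (32 * A * fact m) \<le> abar * (\<gamma> * (\<sigma>\<^sub>0 / 2) ^ m)"
      using A_pos by (simp only: pos_le_divide_eq mult_pos_pos zero_less_numeral fact_gt_zero mult_ac)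
    moreover have "0 < \<gamma> * (\<sigma>\<^sub>0 / 2) ^ m" using \<gamma> \<sigma>\<^sub>0 by simp
    moreover have "4 * A * (F / G) \<le> abar / (8 * \<nu>)" if "\<nu> * (32 * A * F) \<le> abar * G" "0 < G" for F G
      using that \<nu>(1) by (simp add: divide_simps mult_ac)
    ultimately show ?thesis by blast
  qed
  finally have Y1': "cmod (mean (\<lambda>t. exp (- 2 * w t) * y t)) \<le> abar / (8 * \<nu>)" using Y1 by (simp add: mult_ac)
  define n1 where "n1 = mean (\<lambda>t. (exp (2 * w t) - 1) * of_real (a t))"
  define n2 where "n2 = mean (\<lambda>t. exp (- 2 * w t) - 1)"
  have n1: "cmod n1 \<le> abar / 8"
    using wiener_mean_bound[OF wiener_mult[OF e(3) a']] \<sigma>pos \<beta>\<^sub>0(3) by (simp add: n1_def)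
  have n2: "cmod n2 \<le> 1 / 8"
    using wiener_mean_bound[OF e(2)] \<sigma>pos \<beta>\<^sub>0(2) by (simp add: n2_def)
  have mf: "mean f = - (of_real abar + n1)"
  proof -
    have "f = (\<lambda>t. -1 * (of_real (a t) + (exp (2 * w t) - 1) * of_real (a t)))"
      using f by (auto simp: algebra_simps)
    then show ?thesis
      using mean_cmult[OF wiener_add[OF a' wiener_mult[OF e(3) a']], of "-1"] \<sigma>pos
        mean_add[OF a' wiener_mult[OF e(3) a']] mean_eq[OF a_mean] by (simp add: n1_def)
  qed
  have me: "mean (\<lambda>t. exp (- 2 * w t)) = 1 + n2"
    using mean_add[OF wiener_const[of \<sigma> 1] e(2)] \<sigma>pos mean_eq[OF has_mean_const[of 1]] by (simp add: n2_def)
  \<comment> \<open>Two relative errors of one eighth leave \<open>49 / 64\<close>, which exceeds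
    \<open>3 / 4\<close>.\<close>
  have "(3::real) / 4 * abar \<le> (abar - abar / 8) * (1 - 1 / 8)" using abar by simp
  also have "\<dots> \<le> cmod (mean f) * cmod (1 + n2)"
  proof (rule mult_mono)
    show "abar - abar / 8 \<le> cmod (mean f)"
      using norm_triangle_ineq2[of "of_real abar" "- n1"] n1 abar by (simp add: mf norm_minus_cancel[of "_ + _"] del: minus_add_distrib)
    show "1 - 1 / 8 \<le> cmod (1 + n2)" using norm_triangle_ineq2[of 1 "- n2"] n2 by simp
  qed (use abar in auto)
  finally have main: "3 / 4 * abar \<le> cmod (mean f * (1 + n2))" by (simp add: norm_mult)
  have split: "(\<lambda>t. exp (- 2 * w t) * (y t + mean f / (2 * \<i> * of_real \<nu>))) =
      (\<lambda>t. exp (- 2 * w t) * y t + mean f / (2 * \<i> * of_real \<nu>) * exp (- 2 * w t))"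
    by (simp add: algebra_simps)
  have "mean (\<lambda>t. exp (- 2 * w t) * (y t + mean f / (2 * \<i> * of_real \<nu>))) =
      mean (\<lambda>t. exp (- 2 * w t) * y t) + mean f / (2 * \<i> * of_real \<nu>) * (1 + n2)"
    unfolding split me[symmetric] mean_cmult[OF e0 order_refl, symmetric]
    by (rule mean_add[OF wiener_mult[OF e0 y0] wiener_cmult[OF e0]]) simp_all
  moreover have "cmod (mean f / (2 * \<i> * of_real \<nu>) * (1 + n2)) = cmod (mean f * (1 + n2)) / (2 * \<nu>)"
    using \<nu> by (simp add: norm_mult norm_divide)
  moreover have "(3 / 4 * abar) / (2 * \<nu>) \<le> cmod (mean f * (1 + n2)) / (2 * \<nu>)"
    using main \<nu> by (intro divide_right_mono) auto
  \<comment> \<open>Of the main part \<open>3 * abar / (8 * \<nu>)\<close>, the share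
    \<open>abar / (8 * \<nu>)\<close> pays for the term with \<open>y\<close>.\<close>
  moreover have "(3 / 4 * abar) / (2 * \<nu>) = abar / (4 * \<nu>) + abar / (8 * \<nu>)" by (simp add: divide_simps)
  ultimately show ?thesis
    using Y1' norm_diff_ineq[of "mean f / (2 * \<i> * of_real \<nu>) * (1 + n2)" "mean (\<lambda>t. exp (- 2 * w t) * y t)"]
    by (simp add: add.commute)
qed

text \<open>The integrating factor \<open>exp (2 * w)\<close> gives the linearized equation constant
  coefficients. It is solved separately for the sources \<open>E\<close> and \<open>a\<close>, and
  \<open>\<eta>\<close> is fixed afterwards by linearity. One \<open>\<delta>\<close> of width is
  spent on this, a second one on integrating \<open>h\<close> to the increment
  \<open>\<Delta>\<close> of \<open>w\<close>. The remaining error is the square of \<open>h\<close>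
  because the Riccati equation is exactly quadratic.\<close>

lemma newton_step:
  assumes nr: "nonresonant \<nu>" and \<nu>: "0 < \<nu>" "\<nu> \<le> \<nu>\<^sub>0"
    and w: "wiener \<sigma> \<beta> w" "\<beta> \<le> \<beta>\<^sub>0" and E: "wiener \<sigma> e E"
    and \<sigma>: "\<sigma>\<^sub>0 / 2 \<le> \<sigma>" "\<sigma> \<le> \<sigma>\<^sub>0" and \<delta>: "0 < \<delta>" "\<delta> \<le> 1" "2 * \<delta> \<le> \<sigma>"
    and fl: "approx_floquet \<nu> \<epsilon> E w v"
  defines "H \<equiv> C\<^sub>2 * e / (\<nu> * \<delta> ^ m * \<delta> ^ m)"
  shows "\<exists>\<Delta> h \<eta>. wiener (\<sigma> - 2 * \<delta>) (C\<^sub>0 / \<delta> ^ m * H) \<Delta> \<and> wiener (\<sigma> - 2 * \<delta>) H h \<and>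
     cmod \<eta> \<le> C\<^sub>1 * e / \<delta> ^ m \<and>
     approx_floquet \<nu> (\<epsilon> + \<eta>) (\<lambda>t. (h t)\<^sup>2) (\<lambda>t. w t + \<Delta> t) (\<lambda>t. v t + h t)"
proof -
  have e: "0 \<le> e" using E wiener_nonneg by blast
  have \<sigma>pos: "0 < \<sigma>" "0 \<le> \<sigma>" "0 \<le> \<sigma> - \<delta>" "0 < \<sigma> - \<delta>" "\<delta> \<le> \<sigma>" using \<sigma> \<sigma>\<^sub>0 \<delta> by auto
  have \<nu>1: "\<nu> \<le> 1" using \<nu> \<nu>\<^sub>0 by simp
  have dm: "0 < \<delta> ^ m" "\<delta> ^ m \<le> 1" using \<delta> by (auto simp: power_le_one)
  have a': "wiener \<sigma> A (\<lambda>t. of_real (a t))" using wiener_mono[OF a \<sigma>(2)] by simp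
  have ex: "wiener \<sigma> 2 (\<lambda>t. exp (2 * w t))" "wiener \<sigma> 2 (\<lambda>t. exp (- 2 * w t))"
    using exp_small[OF w(1) \<sigma>pos(2) w(2), of "-2"] exp_small[OF w(1) \<sigma>pos(2) w(2), of 2] by auto
  define fE where "fE t = - (exp (2 * w t) * E t)" for t
  define fa where "fa t = - (exp (2 * w t) * of_real (a t))" for t
  have fE: "wiener \<sigma> (2 * e) fE"
    unfolding fE_def by (intro wiener_uminus wiener_mult ex E \<sigma>pos)
  have fa: "wiener \<sigma> (2 * A) fa"
    unfolding fa_def by (intro wiener_uminus wiener_mult ex a' \<sigma>pos)
  obtain yE where yE: "\<And>t. ((\<lambda>t. yE t + mean fE / (2 * \<i> * of_real \<nu>)) has_vector_derivative
           fE t - 2 * \<i> * of_real \<nu> * (yE t + mean fE / (2 * \<i> * of_real \<nu>))) (at t)"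
    "\<And>\<delta>. 0 < \<delta> \<Longrightarrow> \<delta> \<le> \<sigma> \<Longrightarrow> \<delta> \<le> 1 \<Longrightarrow>
           wiener (\<sigma> - \<delta>) (C\<^sub>0 / (\<nu> * \<delta> ^ m) * (2 * e)) (\<lambda>t. yE t + mean fE / (2 * \<i> * of_real \<nu>))"
    using solve_shifted[OF fE nr \<nu>(1) \<nu>1 \<sigma>pos(1)] by metis
  obtain ya where ya0: "\<And>\<delta>. 0 < \<delta> \<Longrightarrow> \<delta> \<le> \<sigma> \<Longrightarrow> wiener (\<sigma> - \<delta>) (fact m / (\<gamma> * \<delta> ^ m) * (2 * A)) ya"
    and ya: "\<And>t. ((\<lambda>t. ya t + mean fa / (2 * \<i> * of_real \<nu>)) has_vector_derivative
           fa t - 2 * \<i> * of_real \<nu> * (ya t + mean fa / (2 * \<i> * of_real \<nu>))) (at t)"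
    "\<And>\<delta>. 0 < \<delta> \<Longrightarrow> \<delta> \<le> \<sigma> \<Longrightarrow> \<delta> \<le> 1 \<Longrightarrow>
           wiener (\<sigma> - \<delta>) (C\<^sub>0 / (\<nu> * \<delta> ^ m) * (2 * A)) (\<lambda>t. ya t + mean fa / (2 * \<i> * of_real \<nu>))"
    using solve_shifted[OF fa nr \<nu>(1) \<nu>1 \<sigma>pos(1)] by metis
  define YE where "YE t = yE t + mean fE / (2 * \<i> * of_real \<nu>)" for t
  define Ya where "Ya t = ya t + mean fa / (2 * \<i> * of_real \<nu>)" for t
  define p where "p = mean (\<lambda>t. exp (- 2 * w t) * YE t)"
  define q where "q = mean (\<lambda>t. exp (- 2 * w t) * Ya t)"
  \<comment> \<open>Chosen so that \<open>mean h = p + \<eta> * q\<close> vanishes;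
    \<open>parameter_derivative_lower_bound\<close> keeps \<open>q\<close> away from 0.\<close>
  define \<eta> where "\<eta> = - p / q"
  define h where "h t = exp (- 2 * w t) * YE t + \<eta> * (exp (- 2 * w t) * Ya t)" for t
  have q: "abar / (4 * \<nu>) \<le> cmod q"
    unfolding q_def Ya_def by (rule parameter_derivative_lower_bound[OF w \<sigma> \<nu> fa_def ya0])
  have q0: "0 < cmod q" using q abar \<nu> by (smt (verit) divide_pos_pos mult_pos_pos)
  have ex': "wiener (\<sigma> - \<delta>) 2 (\<lambda>t. exp (- 2 * w t))" using wiener_mono[OF ex(2)] \<delta> by simp
  have YE: "wiener (\<sigma> - \<delta>) (2 * (C\<^sub>0 / (\<nu> * \<delta> ^ m) * (2 * e))) (\<lambda>t. exp (- 2 * w t) * YE t)"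
    unfolding YE_def by (intro wiener_mult ex' yE(2) \<sigma>pos \<delta>)
  have Ya: "wiener (\<sigma> - \<delta>) (2 * (C\<^sub>0 / (\<nu> * \<delta> ^ m) * (2 * A))) (\<lambda>t. exp (- 2 * w t) * Ya t)"
    unfolding Ya_def by (intro wiener_mult ex' ya(2) \<sigma>pos \<delta>)
  have p: "cmod p \<le> 4 * C\<^sub>0 * e / (\<nu> * \<delta> ^ m)"
    using wiener_mean_bound[OF YE \<sigma>pos(3)] by (simp add: p_def)
  have \<eta>: "cmod \<eta> \<le> C\<^sub>1 * e / \<delta> ^ m"
  proof -
    have "cmod \<eta> = cmod p / cmod q" by (simp add: \<eta>_def norm_divide)
    also have "\<dots> \<le> (4 * C\<^sub>0 * e / (\<nu> * \<delta> ^ m)) / (abar / (4 * \<nu>))"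
      using p q abar \<nu> e C\<^sub>0 dm by (intro frac_le) auto
    also have "\<dots> = C\<^sub>1 * e / \<delta> ^ m" using \<nu> by (simp add: C\<^sub>1_def divide_simps)
    finally show ?thesis .
  qed
  have h: "wiener (\<sigma> - \<delta>) H h"
    unfolding h_def
  proof (rule wiener_mono[OF wiener_add[OF YE wiener_cmult[OF Ya \<sigma>pos(3), of \<eta>] \<sigma>pos(3)]])
    have "cmod \<eta> * (2 * (C\<^sub>0 / (\<nu> * \<delta> ^ m) * (2 * A))) \<le> C\<^sub>1 * e / \<delta> ^ m * (2 * (C\<^sub>0 / (\<nu> * \<delta> ^ m) * (2 * A)))"
      using \<eta> C\<^sub>0 \<nu> dm A_pos by (intro mult_right_mono) auto
    also have "\<dots> = 4 * C\<^sub>0 * (C\<^sub>1 * A) * e / (\<nu> * \<delta> ^ m * \<delta> ^ m)" by (simp add: mult_ac)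
    finally have 1: "cmod \<eta> * (2 * (C\<^sub>0 / (\<nu> * \<delta> ^ m) * (2 * A))) \<le> 4 * C\<^sub>0 * (C\<^sub>1 * A) * e / (\<nu> * \<delta> ^ m * \<delta> ^ m)" .
    have "2 * (C\<^sub>0 / (\<nu> * \<delta> ^ m) * (2 * e)) = 4 * C\<^sub>0 * e / (\<nu> * \<delta> ^ m)" by simp
    also have "\<dots> \<le> 4 * C\<^sub>0 * e / (\<nu> * \<delta> ^ m * \<delta> ^ m)"
      using \<nu> dm e C\<^sub>0 by (intro divide_left_mono) auto
    finally have 2: "2 * (C\<^sub>0 / (\<nu> * \<delta> ^ m) * (2 * e)) \<le> 4 * C\<^sub>0 * e / (\<nu> * \<delta> ^ m * \<delta> ^ m)" .
    have "H = 4 * C\<^sub>0 * e / (\<nu> * \<delta> ^ m * \<delta> ^ m) + 4 * C\<^sub>0 * (C\<^sub>1 * A) * e / (\<nu> * \<delta> ^ m * \<delta> ^ m)"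
      by (simp add: H_def C\<^sub>2_def ring_distribs add_divide_distrib)
    then show "2 * (C\<^sub>0 / (\<nu> * \<delta> ^ m) * (2 * e)) + cmod \<eta> * (2 * (C\<^sub>0 / (\<nu> * \<delta> ^ m) * (2 * A))) \<le> H"
      using 1 2 by linarith
  qed simp
  have H: "0 \<le> H" using h wiener_nonneg by blast
  have "mean h = p + \<eta> * q"
    unfolding h_def[abs_def] p_def q_def mean_cmult[OF Ya \<sigma>pos(3), symmetric]
    by (rule mean_add[OF YE wiener_cmult[OF Ya]]) (use \<sigma>pos in auto)
  then have mh: "mean h = 0" using q0 by (simp add: \<eta>_def)
  \<comment> \<open>Integration is the case \<open>\<xi> = 0\<close>; the mean to be subtracted is 0
    by \<open>mh\<close>.\<close>
  have "\<exists>\<Delta>. (\<forall>\<delta>'. 0 < \<delta>' \<and> \<delta>' \<le> \<sigma> - \<delta> \<longrightarrow> wiener (\<sigma> - \<delta> - \<delta>') (fact m / (\<gamma> * \<delta>' ^ m) * H) \<Delta>) \<and> mean \<Delta> = 0 \<and>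
     (\<forall>t. (\<Delta> has_vector_derivative h t - mean h - \<i> * of_real 0 * \<Delta> t) (at t))"
    by (rule solve_small_divisors[OF h _ \<gamma> \<sigma>pos(4)]) (use small_divisors in simp)
  then obtain \<Delta> where \<Delta>: "\<And>\<delta>'. 0 < \<delta>' \<Longrightarrow> \<delta>' \<le> \<sigma> - \<delta> \<Longrightarrow> wiener (\<sigma> - \<delta> - \<delta>') (fact m / (\<gamma> * \<delta>' ^ m) * H) \<Delta>"
    "\<And>t. (\<Delta> has_vector_derivative h t) (at t)" using mh by auto
  have \<Delta>1: "wiener (\<sigma> - 2 * \<delta>) (C\<^sub>0 / \<delta> ^ m * H) \<Delta>"
  proof (rule wiener_mono[OF \<Delta>(1)[OF \<delta>(1)]])
    have "fact m / (\<gamma> * \<delta> ^ m) = (fact m / \<gamma>) / \<delta> ^ m" by simp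
    also have "\<dots> \<le> C\<^sub>0 / \<delta> ^ m" using dm by (intro divide_right_mono) (auto simp: C\<^sub>0_def)
    finally show "fact m / (\<gamma> * \<delta> ^ m) * H \<le> C\<^sub>0 / \<delta> ^ m * H" using H by (intro mult_right_mono)
  qed (use \<delta> in auto)
  have dw: "(w has_vector_derivative v t) (at t)" and dv: "(v has_vector_derivative
             E t - 2 * \<i> * of_real \<nu> * v t - (v t)\<^sup>2 + (of_real \<nu>)\<^sup>2 - \<epsilon> * of_real (a t)) (at t)" for t
    using fl by (auto simp: approx_floquet_def)
  have dh: "(h has_vector_derivative (- 2 * v t * h t - 2 * \<i> * of_real \<nu> * h t - E t - \<eta> * of_real (a t))) (at t)" for t
  proof -
    have dE: "(YE has_vector_derivative fE t - 2 * \<i> * of_real \<nu> * YE t) (at t)"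
      using yE(1)[of t] by (simp add: YE_def[abs_def])
    have da: "(Ya has_vector_derivative fa t - 2 * \<i> * of_real \<nu> * Ya t) (at t)"
      using ya(1)[of t] by (simp add: Ya_def[abs_def])
    note dx = has_vector_derivative_exp[OF dw, of "-2" t]
    have ee: "exp (- 2 * w t) * exp (2 * w t) = 1" by (simp add: exp_add[symmetric])
    have "((\<lambda>t. exp (- 2 * w t) * YE t + \<eta> * (exp (- 2 * w t) * Ya t)) has_vector_derivative
       (exp (- 2 * w t) * (fE t - 2 * \<i> * of_real \<nu> * YE t) + - 2 * v t * exp (- 2 * w t) * YE t) +
       \<eta> * (exp (- 2 * w t) * (fa t - 2 * \<i> * of_real \<nu> * Ya t) + - 2 * v t * exp (- 2 * w t) * Ya t)) (at t)"
      by (intro has_vector_derivative_add has_vector_derivative_mult has_vector_derivative_mult_right dE da dx)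
    moreover have "(exp (- 2 * w t) * (fE t - 2 * \<i> * of_real \<nu> * YE t) + - 2 * v t * exp (- 2 * w t) * YE t) +
       \<eta> * (exp (- 2 * w t) * (fa t - 2 * \<i> * of_real \<nu> * Ya t) + - 2 * v t * exp (- 2 * w t) * Ya t) =
       - 2 * v t * h t - 2 * \<i> * of_real \<nu> * h t - E t - \<eta> * of_real (a t)"
    proof -
      have "x * (- (z * E t) - 2 * \<i> * of_real \<nu> * YE t) + - 2 * v t * x * YE t +
          \<eta> * (x * (- (z * of_real (a t)) - 2 * \<i> * of_real \<nu> * Ya t) + - 2 * v t * x * Ya t) =
          - 2 * v t * (x * YE t + \<eta> * (x * Ya t)) - 2 * \<i> * of_real \<nu> * (x * YE t + \<eta> * (x * Ya t))
          - (x * z) * E t - \<eta> * ((x * z) * of_real (a t))" for x z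
        by (simp add: algebra_simps)
      from this[of "exp (- 2 * w t)" "exp (2 * w t)"] show ?thesis
        unfolding h_def fE_def fa_def ee by simp
    qed
    ultimately show ?thesis unfolding h_def[abs_def] by metis
  qed
  have "approx_floquet \<nu> (\<epsilon> + \<eta>) (\<lambda>t. (h t)\<^sup>2) (\<lambda>t. w t + \<Delta> t) (\<lambda>t. v t + h t)"
    unfolding approx_floquet_def
  proof (intro allI conjI)
    show "((\<lambda>t. w t + \<Delta> t) has_vector_derivative v t + h t) (at t)" for t
      by (intro has_vector_derivative_add dw \<Delta>)
    show "((\<lambda>t. v t + h t) has_vector_derivative (h t)\<^sup>2 - 2 * \<i> * of_real \<nu> * (v t + h t) - (v t + h t)\<^sup>2
        + (of_real \<nu>)\<^sup>2 - (\<epsilon> + \<eta>) * of_real (a t)) (at t)" for t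
      using has_vector_derivative_add[OF dv[of t] dh[of t]] by (simp add: algebra_simps power2_eq_square)
  qed
  then show ?thesis using \<Delta>1 \<eta> wiener_mono[OF h, of "\<sigma> - 2 * \<delta>" H] \<delta> by auto
qed

end

section \<open>Convergence of the Newton iteration\<close>

lemma has_vector_derivative_uniform_limit:
  fixes f f' :: "nat \<Rightarrow> real \<Rightarrow> complex"
  assumes d: "\<And>n t. (f n has_vector_derivative f' n t) (at t)"
    and u: "uniform_limit UNIV f' g' sequentially" and p: "\<And>t. (\<lambda>n. f n t) \<longlonglongrightarrow> g t"
  shows "(g has_vector_derivative g' t) (at t)"
proof -
  have "\<exists>h. \<forall>t\<in>UNIV. (\<lambda>n. f n t) \<longlonglongrightarrow> h t \<and> (h has_derivative (\<lambda>y. y *\<^sub>R g' t)) (at t within UNIV)"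
  proof (rule has_derivative_sequence[where f = f and f' = "\<lambda>n t y. y *\<^sub>R f' n t" and ?x0.0 = 0 and l = "g 0"])
    fix e :: real assume "e > 0"
    then have "\<forall>\<^sub>F n in sequentially. \<forall>t\<in>UNIV. dist (f' n t) (g' t) < e" using u by (simp add: uniform_limit_iff)
    then show "\<forall>\<^sub>F n in sequentially. \<forall>t\<in>UNIV. \<forall>h. norm (h *\<^sub>R f' n t - h *\<^sub>R g' t) \<le> e * norm h"
    proof eventually_elim
      case (elim n)
      have "norm (h *\<^sub>R f' n t - h *\<^sub>R g' t) \<le> e * norm h" for t h
        using mult_left_mono[of "dist (f' n t) (g' t)" e "\<bar>h\<bar>"] elim[rule_format, of t]
        by (simp add: scaleR_diff_right[symmetric] dist_norm mult.commute[of e])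
      then show ?case by blast
    qed
  qed (use d p in \<open>auto simp: has_vector_derivative_def\<close>)
  then obtain h where h: "\<And>t. (\<lambda>n. f n t) \<longlonglongrightarrow> h t" "\<And>t. (h has_derivative (\<lambda>y. y *\<^sub>R g' t)) (at t)"
    by auto
  have "h = g" using h(1) p LIMSEQ_unique by blast
  then show ?thesis using h(2) by (simp add: has_vector_derivative_def)
qed

lemma uniform_limit_const_of_tendsto:
  "x \<longlonglongrightarrow> l \<Longrightarrow> uniform_limit S (\<lambda>n t. x n) (\<lambda>t. l) sequentially"
  by (auto simp: uniform_limit_iff tendsto_iff elim: eventually_mono)

lemma half_series: "(\<lambda>n. c * (1 / 2) ^ n) sums (2 * c :: real)"
  using sums_mult[OF geometric_sums[of "1/2::real"], of c] by (simp add: mult.commute)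

lemma cauchy_geometric_limit:
  fixes x :: "nat \<Rightarrow> complex"
  assumes "\<And>n. cmod (x (Suc n) - x n) \<le> c * (1 / 2) ^ n"
  obtains l where "x \<longlonglongrightarrow> l" "cmod (l - x 0) \<le> 2 * c"
proof -
  have s: "summable (\<lambda>n. norm (x (Suc n) - x n))"
    by (rule summable_comparison_test'[OF sums_summable[OF half_series[of c]], of 0]) (use assms in auto)
  have t: "(\<lambda>n. x (Suc n) - x n) sums (\<Sum>n. x (Suc n) - x n)"
    using summable_sums[OF summable_norm_cancel[OF s]] .
  then have "(\<lambda>n. x n - x 0) \<longlonglongrightarrow> (\<Sum>n. x (Suc n) - x n)"
    by (simp add: sums_def sum_lessThan_telescope)
  then have "x \<longlonglongrightarrow> (\<Sum>n. x (Suc n) - x n) + x 0"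
    using tendsto_add[OF _ tendsto_const[of "x 0"]] by fastforce
  moreover have "cmod (\<Sum>n. x (Suc n) - x n) \<le> (\<Sum>n. c * (1 / 2) ^ n)"
    by (rule order_trans[OF summable_norm[OF s]])
       (intro suminf_le assms s sums_summable[OF half_series])
  ultimately show thesis using that half_series[of c] by (simp add: sums_iff)
qed

context frequency_group
begin

text \<open>Telescoping turns the limit into a series covered by \<open>wiener_suminf\<close>, so it
  stays in the Wiener class at the common width \<open>\<sigma>\<close>, and convergence is uniform
  on the whole line.\<close>

lemma wiener_geometric_limit:
  assumes d: "\<And>n. wiener \<sigma> (c * (1 / 2) ^ n) (\<lambda>t. F (Suc n) t - F n t)"
    and 0: "wiener \<sigma> B (F 0)" and \<sigma>: "0 \<le> \<sigma>"
  obtains G where "wiener \<sigma> (B + 2 * c) G" "uniform_limit UNIV F G sequentially"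
proof -
  have s: "summable (\<lambda>n. c * (1 / 2) ^ n)" using half_series by (rule sums_summable)
  have w: "wiener \<sigma> (2 * c) (\<lambda>t. \<Sum>n. F (Suc n) t - F n t)"
    using wiener_suminf(1)[OF d s \<sigma>] half_series[of c] by (simp add: sums_iff)
  have tele: "(\<Sum>i<n. F (Suc i) t - F i t) = F n t - F 0 t" for n t
    using sum_lessThan_telescope[of "\<lambda>i. F i t" n] by simp
  have "uniform_limit UNIV (\<lambda>n t. \<Sum>i<n. F (Suc i) t - F i t) (\<lambda>t. \<Sum>i. F (Suc i) t - F i t) sequentially"
    by (rule Weierstrass_m_test[OF _ s]) (use wiener_bound[OF d \<sigma>] in auto)
  then have "uniform_limit UNIV (\<lambda>n t. F n t - F 0 t) (\<lambda>t. \<Sum>i. F (Suc i) t - F i t) sequentially"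
    by (simp only: tele)
  from uniform_limit_add[OF uniform_limit_const[where c = "F 0"] this]
  have "uniform_limit UNIV F (\<lambda>t. F 0 t + (\<Sum>i. F (Suc i) t - F i t)) sequentially" by simp
  then show thesis using that wiener_add[OF 0 w \<sigma>] by blast
qed

end

context hill_frequency_group
begin

text \<open>The right-hand sides converge uniformly, so the limits may be differentiated.
  Boundedness of \<open>v'\<close> and \<open>a\<close> is what makes the products converge
  uniformly.\<close>

lemma approx_floquet_limit:
  assumes fl: "\<And>n. approx_floquet \<nu> (\<epsilon> n) (E n) (w n) (v n)"
    and lim: "\<epsilon> \<longlonglongrightarrow> \<epsilon>'" "uniform_limit UNIV E (\<lambda>t. 0) sequentially"
      "uniform_limit UNIV w w' sequentially" "uniform_limit UNIV v v' sequentially"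
    and b: "\<And>t. cmod (v' t) \<le> B"
  shows "approx_floquet \<nu> \<epsilon>' (\<lambda>t. 0) w' v'"
proof -
  have dw: "(w n has_vector_derivative v n t) (at t)" and
    dv: "(v n has_vector_derivative E n t - 2 * \<i> * of_real \<nu> * v n t - (v n t)\<^sup>2 + (of_real \<nu>)\<^sup>2 - \<epsilon> n * of_real (a t)) (at t)" for n t
    using fl by (auto simp: approx_floquet_def)
  have bv: "bounded (range v')" using b by (auto simp: bounded_iff)
  have ba: "bounded (range (\<lambda>t. complex_of_real (a t)))" using wiener_bound[OF a] \<sigma>\<^sub>0 by (force simp: bounded_iff)
  have "uniform_limit UNIV (\<lambda>n t. E n t - 2 * \<i> * of_real \<nu> * v n t - v n t * v n t + (of_real \<nu>)\<^sup>2 - \<epsilon> n * of_real (a t))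
      (\<lambda>t. 0 - 2 * \<i> * of_real \<nu> * v' t - v' t * v' t + (of_real \<nu>)\<^sup>2 - \<epsilon>' * of_real (a t)) sequentially"
    by (intro uniform_limit_minus uniform_limit_add uniform_limit_const lim(2,4)
        uniform_limit_const_of_tendsto lim(1) bounded_linear.uniform_limit[OF bounded_linear_mult_right]
        uniform_lim_mult bv ba) (auto simp: bounded_iff)
  then have "uniform_limit UNIV (\<lambda>n t. E n t - 2 * \<i> * of_real \<nu> * v n t - (v n t)\<^sup>2 + (of_real \<nu>)\<^sup>2 - \<epsilon> n * of_real (a t))
      (\<lambda>t. 0 - 2 * \<i> * of_real \<nu> * v' t - (v' t)\<^sup>2 + (of_real \<nu>)\<^sup>2 - \<epsilon>' * of_real (a t)) sequentially"
    by (simp only: power2_eq_square)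
  from has_vector_derivative_uniform_limit[OF dv this tendsto_uniform_limitI[OF lim(4)]]
    has_vector_derivative_uniform_limit[OF dw lim(4) tendsto_uniform_limitI[OF lim(3)]]
  show ?thesis by (simp add: approx_floquet_def)
qed

text \<open>Dropping the quadratic term leaves a linear equation for \<open>v\<close> with source
  \<open>\<nu>\<^sup>2 - \<epsilon> * a\<close>. The value \<open>\<nu>\<^sup>2 / abar\<close> of
  \<open>\<epsilon>\<close> makes the mean of the source vanish, so no division by
  \<open>\<nu>\<close> occurs and \<open>v\<close> is of order \<open>\<nu>\<^sup>2\<close>. The
  error is the dropped term, of order \<open>\<nu> ^ 4\<close>.\<close>

lemma first_approximation:
  obtains K where "0 < K" and "\<And>\<nu>. nonresonant \<nu> \<Longrightarrow> 0 < \<nu> \<Longrightarrow> \<nu> \<le> 1 \<Longrightarrow>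
    \<exists>w v. wiener (3 / 4 * \<sigma>\<^sub>0) (K * \<nu>\<^sup>2) w \<and> wiener (3 / 4 * \<sigma>\<^sub>0) (K * \<nu>\<^sup>2) v \<and>
      approx_floquet \<nu> (of_real (\<nu>\<^sup>2 / abar)) (\<lambda>t. (v t)\<^sup>2) w v"
proof -
  \<comment> \<open>The two small divisor equations, for \<open>v\<close> and for \<open>w\<close>,
    each spend \<open>\<sigma>\<^sub>0 / 8\<close>; this leads from \<open>\<sigma>\<^sub>0\<close>
    to \<open>3 / 4 * \<sigma>\<^sub>0\<close>.\<close>
  define D where "D = fact m / (\<gamma> * (\<sigma>\<^sub>0 / 8) ^ m)"
  define M where "M = 1 + A / abar"
  have D: "0 < D" using \<gamma> \<sigma>\<^sub>0 by (simp add: D_def)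
  have M: "0 < M" using A_pos abar by (simp add: M_def add_pos_pos)
  define K where "K = max (D * M) (D * (D * M))"
  have main: "\<exists>w v. wiener (3 / 4 * \<sigma>\<^sub>0) (K * \<nu>\<^sup>2) w \<and> wiener (3 / 4 * \<sigma>\<^sub>0) (K * \<nu>\<^sup>2) v \<and>
      approx_floquet \<nu> (of_real (\<nu>\<^sup>2 / abar)) (\<lambda>t. (v t)\<^sup>2) w v"
    if nr: "nonresonant \<nu>" and \<nu>: "0 < \<nu>" "\<nu> \<le> 1" for \<nu>
  proof -
    define f where "f t = of_real (\<nu>\<^sup>2) + of_real (- (\<nu>\<^sup>2 / abar)) * complex_of_real (a t)" for t
    have ca: "wiener \<sigma>\<^sub>0 (cmod (of_real (- (\<nu>\<^sup>2 / abar))) * A) (\<lambda>t. of_real (- (\<nu>\<^sup>2 / abar)) * complex_of_real (a t))"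
      using a \<sigma>\<^sub>0 by (intro wiener_cmult) auto
    have f: "wiener \<sigma>\<^sub>0 (\<nu>\<^sup>2 * M) f"
      unfolding f_def[abs_def]
      by (rule wiener_mono[OF wiener_add[OF wiener_const ca]])
         (use \<sigma>\<^sub>0 abar in \<open>auto simp: M_def norm_power norm_divide norm_mult algebra_simps\<close>)
    have "mean f = of_real (\<nu>\<^sup>2) + of_real (- (\<nu>\<^sup>2 / abar)) * of_real abar"
      unfolding f_def[abs_def]
      using wiener_continuous[OF ca] \<sigma>\<^sub>0 by (intro mean_eq has_mean_add has_mean_const has_mean_cmult a_mean) auto
    then have mf: "mean f = 0" using abar by (simp flip: of_real_mult of_real_add)
    obtain v where v0: "\<And>\<delta>. 0 < \<delta> \<Longrightarrow> \<delta> \<le> \<sigma>\<^sub>0 \<Longrightarrow> wiener (\<sigma>\<^sub>0 - \<delta>) (fact m / (\<gamma> * \<delta> ^ m) * (\<nu>\<^sup>2 * M)) v"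
      and vm: "mean v = 0"
      and dv: "\<And>t. (v has_vector_derivative f t - 2 * \<i> * of_real \<nu> * v t) (at t)"
      using solve_shifted[OF f nr \<nu> \<sigma>\<^sub>0(1)] unfolding mf div_0 add_0_right by metis
    have v1: "wiener (7 / 8 * \<sigma>\<^sub>0) (D * (\<nu>\<^sup>2 * M)) v"
      using v0[of "\<sigma>\<^sub>0 / 8"] \<sigma>\<^sub>0 by (simp add: D_def)
    have "\<exists>w. (\<forall>\<delta>. 0 < \<delta> \<and> \<delta> \<le> 7 / 8 * \<sigma>\<^sub>0 \<longrightarrow> wiener (7 / 8 * \<sigma>\<^sub>0 - \<delta>) (fact m / (\<gamma> * \<delta> ^ m) * (D * (\<nu>\<^sup>2 * M))) w) \<and> mean w = 0 \<and>
       (\<forall>t. (w has_vector_derivative v t - mean v - \<i> * of_real 0 * w t) (at t))"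
      by (rule solve_small_divisors[OF v1 _ \<gamma>]) (use small_divisors \<sigma>\<^sub>0 in auto)
    then obtain w where w0: "\<And>\<delta>. 0 < \<delta> \<Longrightarrow> \<delta> \<le> 7 / 8 * \<sigma>\<^sub>0 \<Longrightarrow> wiener (7 / 8 * \<sigma>\<^sub>0 - \<delta>) (fact m / (\<gamma> * \<delta> ^ m) * (D * (\<nu>\<^sup>2 * M))) w"
      and dw: "\<And>t. (w has_vector_derivative v t) (at t)" using vm by auto
    have w1: "wiener (3 / 4 * \<sigma>\<^sub>0) (D * (D * (\<nu>\<^sup>2 * M))) w"
      using w0[of "\<sigma>\<^sub>0 / 8"] \<sigma>\<^sub>0 by (simp add: D_def)
    have K: "D * (\<nu>\<^sup>2 * M) \<le> K * \<nu>\<^sup>2" "D * (D * (\<nu>\<^sup>2 * M)) \<le> K * \<nu>\<^sup>2"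
      using mult_right_mono[of "D * M" K "\<nu>\<^sup>2"] mult_right_mono[of "D * (D * M)" K "\<nu>\<^sup>2"]
      by (simp_all add: K_def mult_ac)
    have "approx_floquet \<nu> (of_real (\<nu>\<^sup>2 / abar)) (\<lambda>t. (v t)\<^sup>2) w v"
      unfolding approx_floquet_def
    proof (intro allI conjI dw)
      show "(v has_vector_derivative (v t)\<^sup>2 - 2 * \<i> * of_real \<nu> * v t - (v t)\<^sup>2 + (of_real \<nu>)\<^sup>2 -
          of_real (\<nu>\<^sup>2 / abar) * of_real (a t)) (at t)" for t
        using dv[of t] by (simp add: f_def algebra_simps)
    qed
    then show ?thesis
      using wiener_mono[OF w1 _ K(2), of "3 / 4 * \<sigma>\<^sub>0"] wiener_mono[OF v1 _ K(1), of "3 / 4 * \<sigma>\<^sub>0"] \<sigma>\<^sub>0 by auto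
  qed
  have "0 < K" using D M by (simp add: K_def less_max_iff_disj)
  then show thesis using that main by blast
qed

text \<open>The errors are only required to decrease like \<open>r ^ n\<close>, which the quadratic
  gain of Newton's method affords and which keeps every sum geometric. Step \<open>n\<close> loses
  the width \<open>2 * \<delta>\<close> with
  \<open>\<delta> = \<sigma>\<^sub>0 / 16 * (1 / 2) ^ n\<close>; in all this uses up
  \<open>\<sigma>\<^sub>0 / 4\<close>, from \<open>3 / 4 * \<sigma>\<^sub>0\<close> down to
  \<open>\<sigma>\<^sub>0 / 2\<close>.\<close>

theorem floquet_exists:
  obtains \<nu>\<^sub>1 C where "0 < \<nu>\<^sub>1" "\<nu>\<^sub>1 \<le> 1" "0 < C"
    and "\<And>\<nu>. nonresonant \<nu> \<Longrightarrow> 0 < \<nu> \<Longrightarrow> \<nu> \<le> \<nu>\<^sub>1 \<Longrightarrow>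
      \<exists>\<epsilon> w v. wiener (\<sigma>\<^sub>0 / 2) (C * \<nu>\<^sup>2) w \<and> wiener (\<sigma>\<^sub>0 / 2) (C * \<nu>\<^sup>2) v \<and>
        cmod (\<epsilon> - of_real (\<nu>\<^sup>2 / abar)) \<le> C * \<nu> ^ 4 \<and> approx_floquet \<nu> \<epsilon> (\<lambda>t. 0) w v"
proof -
  obtain K where K: "0 < K" and first: "\<And>\<nu>. nonresonant \<nu> \<Longrightarrow> 0 < \<nu> \<Longrightarrow> \<nu> \<le> 1 \<Longrightarrow>
    \<exists>w v. wiener (3 / 4 * \<sigma>\<^sub>0) (K * \<nu>\<^sup>2) w \<and> wiener (3 / 4 * \<sigma>\<^sub>0) (K * \<nu>\<^sup>2) v \<and>
      approx_floquet \<nu> (of_real (\<nu>\<^sup>2 / abar)) (\<lambda>t. (v t)\<^sup>2) w v"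
    by (rule first_approximation) (use that in blast)
  \<comment> \<open>The bound of \<open>h\<close> contains \<open>1 / \<delta> ^ m\<close> twice,
    that of its square four times, and \<open>1 / \<delta> ^ m\<close> grows like
    \<open>(2 ^ m) ^ n\<close>. The value of \<open>r\<close> is fixed by
    \<open>r * 16 ^ m = 1 / 2\<close>.\<close>
  define r where "r = (1 / 2 :: real) ^ (4 * m + 1)"
  define Q where "Q = (16 / \<sigma>\<^sub>0) ^ m"
  \<comment> \<open>At step \<open>n\<close>, \<open>K\<^sub>3 * \<nu> ^ 3\<close>,
    \<open>K\<^sub>4 * \<nu> ^ 3\<close> and \<open>K\<^sub>5 * \<nu> ^ 4\<close>, each times
    \<open>(1 / 2) ^ n\<close>, bound \<open>h\<close>, \<open>\<Delta>\<close> and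
    \<open>\<eta>\<close>. They come from \<open>newton_step\<close> with
    \<open>e = K\<^sup>2 * \<nu> ^ 4 * r ^ n\<close> and
    \<open>1 / \<delta> ^ m = Q * (2 ^ m) ^ n\<close>.\<close>
  define K\<^sub>3 where "K\<^sub>3 = C\<^sub>2 * K\<^sup>2 * Q\<^sup>2"
  define K\<^sub>4 where "K\<^sub>4 = C\<^sub>0 * Q * K\<^sub>3"
  define K\<^sub>5 where "K\<^sub>5 = C\<^sub>1 * K\<^sup>2 * Q"
  have Q: "0 < Q" using \<sigma>\<^sub>0 by (simp add: Q_def)
  have r: "0 < r" by (simp add: r_def)
  have K3: "0 < K\<^sub>3" using C\<^sub>2 K Q by (simp add: K\<^sub>3_def)
  have K4: "0 < K\<^sub>4" using C\<^sub>0 K3 Q by (simp add: K\<^sub>4_def)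
  have K5: "0 < K\<^sub>5" using C\<^sub>1 K Q by (simp add: K\<^sub>5_def)
  define C where "C = K + 2 * K\<^sub>4 + 2 * K\<^sub>3 + 2 * K\<^sub>5"
  have C: "0 < C" using K K3 K4 K5 by (simp add: C_def)
  \<comment> \<open>\<open>\<beta>\<^sub>0 / C\<close> keeps \<open>w\<close> in the range of
    \<open>newton_step\<close> through all steps; \<open>K\<^sup>2 * r / K\<^sub>3\<^sup>2\<close>
    makes the squared correction an admissible next error. Since \<open>\<nu> \<le> 1\<close>,
    bounds on \<open>\<nu>\<close> also bound \<open>\<nu>\<^sup>2\<close>.\<close>
  define \<nu>\<^sub>1 where "\<nu>\<^sub>1 = Min {\<nu>\<^sub>0, \<beta>\<^sub>0 / C, K\<^sup>2 * r / K\<^sub>3\<^sup>2, 1}"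
  have \<nu>1: "0 < \<nu>\<^sub>1" "\<nu>\<^sub>1 \<le> \<nu>\<^sub>0" "\<nu>\<^sub>1 \<le> \<beta>\<^sub>0 / C" "\<nu>\<^sub>1 \<le> K\<^sup>2 * r / K\<^sub>3\<^sup>2" "\<nu>\<^sub>1 \<le> 1"
    using \<nu>\<^sub>0 \<beta>\<^sub>0 C K K3 r by (auto simp: \<nu>\<^sub>1_def)
  have main: "\<exists>\<epsilon> w v. wiener (\<sigma>\<^sub>0 / 2) (C * \<nu>\<^sup>2) w \<and> wiener (\<sigma>\<^sub>0 / 2) (C * \<nu>\<^sup>2) v \<and>
        cmod (\<epsilon> - of_real (\<nu>\<^sup>2 / abar)) \<le> C * \<nu> ^ 4 \<and> approx_floquet \<nu> \<epsilon> (\<lambda>t. 0) w v"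
    if nr: "nonresonant \<nu>" and \<nu>: "0 < \<nu>" "\<nu> \<le> \<nu>\<^sub>1" for \<nu>
  proof -
    have \<nu>': "\<nu> \<le> 1" "\<nu> \<le> \<nu>\<^sub>0" using \<nu> \<nu>1 by auto
    have \<nu>32: "\<nu> ^ 3 \<le> \<nu>\<^sup>2" "\<nu>\<^sup>2 \<le> \<nu>" using \<nu> \<nu>' by (auto simp: power3_eq_cube power2_eq_square mult_left_le)
    have small: "K\<^sub>3\<^sup>2 * \<nu>\<^sup>2 \<le> K\<^sup>2 * r"
    proof -
      have "\<nu>\<^sup>2 \<le> K\<^sup>2 * r / K\<^sub>3\<^sup>2" using \<nu>32 \<nu> \<nu>1 by linarith
      then show ?thesis using K3 by (simp add: pos_le_divide_eq mult.commute)
    qed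
    have \<beta>: "K * \<nu>\<^sup>2 + K\<^sub>4 * \<nu> ^ 3 * (2 - 2 * (1 / 2) ^ n) \<le> C * \<nu>\<^sup>2" "C * \<nu>\<^sup>2 \<le> \<beta>\<^sub>0" for n
    proof -
      have "K\<^sub>4 * \<nu> ^ 3 * (2 - 2 * (1 / 2) ^ n) \<le> K\<^sub>4 * \<nu>\<^sup>2 * 2"
        using K4 \<nu>32 \<nu> by (intro mult_mono) (auto simp: power_le_one)
      moreover have "K * \<nu>\<^sup>2 + K\<^sub>4 * \<nu>\<^sup>2 * 2 \<le> C * \<nu>\<^sup>2"
        using K3 K5 mult_right_mono[of "K + 2 * K\<^sub>4" C "\<nu>\<^sup>2"] by (simp add: C_def algebra_simps)
      ultimately show "K * \<nu>\<^sup>2 + K\<^sub>4 * \<nu> ^ 3 * (2 - 2 * (1 / 2) ^ n) \<le> C * \<nu>\<^sup>2" by linarith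
      have "\<nu>\<^sup>2 \<le> \<beta>\<^sub>0 / C" using \<nu>32 \<nu> \<nu>1 by linarith
      then show "C * \<nu>\<^sup>2 \<le> \<beta>\<^sub>0" using C by (simp add: pos_le_divide_eq mult.commute)
    qed
    define s where "s n = \<sigma>\<^sub>0 * (1 / 2 + (1 / 2) ^ n / 4)" for n :: nat
    \<comment> \<open>The invariant bounds \<open>E\<close> and \<open>w\<close>, the data that
      enter the estimates of \<open>newton_step\<close>; \<open>2 - 2 * (1 / 2) ^ n\<close> is the
      sum of \<open>(1 / 2) ^ i\<close> over \<open>i < n\<close>.\<close>
    define P where "P n x \<longleftrightarrow> (case x of (\<epsilon>, E, w, v) \<Rightarrow> approx_floquet \<nu> \<epsilon> E w v \<and>
       wiener (s n) (K\<^sup>2 * \<nu> ^ 4 * r ^ n) E \<and> wiener (s n) (K * \<nu>\<^sup>2 + K\<^sub>4 * \<nu> ^ 3 * (2 - 2 * (1 / 2) ^ n)) w)" for n x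
    define R where "R n x y \<longleftrightarrow> (case x of (\<epsilon>, E, w, v) \<Rightarrow> case y of (\<epsilon>', E', w', v') \<Rightarrow>
       cmod (\<epsilon>' - \<epsilon>) \<le> K\<^sub>5 * \<nu> ^ 4 * (1 / 2) ^ n \<and>
       wiener (\<sigma>\<^sub>0 / 2) (K\<^sub>4 * \<nu> ^ 3 * (1 / 2) ^ n) (\<lambda>t. w' t - w t) \<and>
       wiener (\<sigma>\<^sub>0 / 2) (K\<^sub>3 * \<nu> ^ 3 * (1 / 2) ^ n) (\<lambda>t. v' t - v t))"
      for n :: nat and x y :: "complex \<times> (real \<Rightarrow> complex) \<times> (real \<Rightarrow> complex) \<times> (real \<Rightarrow> complex)"
    obtain w0 v0 where wv0: "wiener (3 / 4 * \<sigma>\<^sub>0) (K * \<nu>\<^sup>2) w0" "wiener (3 / 4 * \<sigma>\<^sub>0) (K * \<nu>\<^sup>2) v0"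
      "approx_floquet \<nu> (of_real (\<nu>\<^sup>2 / abar)) (\<lambda>t. (v0 t)\<^sup>2) w0 v0"
      using first[OF nr \<nu>(1) \<nu>'(1)] by blast
    define x0 where "x0 = (complex_of_real (\<nu>\<^sup>2 / abar), (\<lambda>t. (v0 t)\<^sup>2), w0, v0)"
    have s0: "s 0 = 3 / 4 * \<sigma>\<^sub>0" by (simp add: s_def)
    have P0: "P 0 x0"
      using wv0 wiener_power[OF wv0(2), of 2] \<sigma>\<^sub>0
      by (simp add: P_def x0_def s0 power_mult_distrib flip: power_mult)
    have s: "\<sigma>\<^sub>0 / 2 \<le> s n" "s n \<le> \<sigma>\<^sub>0" for n
      using \<sigma>\<^sub>0 power_le_one[of "1 / 2 :: real" n] by (auto simp: s_def intro: mult_left_le)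
    have step: "\<exists>y. P (Suc n) y \<and> R n x y" if "P n x" for n x
    proof -
      obtain \<epsilon> E w v where x: "x = (\<epsilon>, E, w, v)" by (cases x) auto
      define \<delta> where "\<delta> = \<sigma>\<^sub>0 / 16 * (1 / 2) ^ n"
      define e where "e = K\<^sup>2 * \<nu> ^ 4 * r ^ n"
      have hn: "0 < (1 / 2 :: real) ^ n" "(1 / 2 :: real) ^ n \<le> 1" by (auto simp: power_le_one)
      have \<delta>: "0 < \<delta>" "\<delta> \<le> 1" "2 * \<delta> \<le> s n"
      proof -
        show "0 < \<delta>" using \<sigma>\<^sub>0 by (simp add: \<delta>_def)
        have "\<delta> \<le> \<sigma>\<^sub>0 / 16" unfolding \<delta>_def using hn \<sigma>\<^sub>0 by (intro mult_left_le) auto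
        then show "\<delta> \<le> 1" "2 * \<delta> \<le> s n" using \<sigma>\<^sub>0 s(1)[of n] by linarith+
      qed
      have sS: "s n - 2 * \<delta> = s (Suc n)" by (simp add: s_def \<delta>_def algebra_simps)
      from that have fl: "approx_floquet \<nu> \<epsilon> E w v" and E: "wiener (s n) e E"
        and w: "wiener (s n) (K * \<nu>\<^sup>2 + K\<^sub>4 * \<nu> ^ 3 * (2 - 2 * (1 / 2) ^ n)) w"
        by (simp_all add: P_def x e_def)
      define H where "H = C\<^sub>2 * e / (\<nu> * \<delta> ^ m * \<delta> ^ m)"
      obtain \<Delta> h \<eta> where \<Delta>: "wiener (s (Suc n)) (C\<^sub>0 / \<delta> ^ m * H) \<Delta>" and h: "wiener (s (Suc n)) H h"
        and \<eta>: "cmod \<eta> \<le> C\<^sub>1 * e / \<delta> ^ m"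
        and fl': "approx_floquet \<nu> (\<epsilon> + \<eta>) (\<lambda>t. (h t)\<^sup>2) (\<lambda>t. w t + \<Delta> t) (\<lambda>t. v t + h t)"
        using newton_step[OF nr \<nu>(1) \<nu>'(2) w order_trans[OF \<beta>(1) \<beta>(2)] E s(1) s(2) \<delta> fl] unfolding sS H_def by blast
      have dm: "1 / \<delta> ^ m = Q * (2 ^ m) ^ n"
        using \<sigma>\<^sub>0 by (simp add: \<delta>_def Q_def power_mult_distrib power_divide divide_simps flip: power_mult)
      have r16: "r * 16 ^ m = 1 / 2"
        by (simp add: r_def power_add power_mult power_divide)
      have le16: "(2::real) ^ m \<le> 16 ^ m" "(4::real) ^ m \<le> 16 ^ m" "(8::real) ^ m \<le> 16 ^ m"
        by (auto intro: power_mono)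
      have rp: "(r * b) ^ n \<le> (1 / 2) ^ n" if "0 \<le> b" "b \<le> 16 ^ m" for b
        unfolding r16[symmetric] using that r by (intro power_mono mult_left_mono) auto
      have Heq: "H = K\<^sub>3 * \<nu> ^ 3 * (r * 4 ^ m) ^ n"
      proof -
        have "H = C\<^sub>2 * e / \<nu> * (1 / \<delta> ^ m) * (1 / \<delta> ^ m)" by (simp add: H_def)
        also have "\<dots> = C\<^sub>2 * (K\<^sup>2 * \<nu> ^ 3 * r ^ n) * (Q * (2 ^ m) ^ n) * (Q * (2 ^ m) ^ n)"
          unfolding dm e_def using \<nu> by (simp add: power3_eq_cube power4_eq_xxxx)
        also have "\<dots> = K\<^sub>3 * \<nu> ^ 3 * (r ^ n * ((2 ^ m) ^ n * (2 ^ m) ^ n))"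
          by (simp add: K\<^sub>3_def power2_eq_square mult_ac)
        also have "(2 ^ m) ^ n * (2 ^ m) ^ n = ((4::real) ^ m) ^ n"
          by (simp add: power_mult_distrib[symmetric])
        finally show ?thesis by (simp add: power_mult_distrib)
      qed
      have H1: "H \<le> K\<^sub>3 * \<nu> ^ 3 * (1 / 2) ^ n"
        unfolding Heq using K3 \<nu> le16 by (intro mult_left_mono rp) auto
      \<comment> \<open>The spare factor \<open>\<nu>\<^sup>2\<close> is used here:
        \<open>H\<^sup>2\<close> is of order \<open>\<nu> ^ 6\<close>, and \<open>small\<close>
        converts \<open>K\<^sub>3\<^sup>2 * \<nu>\<^sup>2\<close> into \<open>K\<^sup>2 * r\<close>,
        as the next error bound requires.\<close>
      have H2: "H\<^sup>2 \<le> K\<^sup>2 * \<nu> ^ 4 * r ^ Suc n"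
      proof -
        have "H\<^sup>2 = K\<^sub>3\<^sup>2 * \<nu>\<^sup>2 * \<nu> ^ 4 * (r * (r * 16 ^ m)) ^ n"
        proof -
          have "((r * 4 ^ m) ^ n)\<^sup>2 = ((r * 4 ^ m)\<^sup>2) ^ n" by (simp add: power_mult[symmetric] mult.commute)
          also have "(r * 4 ^ m)\<^sup>2 = r * (r * 16 ^ m)"
            by (simp add: power2_eq_square power_mult_distrib[symmetric])
          finally have 1: "((r * 4 ^ m) ^ n)\<^sup>2 = (r * (r * 16 ^ m)) ^ n" .
          have "(\<nu> ^ 3)\<^sup>2 = \<nu>\<^sup>2 * \<nu> ^ 4" by (simp flip: power_mult power_add)
          then show ?thesis unfolding Heq power_mult_distrib[of "_ * _" _ 2] power_mult_distrib[of K\<^sub>3 _ 2] 1 by simp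
        qed
        also have "\<dots> \<le> (K\<^sup>2 * r) * \<nu> ^ 4 * r ^ n"
          unfolding r16 using r by (intro mult_mono[OF mult_right_mono[OF small] power_mono]) auto
        finally show ?thesis by (simp add: mult_ac)
      qed
      have D1: "C\<^sub>0 / \<delta> ^ m * H \<le> K\<^sub>4 * \<nu> ^ 3 * (1 / 2) ^ n"
      proof -
        have "C\<^sub>0 / \<delta> ^ m * H = C\<^sub>0 * (1 / \<delta> ^ m) * H" by simp
        also have "\<dots> = K\<^sub>4 * \<nu> ^ 3 * ((r * 4 ^ m) ^ n * (2 ^ m) ^ n)"
          unfolding dm Heq by (simp add: K\<^sub>4_def)
        also have "(r * 4 ^ m) ^ n * (2 ^ m) ^ n = (r * 8 ^ m) ^ n"
          by (simp add: power_mult_distrib[symmetric] mult.assoc)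
        also have "K\<^sub>4 * \<nu> ^ 3 * (r * 8 ^ m) ^ n \<le> K\<^sub>4 * \<nu> ^ 3 * (1 / 2) ^ n"
          using K4 \<nu> le16 by (intro mult_left_mono rp) auto
        finally show ?thesis .
      qed
      have \<eta>1: "cmod \<eta> \<le> K\<^sub>5 * \<nu> ^ 4 * (1 / 2) ^ n"
      proof -
        have "C\<^sub>1 * e / \<delta> ^ m = C\<^sub>1 * e * (1 / \<delta> ^ m)" by simp
        also have "\<dots> = K\<^sub>5 * \<nu> ^ 4 * (r * 2 ^ m) ^ n"
          unfolding dm e_def by (simp add: K\<^sub>5_def power_mult_distrib)
        also have "\<dots> \<le> K\<^sub>5 * \<nu> ^ 4 * (1 / 2) ^ n"
          using K5 \<nu> le16 by (intro mult_left_mono rp) auto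
        finally show ?thesis using \<eta> by linarith
      qed
      have sp: "0 \<le> s (Suc n)" using s(1)[of "Suc n"] \<sigma>\<^sub>0 by simp
      have "P (Suc n) (\<epsilon> + \<eta>, (\<lambda>t. (h t)\<^sup>2), (\<lambda>t. w t + \<Delta> t), (\<lambda>t. v t + h t))"
        unfolding P_def prod.case
      proof (intro conjI fl')
        show "wiener (s (Suc n)) (K\<^sup>2 * \<nu> ^ 4 * r ^ Suc n) (\<lambda>t. (h t)\<^sup>2)"
          by (rule wiener_mono[OF wiener_power[OF h sp, of 2] order_refl H2])
        show "wiener (s (Suc n)) (K * \<nu>\<^sup>2 + K\<^sub>4 * \<nu> ^ 3 * (2 - 2 * (1 / 2) ^ Suc n)) (\<lambda>t. w t + \<Delta> t)"
        proof (rule wiener_mono[OF wiener_add[OF wiener_mono[OF w _ order_refl] \<Delta> sp] order_refl])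
          show "s (Suc n) \<le> s n" using sS \<delta> by simp
          have "K\<^sub>4 * \<nu> ^ 3 * (2 - 2 * (1 / 2) ^ n) + K\<^sub>4 * \<nu> ^ 3 * (1 / 2) ^ n = K\<^sub>4 * \<nu> ^ 3 * (2 - 2 * (1 / 2) ^ Suc n)"
            by (simp add: algebra_simps)
          then show "K * \<nu>\<^sup>2 + K\<^sub>4 * \<nu> ^ 3 * (2 - 2 * (1 / 2) ^ n) + C\<^sub>0 / \<delta> ^ m * H
             \<le> K * \<nu>\<^sup>2 + K\<^sub>4 * \<nu> ^ 3 * (2 - 2 * (1 / 2) ^ Suc n)" using D1 by linarith
        qed
      qed
      moreover have "R n x (\<epsilon> + \<eta>, (\<lambda>t. (h t)\<^sup>2), (\<lambda>t. w t + \<Delta> t), (\<lambda>t. v t + h t))"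
        using \<eta>1 wiener_mono[OF \<Delta> s(1) D1] wiener_mono[OF h s(1) H1] by (simp add: R_def x)
      ultimately show ?thesis by blast
    qed
    have "\<exists>X. \<forall>n. (P n (X n) \<and> (n = 0 \<longrightarrow> X n = x0)) \<and> R n (X n) (X (Suc n))"
    proof (rule dependent_nat_choice)
      show "\<exists>x. P 0 x \<and> (0 = (0::nat) \<longrightarrow> x = x0)" using P0 by blast
      show "\<exists>y. (P (Suc n) y \<and> (Suc n = 0 \<longrightarrow> y = x0)) \<and> R n x y" if "P n x \<and> (n = 0 \<longrightarrow> x = x0)" for x n
        using step that by blast
    qed
    then obtain X where X: "\<And>n. P n (X n)" "\<And>n. R n (X n) (X (Suc n))" "X 0 = x0" by auto
    define \<epsilon> E w v where "\<epsilon> n = fst (X n)" and "E n = fst (snd (X n))"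
      and "w n = fst (snd (snd (X n)))" and "v n = snd (snd (snd (X n)))" for n
    have fl: "approx_floquet \<nu> (\<epsilon> n) (E n) (w n) (v n)" and En: "wiener (s n) (K\<^sup>2 * \<nu> ^ 4 * r ^ n) (E n)" for n
      using X(1)[of n] by (simp_all add: P_def \<epsilon>_def E_def w_def v_def split_beta)
    have incr: "cmod (\<epsilon> (Suc n) - \<epsilon> n) \<le> K\<^sub>5 * \<nu> ^ 4 * (1 / 2) ^ n"
      "wiener (\<sigma>\<^sub>0 / 2) (K\<^sub>4 * \<nu> ^ 3 * (1 / 2) ^ n) (\<lambda>t. w (Suc n) t - w n t)"
      "wiener (\<sigma>\<^sub>0 / 2) (K\<^sub>3 * \<nu> ^ 3 * (1 / 2) ^ n) (\<lambda>t. v (Suc n) t - v n t)" for n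
      using X(2)[of n] by (simp_all add: R_def \<epsilon>_def E_def w_def v_def split_beta)
    have init: "\<epsilon> 0 = of_real (\<nu>\<^sup>2 / abar)" "wiener (\<sigma>\<^sub>0 / 2) (K * \<nu>\<^sup>2) (w 0)" "wiener (\<sigma>\<^sub>0 / 2) (K * \<nu>\<^sup>2) (v 0)"
      using X(3) wiener_mono[OF wv0(1), of "\<sigma>\<^sub>0 / 2"] wiener_mono[OF wv0(2), of "\<sigma>\<^sub>0 / 2"] \<sigma>\<^sub>0
      by (simp_all add: \<epsilon>_def w_def v_def x0_def)
    have \<sigma>2: "0 \<le> \<sigma>\<^sub>0 / 2" using \<sigma>\<^sub>0 by simp
    obtain \<epsilon>' where \<epsilon>': "\<epsilon> \<longlonglongrightarrow> \<epsilon>'" "cmod (\<epsilon>' - \<epsilon> 0) \<le> 2 * (K\<^sub>5 * \<nu> ^ 4)"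
      using cauchy_geometric_limit[OF incr(1)] by blast
    obtain w' where w': "wiener (\<sigma>\<^sub>0 / 2) (K * \<nu>\<^sup>2 + 2 * (K\<^sub>4 * \<nu> ^ 3)) w'" "uniform_limit UNIV w w' sequentially"
      using wiener_geometric_limit[of "\<sigma>\<^sub>0 / 2" "K\<^sub>4 * \<nu> ^ 3" w, OF incr(2) init(2) \<sigma>2] by blast
    obtain v' where v': "wiener (\<sigma>\<^sub>0 / 2) (K * \<nu>\<^sup>2 + 2 * (K\<^sub>3 * \<nu> ^ 3)) v'" "uniform_limit UNIV v v' sequentially"
      using wiener_geometric_limit[of "\<sigma>\<^sub>0 / 2" "K\<^sub>3 * \<nu> ^ 3" v, OF incr(3) init(3) \<sigma>2] by blast
    have E0: "uniform_limit UNIV E (\<lambda>t. 0) sequentially"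
    proof -
      have "r < 1" using power_strict_decreasing[of 0 "4 * m + 1" "1 / 2 :: real"] by (simp add: r_def)
      then have "(\<lambda>n. K\<^sup>2 * \<nu> ^ 4 * r ^ n) \<longlonglongrightarrow> K\<^sup>2 * \<nu> ^ 4 * 0"
        using r by (intro tendsto_mult_left LIMSEQ_power_zero) auto
      then have lim: "(\<lambda>n. K\<^sup>2 * \<nu> ^ 4 * r ^ n) \<longlonglongrightarrow> 0" by simp
      have b: "cmod (E n t) \<le> K\<^sup>2 * \<nu> ^ 4 * r ^ n" for n t
        using wiener_bound[OF En] s(1)[of n] \<sigma>\<^sub>0 by auto
      show ?thesis
        unfolding uniform_limit_iff
      proof (intro allI impI)
        fix e :: real assume "e > 0"
        then have "\<forall>\<^sub>F n in sequentially. K\<^sup>2 * \<nu> ^ 4 * r ^ n < e" using order_tendstoD(2)[OF lim] by blast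
        then show "\<forall>\<^sub>F n in sequentially. \<forall>t\<in>UNIV. dist (E n t) 0 < e"
        proof eventually_elim
          case (elim n)
          show ?case using le_less_trans[OF b elim] by simp
        qed
      qed
    qed
    have "approx_floquet \<nu> \<epsilon>' (\<lambda>t. 0) w' v'"
      by (rule approx_floquet_limit[OF fl \<epsilon>'(1) E0 w'(2) v'(2) wiener_bound[OF v'(1) \<sigma>2]])
    moreover have "wiener (\<sigma>\<^sub>0 / 2) (C * \<nu>\<^sup>2) w'"
    proof (rule wiener_mono[OF w'(1) order_refl])
      have "K * \<nu>\<^sup>2 + 2 * (K\<^sub>4 * \<nu> ^ 3) \<le> K * \<nu>\<^sup>2 + 2 * (K\<^sub>4 * \<nu>\<^sup>2)" using K4 \<nu>32 by simp
      also have "\<dots> \<le> C * \<nu>\<^sup>2" using K3 K5 by (simp add: C_def ring_distribs)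
      finally show "K * \<nu>\<^sup>2 + 2 * (K\<^sub>4 * \<nu> ^ 3) \<le> C * \<nu>\<^sup>2" .
    qed
    moreover have "wiener (\<sigma>\<^sub>0 / 2) (C * \<nu>\<^sup>2) v'"
    proof (rule wiener_mono[OF v'(1) order_refl])
      have "K * \<nu>\<^sup>2 + 2 * (K\<^sub>3 * \<nu> ^ 3) \<le> K * \<nu>\<^sup>2 + 2 * (K\<^sub>3 * \<nu>\<^sup>2)" using K3 \<nu>32 by simp
      also have "\<dots> \<le> C * \<nu>\<^sup>2" using K4 K5 by (simp add: C_def ring_distribs)
      finally show "K * \<nu>\<^sup>2 + 2 * (K\<^sub>3 * \<nu> ^ 3) \<le> C * \<nu>\<^sup>2" .
    qed
    moreover have "cmod (\<epsilon>' - of_real (\<nu>\<^sup>2 / abar)) \<le> C * \<nu> ^ 4"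
    proof -
      have "2 * (K\<^sub>5 * \<nu> ^ 4) \<le> C * \<nu> ^ 4" using K K3 K4 \<nu> by (simp add: C_def ring_distribs)
      then show ?thesis using \<epsilon>'(2) init(1) by simp
    qed
    ultimately show ?thesis by blast
  qed
  show thesis by (rule that[OF \<nu>1(1) \<nu>1(5) C main])
qed

text \<open>A Wronskian of \<open>exp (\<i> \<nu>\<^sub>1 t + w\<^sub>1)\<close> and the conjugate of \<open>exp (\<i> \<nu>\<^sub>2 t + w\<^sub>2)\<close>; averaging its
  derivative compares the parameters without meeting any small divisor.\<close>

lemma wronskian_average:
  assumes f1: "approx_floquet \<nu>\<^sub>1 \<epsilon>\<^sub>1 (\<lambda>t. 0) w\<^sub>1 v\<^sub>1" and f2: "approx_floquet \<nu>\<^sub>2 \<epsilon>\<^sub>2 (\<lambda>t. 0) w\<^sub>2 v\<^sub>2"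
    and w: "wiener 0 \<beta>\<^sub>0 w\<^sub>1" "wiener 0 \<beta>\<^sub>0 w\<^sub>2" and v: "wiener 0 1 v\<^sub>1" "wiener 0 1 v\<^sub>2"
    and \<nu>: "0 \<le> \<nu>\<^sub>1" "\<nu>\<^sub>1 \<le> 1" "0 \<le> \<nu>\<^sub>2" "\<nu>\<^sub>2 \<le> 1"
  shows "cmod (\<epsilon>\<^sub>1 - cnj \<epsilon>\<^sub>2) \<le> 16 / abar * \<bar>\<nu>\<^sub>1 - \<nu>\<^sub>2\<bar>"
proof -
  define W where "W t = w\<^sub>1 t + cnj (w\<^sub>2 t)" for t
  \<comment> \<open>Up to the factor \<open>cis ((\<nu>\<^sub>1 - \<nu>\<^sub>2) * t)\<close>,
    \<open>exp (W t) * u t\<close> is the Wronskian of the first solution and the conjugate of the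
    second.\<close>
  define u where "u t = \<i> * of_real (\<nu>\<^sub>1 + \<nu>\<^sub>2) + (v\<^sub>1 t - cnj (v\<^sub>2 t))" for t
  have W: "wiener 0 (2 * \<beta>\<^sub>0) W"
    unfolding W_def using wiener_add[OF w(1) wiener_cnj[OF w(2)]] by simp
  have eb: "exp (2 * \<beta>\<^sub>0) - 1 \<le> 4 * \<beta>\<^sub>0"
    using exp_minus_one_le[of "2 * \<beta>\<^sub>0"] \<beta>\<^sub>0 by simp
  have e1: "wiener 0 (4 * \<beta>\<^sub>0) (\<lambda>t. exp (W t) - 1)"
    by (rule wiener_mono[OF wiener_exp_minus_1[OF W] order_refl eb]) simp
  have e2: "wiener 0 2 (\<lambda>t. exp (W t))"
    by (rule wiener_mono[OF wiener_exp[OF W]]) (use eb \<beta>\<^sub>0 in auto)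
  have u: "wiener 0 4 u"
    unfolding u_def[abs_def]
    by (rule wiener_mono[OF wiener_add[OF wiener_const wiener_diff[OF v(1) wiener_cnj[OF v(2)]]]])
       (use \<nu> in \<open>auto simp: norm_mult simp flip: of_real_add\<close>)
  have y: "wiener 0 8 (\<lambda>t. exp (W t) * u t)" using wiener_mult[OF e2 u] by simp
  have a0: "wiener 0 A (\<lambda>t. of_real (a t))" using wiener_mono[OF a, of 0 A] \<sigma>\<^sub>0 by simp
  have ae: "wiener 0 (A * 2) (\<lambda>t. of_real (a t) * exp (W t))" by (rule wiener_mult[OF a0 e2]) simp
  have n1: "cmod (mean (\<lambda>t. of_real (a t) * (exp (W t) - 1))) \<le> abar / 8"
    using wiener_mean_bound[OF wiener_mult[OF a0 e1]] \<beta>\<^sub>0(3) by (simp add: mult_ac)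
  have "mean (\<lambda>t. of_real (a t) * exp (W t)) = of_real abar + mean (\<lambda>t. of_real (a t) * (exp (W t) - 1))"
    using mean_add[OF a0 wiener_mult[OF a0 e1]] mean_eq[OF a_mean] by (simp add: algebra_simps)
  then have lower: "abar / 2 \<le> cmod (mean (\<lambda>t. of_real (a t) * exp (W t)))"
    using n1 abar norm_diff_ineq[of "of_real abar" "mean (\<lambda>t. of_real (a t) * (exp (W t) - 1))"] by simp
  have d1: "(w\<^sub>1 has_vector_derivative v\<^sub>1 t) (at t)" "(v\<^sub>1 has_vector_derivative
      0 - 2 * \<i> * of_real \<nu>\<^sub>1 * v\<^sub>1 t - (v\<^sub>1 t)\<^sup>2 + (of_real \<nu>\<^sub>1)\<^sup>2 - \<epsilon>\<^sub>1 * of_real (a t)) (at t)" for t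
    using f1 by (auto simp: approx_floquet_def)
  have d2: "((\<lambda>t. cnj (w\<^sub>2 t)) has_vector_derivative cnj (v\<^sub>2 t)) (at t)" "((\<lambda>t. cnj (v\<^sub>2 t)) has_vector_derivative
      cnj (0 - 2 * \<i> * of_real \<nu>\<^sub>2 * v\<^sub>2 t - (v\<^sub>2 t)\<^sup>2 + (of_real \<nu>\<^sub>2)\<^sup>2 - \<epsilon>\<^sub>2 * of_real (a t))) (at t)" for t
    using f2 bounded_linear.has_vector_derivative[OF bounded_linear_cnj] unfolding approx_floquet_def by blast+
  have dW: "((\<lambda>t. exp (W t)) has_vector_derivative (v\<^sub>1 t + cnj (v\<^sub>2 t)) * exp (W t)) (at t)" for t
    using has_vector_derivative_exp[of W "v\<^sub>1 t + cnj (v\<^sub>2 t)" t 1] has_vector_derivative_add[OF d1(1) d2(1)]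
    by (simp add: W_def[abs_def])
  have dy: "((\<lambda>t. exp (W t) * u t) has_vector_derivative
      - (\<i> * of_real (\<nu>\<^sub>1 - \<nu>\<^sub>2) * (exp (W t) * u t)) - (\<epsilon>\<^sub>1 - cnj \<epsilon>\<^sub>2) * (of_real (a t) * exp (W t))) (at t)" for t
  proof -
    have du: "(u has_vector_derivative 0 + ((0 - 2 * \<i> * of_real \<nu>\<^sub>1 * v\<^sub>1 t - (v\<^sub>1 t)\<^sup>2 + (of_real \<nu>\<^sub>1)\<^sup>2 - \<epsilon>\<^sub>1 * of_real (a t))
      - cnj (0 - 2 * \<i> * of_real \<nu>\<^sub>2 * v\<^sub>2 t - (v\<^sub>2 t)\<^sup>2 + (of_real \<nu>\<^sub>2)\<^sup>2 - \<epsilon>\<^sub>2 * of_real (a t)))) (at t)"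
      unfolding u_def[abs_def]
      by (intro has_vector_derivative_add has_vector_derivative_const has_vector_derivative_diff d1 d2)
    have "exp (W t) * (0 + ((0 - 2 * \<i> * of_real \<nu>\<^sub>1 * v\<^sub>1 t - (v\<^sub>1 t)\<^sup>2 + (of_real \<nu>\<^sub>1)\<^sup>2 - \<epsilon>\<^sub>1 * of_real (a t))
      - cnj (0 - 2 * \<i> * of_real \<nu>\<^sub>2 * v\<^sub>2 t - (v\<^sub>2 t)\<^sup>2 + (of_real \<nu>\<^sub>2)\<^sup>2 - \<epsilon>\<^sub>2 * of_real (a t)))) +
      (v\<^sub>1 t + cnj (v\<^sub>2 t)) * exp (W t) * u t =
      - (\<i> * of_real (\<nu>\<^sub>1 - \<nu>\<^sub>2) * (exp (W t) * u t)) - (\<epsilon>\<^sub>1 - cnj \<epsilon>\<^sub>2) * (of_real (a t) * exp (W t))"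
      by (simp add: u_def algebra_simps power2_eq_square)
    then show ?thesis using has_vector_derivative_mult[OF dW[of t] du] by metis
  qed
  have cy: "wiener 0 (cmod (- (\<i> * of_real (\<nu>\<^sub>1 - \<nu>\<^sub>2))) * 8) (\<lambda>t. - (\<i> * of_real (\<nu>\<^sub>1 - \<nu>\<^sub>2)) * (exp (W t) * u t))"
    by (rule wiener_cmult[OF y]) simp
  have ca: "wiener 0 (cmod (- (\<epsilon>\<^sub>1 - cnj \<epsilon>\<^sub>2)) * (A * 2)) (\<lambda>t. - (\<epsilon>\<^sub>1 - cnj \<epsilon>\<^sub>2) * (of_real (a t) * exp (W t)))"
    by (rule wiener_cmult[OF ae]) simp
  \<comment> \<open>The derivative of a bounded function has mean 0. This balances
    \<open>\<nu>\<^sub>1 - \<nu>\<^sub>2\<close>, whose coefficient is at most 8, against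
    \<open>\<epsilon>\<^sub>1 - cnj \<epsilon>\<^sub>2\<close>, whose coefficient is at least
    \<open>abar / 2\<close>. Applied to one solution twice it shows that the parameter is
    real.\<close>
  have "0 = mean (\<lambda>t. - (\<i> * of_real (\<nu>\<^sub>1 - \<nu>\<^sub>2)) * (exp (W t) * u t) + - (\<epsilon>\<^sub>1 - cnj \<epsilon>\<^sub>2) * (of_real (a t) * exp (W t)))"
    by (rule mean_eq[symmetric], rule has_mean_derivative[where F = "\<lambda>t. exp (W t) * u t" and M = 8])
       (use dy wiener_bound[OF y] in \<open>simp_all only: mult_minus_left diff_conv_add_uminus order_refl\<close>)
  also have "\<dots> = - (\<i> * of_real (\<nu>\<^sub>1 - \<nu>\<^sub>2)) * mean (\<lambda>t. exp (W t) * u t)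
      + - (\<epsilon>\<^sub>1 - cnj \<epsilon>\<^sub>2) * mean (\<lambda>t. of_real (a t) * exp (W t))"
    unfolding mean_cmult[OF y order_refl, symmetric] mean_cmult[OF ae order_refl, symmetric]
    by (rule mean_add[OF cy ca]) auto
  finally have "(\<epsilon>\<^sub>1 - cnj \<epsilon>\<^sub>2) * mean (\<lambda>t. of_real (a t) * exp (W t)) =
      - (\<i> * of_real (\<nu>\<^sub>1 - \<nu>\<^sub>2)) * mean (\<lambda>t. exp (W t) * u t)"
    by (simp add: algebra_simps)
  from arg_cong[OF this, of cmod]
  have "cmod (\<epsilon>\<^sub>1 - cnj \<epsilon>\<^sub>2) * cmod (mean (\<lambda>t. of_real (a t) * exp (W t))) = \<bar>\<nu>\<^sub>1 - \<nu>\<^sub>2\<bar> * cmod (mean (\<lambda>t. exp (W t) * u t))"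
    by (simp only: norm_mult norm_minus_cancel norm_ii mult_1 norm_of_real)
  also have "\<dots> \<le> \<bar>\<nu>\<^sub>1 - \<nu>\<^sub>2\<bar> * 8" using wiener_mean_bound[OF y order_refl] by (intro mult_left_mono) auto
  finally have "cmod (\<epsilon>\<^sub>1 - cnj \<epsilon>\<^sub>2) * (abar / 2) \<le> \<bar>\<nu>\<^sub>1 - \<nu>\<^sub>2\<bar> * 8"
    using mult_left_mono[OF lower norm_ge_zero[of "\<epsilon>\<^sub>1 - cnj \<epsilon>\<^sub>2"]] by linarith
  then show ?thesis using abar by (simp add: field_simps)
qed

end

section \<open>Averages over the torus\<close>

text \<open>Such a \<open>g\<close> is orthogonal to all \<open>((1 + cos s) / 2) ^ m\<close>, whose mass concentrates at \<open>0\<close> modulo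
  \<open>2 * pi\<close>.\<close>

lemma continuous_periodic_eq_0:
  fixes g :: "real \<Rightarrow> complex"
  assumes cont: "continuous_on UNIV g" and per: "\<And>s. g (s + 2 * pi) = g s"
    and orth: "\<And>n::int. integral {0..2*pi} (\<lambda>s. g s * cis (of_int n * s)) = 0"
  shows "g 0 = 0"
proof -
  define B where "B m s = ((1 + cos s) / 2) ^ m" for m and s :: real
  have cB: "continuous_on S (B m)" for m S unfolding B_def by (intro continuous_intros) auto
  have cg: "continuous_on S g" for S using cont by (rule continuous_on_subset) simp
  have B01: "0 \<le> B m s" "(1 + cos s) / 2 \<le> 1" "0 \<le> (1 + cos s) / 2" for m s
  proof -
    have "0 \<le> 1 + cos s" using cos_ge_minus_one[of s] by linarith
    then show "0 \<le> B m s" "(1 + cos s) / 2 \<le> 1" "0 \<le> (1 + cos s) / 2" by (auto simp: B_def)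
  qed
  have int: "(\<lambda>s. g s * cis (of_int n * s) * of_real (B m s)) integrable_on {0..2*pi}" for n m
    by (intro integrable_continuous_real continuous_intros cg cB)
  \<comment> \<open>\<open>(1 + cos s) / 2\<close> is a combination of 1, \<open>cis s\<close> and
    \<open>cis (- s)\<close>, so raising \<open>m\<close> shifts \<open>n\<close>; hence the
    induction treats all \<open>n\<close> at once.\<close>
  have gB': "((\<lambda>s. g s * cis (of_int n * s) * of_real (B m s)) has_integral 0) {0..2*pi}" for m n
  proof (induction m arbitrary: n)
    case 0
    then show ?case using integrable_integral[OF int[of n 0]] orth[of n] by (simp add: B_def)
  next
    case (Suc m)
    have "1 / 2 * (g s * cis (of_int n * s) * of_real (B m s)) +
        (1 / 4 * (g s * cis (of_int (n + 1) * s) * of_real (B m s)) +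
         1 / 4 * (g s * cis (of_int (n - 1) * s) * of_real (B m s))) =
        g s * cis (of_int n * s) * of_real (B (Suc m) s)" for s
    proof -
      have 1: "cis (of_int (n + 1) * s) = cis (of_int n * s) * cis s" "cis (of_int (n - 1) * s) = cis (of_int n * s) * cis (- s)"
        by (simp_all add: cis_mult algebra_simps)
      have "complex_of_real ((1 + cos s) / 2) = 1 / 2 + (cis s + cis (- s)) / 4" by (simp add: complex_eq_iff)
      then have 2: "complex_of_real (B (Suc m) s) = (1 / 2 + (cis s + cis (- s)) / 4) * of_real (B m s)"
        by (simp add: B_def)
      show ?thesis unfolding 1 2 by (simp add: algebra_simps)
    qed
    moreover have "((\<lambda>s. 1 / 2 * (g s * cis (of_int n * s) * of_real (B m s)) +
        (1 / 4 * (g s * cis (of_int (n + 1) * s) * of_real (B m s)) +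
         1 / 4 * (g s * cis (of_int (n - 1) * s) * of_real (B m s)))) has_integral 1 / 2 * 0 + (1 / 4 * 0 + 1 / 4 * 0)) {0..2*pi}"
      by (intro has_integral_add has_integral_mult_right Suc.IH)
    ultimately show ?case by simp
  qed
  have gB: "integral {0..2*pi} (\<lambda>s. g s * cis (of_int n * s) * of_real (B m s)) = 0" for m n
    using gB' by (rule integral_unique)
  obtain M where M: "\<And>s. s \<in> {0..2*pi} \<Longrightarrow> cmod (g s) \<le> M"
    using compact_imp_bounded[OF compact_continuous_image[OF cg compact_Icc]] by (force simp: bounded_iff)
  have M0: "0 \<le> M" using M[of 0] by (smt (verit) norm_ge_zero atLeastAtMost_iff pi_gt_zero)
  have "cmod (g 0) \<le> \<epsilon>" if \<epsilon>: "0 < \<epsilon>" for \<epsilon>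
  proof -
    obtain \<delta>' where \<delta>': "0 < \<delta>'" "\<And>s. \<bar>s\<bar> < \<delta>' \<Longrightarrow> cmod (g s - g 0) < \<epsilon>"
      using cont \<epsilon> unfolding continuous_on_iff by (metis UNIV_I dist_norm diff_zero real_norm_def)
    define \<delta> where "\<delta> = min (\<delta>' / 2) 1"
    have \<delta>: "0 < \<delta>" "\<delta> < \<delta>'" "\<delta> \<le> 1" using \<delta>' by (auto simp: \<delta>_def)
    have near: "cmod (g s - g 0) \<le> \<epsilon>" if "s \<in> {0..2*pi}" "s \<le> \<delta> \<or> 2 * pi - \<delta> \<le> s" for s
    proof (cases "s \<le> \<delta>")
      case True then show ?thesis using \<delta>'(2)[of s] \<delta> that by simp
    next
      case False
      then have "\<bar>s - 2 * pi\<bar> < \<delta>'" using that \<delta> by auto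
      from \<delta>'(2)[OF this] per[of "s - 2 * pi"] show ?thesis by simp
    qed
    \<comment> \<open>At distance at least \<open>\<delta>\<close> from the multiples of
      \<open>2 * pi\<close> the kernel is at most \<open>q ^ m\<close>, within
      \<open>\<delta> / 2\<close> it is at least \<open>q' ^ m\<close>. As \<open>q < q'\<close>,
      the far part becomes negligible after division by the total mass.\<close>
    define q where "q = (1 + cos \<delta>) / 2"
    define q' where "q' = (1 + cos (\<delta> / 2)) / 2"
    have pi3: "3 < pi" by (rule pi_gt3)
    have q: "0 < q" "q < q'" using \<delta> pi3 cos_monotone_0_pi[of "\<delta> / 2" \<delta>] cos_gt_zero[of \<delta>]
      by (auto simp: q_def q'_def intro: add_pos_pos)
    have far: "(1 + cos s) / 2 \<le> q" if "\<delta> \<le> s" "s \<le> 2 * pi - \<delta>" for s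
    proof (cases "s \<le> pi")
      case True then show ?thesis using cos_monotone_0_pi_le[of \<delta> s] that \<delta> by (simp add: q_def)
    next
      case False
      then show ?thesis using cos_monotone_0_pi_le[of \<delta> "2 * pi - s"] that \<delta> cos_periodic[of "- s"]
        by (simp add: q_def cos_diff)
    qed
    have IB: "B m integrable_on {0..2*pi}" for m by (intro integrable_continuous_real cB)
    have low: "\<delta> / 2 * q' ^ m \<le> integral {0..2*pi} (B m)" for m
    proof -
      have "integral {0..\<delta>/2} (\<lambda>s. q' ^ m) \<le> integral {0..\<delta>/2} (B m)"
      proof (rule integral_le)
        fix s assume s: "s \<in> {0..\<delta>/2}"
        have "cos (\<delta> / 2) \<le> cos s" using s \<delta> pi3 by (intro cos_monotone_0_pi_le) auto
        then show "q' ^ m \<le> B m s" unfolding B_def using q by (intro power_mono) (auto simp: q'_def)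
      qed (use cB in \<open>auto intro: integrable_continuous_real\<close>)
      also have "\<dots> \<le> integral {0..2*pi} (B m)"
        using \<delta> pi3 B01 by (intro integral_subset_le integrable_continuous_real cB) auto
      finally show ?thesis using \<delta> by simp
    qed
    have up: "cmod (g 0) * integral {0..2*pi} (B m) \<le> \<epsilon> * integral {0..2*pi} (B m) + 2 * pi * (2 * M * q ^ m)" for m
    proof -
      have "integral {0..2*pi} (\<lambda>s. (g s - g 0) * of_real (B m s)) =
          integral {0..2*pi} (\<lambda>s. g s * of_real (B m s) - g 0 * of_real (B m s))" by (simp add: algebra_simps)
      also have "\<dots> = integral {0..2*pi} (\<lambda>s. g s * of_real (B m s)) - integral {0..2*pi} (\<lambda>s. g 0 * of_real (B m s))"
        by (intro integral_diff integrable_continuous_real continuous_intros cg cB)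
      also have "\<dots> = - (g 0 * of_real (integral {0..2*pi} (B m)))"
        using gB[of 0 m] integral_linear[OF IB[of m] bounded_linear_of_real[where 'a = complex]] by (simp add: o_def)
      finally have "cmod (g 0) * integral {0..2*pi} (B m) = cmod (integral {0..2*pi} (\<lambda>s. (g s - g 0) * of_real (B m s)))"
        using integral_nonneg[OF IB[of m]] B01 by (simp add: norm_mult)
      also have "\<dots> \<le> integral {0..2*pi} (\<lambda>s. \<epsilon> * B m s + 2 * M * q ^ m)"
      proof (rule integral_norm_bound_integral)
        show "(\<lambda>s. (g s - g 0) * of_real (B m s)) integrable_on {0..2*pi}"
          by (intro integrable_continuous_real continuous_intros cg cB)
        show "(\<lambda>s. \<epsilon> * B m s + 2 * M * q ^ m) integrable_on {0..2*pi}"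
          by (intro integrable_continuous_real continuous_intros cB)
        fix s assume s: "s \<in> {0..2*pi}"
        have n: "cmod ((g s - g 0) * of_real (B m s)) = cmod (g s - g 0) * B m s" using B01 by (simp add: norm_mult)
        show "cmod ((g s - g 0) * of_real (B m s)) \<le> \<epsilon> * B m s + 2 * M * q ^ m"
        proof (cases "s \<le> \<delta> \<or> 2 * pi - \<delta> \<le> s")
          case True
          then show ?thesis unfolding n using mult_right_mono[OF near[OF s] B01(1)[of m s]] M0 q by (simp add: add_increasing2)
        next
          case False
          have "cmod (g s - g 0) \<le> 2 * M" using M[OF s] M[of 0] norm_triangle_ineq4[of "g s" "g 0"] by simp
          moreover have "B m s \<le> q ^ m" unfolding B_def using far[of s] False B01(3)[of s] by (intro power_mono) auto
          ultimately have "cmod (g s - g 0) * B m s \<le> 2 * M * q ^ m" using M0 B01 by (intro mult_mono) auto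
          then show ?thesis unfolding n using \<epsilon> B01(1)[of m s] by (simp add: add_increasing)
        qed
      qed
      also have "\<dots> = \<epsilon> * integral {0..2*pi} (B m) + 2 * pi * (2 * M * q ^ m)"
        using IB by (subst integral_add) (auto intro!: integrable_on_mult_right)
      finally show ?thesis .
    qed
    have b: "cmod (g 0) \<le> \<epsilon> + 8 * pi * M / \<delta> * (q / q') ^ m" for m
    proof -
      define I where "I = integral {0..2*pi} (B m)"
      have q': "0 < q'" using q by simp
      have I: "0 < I" unfolding I_def by (rule less_le_trans[OF _ low]) (use \<delta> q' in auto)
      have "cmod (g 0) \<le> \<epsilon> + 2 * pi * (2 * M * q ^ m) / I"
        using up[of m] I unfolding I_def[symmetric] by (simp add: field_simps)
      also have "2 * pi * (2 * M * q ^ m) / I \<le> 2 * pi * (2 * M * q ^ m) / (\<delta> / 2 * q' ^ m)"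
        using M0 q low[of m] I q' \<delta> unfolding I_def[symmetric] by (intro divide_left_mono mult_pos_pos) auto
      also have "\<dots> = 8 * pi * M / \<delta> * (q / q') ^ m" by (simp add: power_divide divide_simps)
      finally show ?thesis by simp
    qed
    have "(\<lambda>m. \<epsilon> + 8 * pi * M / \<delta> * (q / q') ^ m) \<longlonglongrightarrow> \<epsilon> + 8 * pi * M / \<delta> * 0"
      using q by (intro tendsto_intros LIMSEQ_power_zero) auto
    then show ?thesis using b by (intro LIMSEQ_le_const[of _ \<epsilon>]) auto
  qed
  then have "cmod (g 0) \<le> 0" using field_le_epsilon[of "cmod (g 0)" 0] by simp
  then show ?thesis by simp
qed

definition line_mean :: "'i::finite \<Rightarrow> (complex ^ 'i \<Rightarrow> complex) \<Rightarrow> complex ^ 'i \<Rightarrow> complex" where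
  "line_mean j F \<theta> = integral {0..2*pi} (\<lambda>s. F (\<theta> + axis j (of_real s))) / of_real (2 * pi)"

text \<open>The torus average as iterated integrals in the order of a list. Partial lists are
  meaningful too, which allows induction over one coordinate at a time.\<close>

fun multi_mean :: "'i::finite list \<Rightarrow> (complex ^ 'i \<Rightarrow> complex) \<Rightarrow> complex ^ 'i \<Rightarrow> complex" where
  "multi_mean [] F = F"
| "multi_mean (j # js) F = line_mean j (multi_mean js F)"

definition cont_periodic :: "real \<Rightarrow> (complex ^ 'i::finite \<Rightarrow> complex) \<Rightarrow> bool" where
  "cont_periodic \<rho> F \<longleftrightarrow> continuous_on (strip \<rho>) F \<and>
     (\<forall>\<theta>\<in>strip \<rho>. \<forall>j. F (\<theta> + axis j (of_real (2 * pi))) = F \<theta>)"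

definition fourier_mode :: "int ^ 'i \<Rightarrow> complex ^ 'i::finite \<Rightarrow> complex" where
  "fourier_mode k \<theta> = exp (\<i> * (\<Sum>j\<in>UNIV. of_int (k $ j) * \<theta> $ j))"

lemma strip_axis_real: "\<theta> + axis j (of_real s) \<in> strip \<rho> \<longleftrightarrow> \<theta> \<in> strip \<rho>"
proof -
  have "Im ((\<theta> + axis j (of_real s)) $ i) = Im (\<theta> $ i)" for i by (simp add: axis_def)
  then show ?thesis unfolding strip_def by simp
qed

lemma continuous_on_axis:
  fixes f :: "'a::topological_space \<Rightarrow> complex"
  assumes "continuous_on S f"
  shows "continuous_on S (\<lambda>x. axis j (f x) :: complex ^ 'i::finite)"
  unfolding axis_def
proof (intro continuous_on_vec_lambda)
  show "continuous_on S (\<lambda>x. if i = j then f x else 0)" for i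
    using assms by (cases "i = j") auto
qed

lemma continuous_on_shifted:
  assumes "continuous_on (strip \<rho>) F"
  shows "continuous_on (strip \<rho> \<times> S) (\<lambda>(\<theta>, s). F (\<theta> + axis j (of_real s)))"
  unfolding split_beta
  by (rule continuous_on_compose2[OF assms])
     (auto simp: strip_axis_real intro!: continuous_intros continuous_on_axis)

lemma continuous_on_line:
  assumes "continuous_on (strip \<rho>) F" "\<theta> \<in> strip \<rho>"
  shows "continuous_on S (\<lambda>s. F (\<theta> + axis j (of_real s)))"
  by (rule continuous_on_compose2[OF assms(1)])
     (use assms(2) in \<open>auto simp: strip_axis_real intro!: continuous_intros continuous_on_axis\<close>)

lemma cont_periodic_line_mean:
  assumes "cont_periodic \<rho> F" shows "cont_periodic \<rho> (line_mean j F)"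
  unfolding cont_periodic_def
proof (intro conjI ballI allI)
  have c: "continuous_on (strip \<rho>) F" using assms by (simp add: cont_periodic_def)
  show "continuous_on (strip \<rho>) (line_mean j F)"
    unfolding line_mean_def[abs_def]
    using integral_continuous_on_param[of "strip \<rho>" 0 "2 * pi" "\<lambda>\<theta> s. F (\<theta> + axis j (of_real s))"] continuous_on_shifted[OF c]
    by (intro continuous_intros) auto
  fix \<theta> :: "complex ^ 'a" and i assume \<theta>: "\<theta> \<in> strip \<rho>"
  have "F (\<theta> + axis i (of_real (2 * pi)) + axis j (of_real s)) = F (\<theta> + axis j (of_real s))" for s
  proof -
    have "\<theta> + axis j (of_real s) \<in> strip \<rho>" using \<theta> by (simp add: strip_axis_real)
    then have "F (\<theta> + axis j (of_real s) + axis i (of_real (2 * pi))) = F (\<theta> + axis j (of_real s))"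
      using assms by (simp add: cont_periodic_def)
    then show ?thesis by (simp add: add_ac)
  qed
  then show "line_mean j F (\<theta> + axis i (of_real (2 * pi))) = line_mean j F \<theta>"
    by (simp add: line_mean_def)
qed

lemma cont_periodic_multi_mean: "cont_periodic \<rho> F \<Longrightarrow> cont_periodic \<rho> (multi_mean js F)"
  by (induction js) (auto intro: cont_periodic_line_mean)

lemma line_mean_bound:
  assumes "continuous_on (strip \<rho>) F" "\<theta> \<in> strip \<rho>" "\<And>s. cmod (F (\<theta> + axis j (of_real s))) \<le> M"
  shows "cmod (line_mean j F \<theta>) \<le> M"
proof -
  have "cmod (integral {0..2*pi} (\<lambda>s. F (\<theta> + axis j (of_real s)))) \<le> M * (2 * pi - 0)"
    by (rule integral_bound) (use assms continuous_on_line in auto)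
  then show ?thesis by (simp add: line_mean_def norm_divide norm_mult field_simps)
qed

text \<open>Averaging moves only real parts, so a bound on the points with the imaginary parts of
  \<open>\<theta>\<close> is enough. The decay of the Fourier coefficients rests on this.\<close>

lemma multi_mean_bound:
  assumes "cont_periodic \<rho> F"
    and "\<And>\<theta>'. (\<And>j. Im (\<theta>' $ j) = Im (\<theta> $ j)) \<Longrightarrow> cmod (F \<theta>') \<le> M" and "\<theta> \<in> strip \<rho>"
  shows "cmod (multi_mean js F \<theta>) \<le> M"
  using assms(2,3)
proof (induction js arbitrary: \<theta>)
  case (Cons j js)
  have c: "continuous_on (strip \<rho>) (multi_mean js F)"
    using cont_periodic_multi_mean[OF assms(1)] by (simp add: cont_periodic_def)
  have "cmod (multi_mean js F (\<theta> + axis j (of_real s))) \<le> M" for s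
  proof (rule Cons.IH)
    show "cmod (F \<theta>') \<le> M" if "\<And>i. Im (\<theta>' $ i) = Im ((\<theta> + axis j (of_real s)) $ i)" for \<theta>'
      by (rule Cons.prems(1)) (use that in \<open>simp add: axis_def\<close>)
  qed (use Cons.prems in \<open>simp add: strip_axis_real\<close>)
  then show ?case using line_mean_bound[OF c Cons.prems(2)] by simp
qed auto

lemma line_mean_commute:
  assumes "continuous_on (strip \<rho>) F" "\<theta> \<in> strip \<rho>"
  shows "line_mean i (line_mean j F) \<theta> = line_mean j (line_mean i F) \<theta>"
proof -
  have "continuous_on (cbox (0, 0) (2 * pi, 2 * pi)) (\<lambda>(s, t). F (\<theta> + axis i (of_real s) + axis j (of_real t)))"
    unfolding split_beta
    by (rule continuous_on_compose2[OF assms(1)])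
       (use assms(2) in \<open>auto simp: strip_axis_real intro!: continuous_intros continuous_on_axis\<close>)
  from integral_swap_continuous[OF this] show ?thesis
    by (simp add: line_mean_def add_ac)
qed

lemma line_mean_cong: "\<theta> \<in> strip \<rho> \<Longrightarrow> (\<And>\<theta>. \<theta> \<in> strip \<rho> \<Longrightarrow> F \<theta> = G \<theta>) \<Longrightarrow> line_mean j F \<theta> = line_mean j G \<theta>"
  by (simp add: line_mean_def strip_axis_real)

lemma multi_mean_line_mean:
  assumes "cont_periodic \<rho> F" "\<theta> \<in> strip \<rho>"
  shows "multi_mean js (line_mean j F) \<theta> = line_mean j (multi_mean js F) \<theta>"
  using assms(2)
proof (induction js arbitrary: \<theta>)
  case (Cons i js)
  have c: "continuous_on (strip \<rho>) (multi_mean js F)"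
    using cont_periodic_multi_mean[OF assms(1)] by (simp add: cont_periodic_def)
  have "line_mean i (multi_mean js (line_mean j F)) \<theta> = line_mean i (line_mean j (multi_mean js F)) \<theta>"
    by (rule line_mean_cong[OF Cons.prems Cons.IH])
  then show ?case using line_mean_commute[OF c Cons.prems] by simp
qed simp

section \<open>Independence of the averages from the imaginary parts\<close>

definition separately_holomorphic :: "real \<Rightarrow> (complex ^ 'i::finite \<Rightarrow> complex) \<Rightarrow> bool" where
  "separately_holomorphic \<rho> F \<longleftrightarrow> (\<forall>\<theta>\<in>strip \<rho>. \<forall>j z. \<theta> + axis j z \<in> strip \<rho> \<longrightarrow>
     (\<lambda>z. F (\<theta> + axis j z)) field_differentiable at z)"

lemma axis_add: "axis j (x + y) = axis j x + axis j (y :: 'a::monoid_add)"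
  by (simp add: vec_eq_iff axis_def)

text \<open>If \<open>G\<close> is a primitive of \<open>z \<mapsto> F (\<theta> + axis j z)\<close> on the strip, then \<open>G (z + 2 * pi) - G z\<close> does
  not depend on \<open>z\<close>.\<close>

lemma line_mean_shift:
  assumes F: "cont_periodic \<rho> F" "separately_holomorphic \<rho> F"
    and \<theta>: "\<theta> \<in> strip \<rho>" "\<theta> + axis j z \<in> strip \<rho>"
  shows "line_mean j F (\<theta> + axis j z) = line_mean j F \<theta>"
proof -
  define S where "S = {z. \<theta> + axis j z \<in> strip \<rho>}"
  define g where "g z = F (\<theta> + axis j z)" for z
  have S: "S = {z. \<bar>Im (\<theta> $ j) + Im z\<bar> \<le> \<rho>}"
  proof -
    have "(\<theta> + axis j z \<in> strip \<rho>) = (\<bar>Im (\<theta> $ j) + Im z\<bar> \<le> \<rho>)" for z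
    proof
      assume "\<theta> + axis j z \<in> strip \<rho>"
      then have "\<bar>Im ((\<theta> + axis j z) $ j)\<bar> \<le> \<rho>" unfolding strip_def by blast
      then show "\<bar>Im (\<theta> $ j) + Im z\<bar> \<le> \<rho>" by simp
    next
      assume *: "\<bar>Im (\<theta> $ j) + Im z\<bar> \<le> \<rho>"
      have "\<bar>Im ((\<theta> + axis j z) $ i)\<bar> \<le> \<rho>" for i
        using * \<theta>(1) by (cases "i = j") (auto simp: axis_def strip_def)
      then show "\<theta> + axis j z \<in> strip \<rho>" by (simp add: strip_def)
    qed
    then show ?thesis by (simp add: S_def)
  qed
  have Sadd: "w + of_real s \<in> S" if "w \<in> S" for w s using that by (simp add: S)
  have "S = {z. - \<rho> - Im (\<theta> $ j) \<le> Im z} \<inter> {z. Im z \<le> \<rho> - Im (\<theta> $ j)}" by (auto simp: S)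
  then have cS: "convex S" by (simp add: convex_Int convex_halfspace_Im_le convex_halfspace_Im_ge)
  have dg: "g field_differentiable at w" if "w \<in> S" for w
    using F(2) \<theta>(1) that by (simp add: separately_holomorphic_def S_def g_def[abs_def])
  have contg: "continuous_on S g"
    using dg by (simp add: continuous_at_imp_continuous_on field_differentiable_imp_continuous_at)
  obtain G where G: "\<And>w. w \<in> S \<Longrightarrow> (G has_field_derivative g w) (at w within S)"
    by (rule holomorphic_convex_primitive[OF cS finite.emptyI contg]) (use dg interior_subset in blast)+
  have per: "g (w + of_real (2 * pi)) = g w" if "w \<in> S" for w
    using F(1) that by (simp add: cont_periodic_def S_def g_def axis_add add.assoc[symmetric])
  have "\<exists>c. \<forall>w\<in>S. G (w + of_real (2 * pi)) - G w = c"
  proof (rule has_field_derivative_zero_constant[OF cS])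
    fix w assume w: "w \<in> S"
    have im: "(\<lambda>w. w + of_real (2 * pi)) ` S \<subseteq> S" using Sadd by blast
    have "((\<lambda>w. w + of_real (2 * pi)) has_field_derivative 1) (at w within S)"
      by (auto intro!: derivative_eq_intros)
    from DERIV_image_chain[OF DERIV_subset[OF G[OF Sadd[OF w]] im] this]
    have "((\<lambda>w. G (w + of_real (2 * pi))) has_field_derivative g (w + of_real (2 * pi))) (at w within S)"
      by (simp add: o_def)
    from DERIV_diff[OF this G[OF w]]
    show "((\<lambda>w. G (w + of_real (2 * pi)) - G w) has_field_derivative 0) (at w within S)"
      using per[OF w] by simp
  qed
  then obtain c where c: "\<And>w. w \<in> S \<Longrightarrow> G (w + of_real (2 * pi)) - G w = c" by blast
  have I: "integral {0..2*pi} (\<lambda>s. g (w + of_real s)) = c" if w: "w \<in> S" for w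
  proof -
    have "((\<lambda>s. g (w + of_real s)) has_integral (G (w + of_real (2 * pi)) - G (w + of_real 0))) {0..2*pi}"
    proof (rule fundamental_theorem_of_calculus[where f = "\<lambda>s. G (w + of_real s)"])
      fix s :: real
      have "((\<lambda>s. w + of_real s) has_vector_derivative 1) (at s within {0..2*pi})"
        by (auto intro!: derivative_eq_intros)
      moreover have "(G has_field_derivative g (w + of_real s)) (at (w + of_real s) within (\<lambda>s. w + of_real s) ` {0..2*pi})"
        by (rule DERIV_subset[OF G[OF Sadd[OF w]]]) (use Sadd w in blast)
      ultimately show "((\<lambda>s. G (w + of_real s)) has_vector_derivative g (w + of_real s)) (at s within {0..2*pi})"
        using field_vector_diff_chain_within by (fastforce simp: o_def)
    qed simp
    then show ?thesis using c[OF w] by (simp add: integral_unique)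
  qed
  have "z \<in> S" using \<theta> by (simp add: S_def)
  have "0 \<in> S" using \<theta>(1) by (simp add: S strip_def)
  have ax0: "axis j (0::complex) = 0" by (simp add: vec_eq_iff axis_def)
  have *: "\<theta> + axis j z + axis j (of_real s) = \<theta> + axis j (z + of_real s)" for s
    by (simp add: axis_add add.assoc)
  show ?thesis
    using I[OF \<open>z \<in> S\<close>] I[OF \<open>0 \<in> S\<close>] unfolding line_mean_def * by (simp add: g_def ax0)
qed

lemma multi_mean_shift_invariant:
  assumes "\<And>\<theta>. \<theta> \<in> strip \<rho> \<Longrightarrow> \<theta> + c \<in> strip \<rho> \<Longrightarrow> F (\<theta> + c) = F \<theta>"
    and "\<theta> \<in> strip \<rho>" "\<theta> + c \<in> strip \<rho>"
  shows "multi_mean js F (\<theta> + c) = multi_mean js F \<theta>"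
  using assms(2,3)
proof (induction js arbitrary: \<theta>)
  case (Cons j js)
  have "multi_mean js F (\<theta> + axis j (of_real s) + c) = multi_mean js F (\<theta> + axis j (of_real s))" for s
  proof (rule Cons.IH)
    show "\<theta> + axis j (of_real s) + c \<in> strip \<rho>"
      using Cons.prems(2) strip_axis_real[of "\<theta> + c"] by (simp add: add_ac)
  qed (use Cons.prems in \<open>simp add: strip_axis_real\<close>)
  then show ?case by (simp add: line_mean_def add_ac)
qed (use assms in auto)

text \<open>Averages in different coordinates commute, so the one over \<open>j\<close> may be
  performed innermost, on \<open>F\<close> itself, where \<open>line_mean_shift\<close> applies; the
  outer averages inherit the invariance.\<close>

lemma multi_mean_shift_axis:
  assumes F: "cont_periodic \<rho> F" "separately_holomorphic \<rho> F"
    and "j \<in> set js" "\<theta> \<in> strip \<rho>" "\<theta> + axis j z \<in> strip \<rho>"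
  shows "multi_mean js F (\<theta> + axis j z) = multi_mean js F \<theta>"
  using assms(3-5)
proof (induction js arbitrary: \<theta>)
  case (Cons i js)
  show ?case
  proof (cases "i = j")
    case True
    have "multi_mean js (line_mean j F) (\<theta> + axis j z) = multi_mean js (line_mean j F) \<theta>"
      by (rule multi_mean_shift_invariant[OF _ Cons.prems(2,3)]) (rule line_mean_shift[OF F])
    then show ?thesis using True multi_mean_line_mean[OF F(1)] Cons.prems(2,3) by simp
  next
    case False
    have "multi_mean js F (\<theta> + axis i (of_real s) + axis j z) = multi_mean js F (\<theta> + axis i (of_real s))" for s
    proof (rule Cons.IH)
      show "\<theta> + axis i (of_real s) + axis j z \<in> strip \<rho>"
        using Cons.prems(3) strip_axis_real[of "\<theta> + axis j z" i] by (simp add: add_ac)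
    qed (use Cons.prems False in \<open>auto simp: strip_axis_real\<close>)
    then show ?thesis by (simp add: line_mean_def add_ac)
  qed
qed simp

lemma multi_mean_constant:
  assumes F: "cont_periodic \<rho> F" "separately_holomorphic \<rho> F"
    and js: "set js = UNIV" and \<theta>: "\<theta> \<in> strip \<rho>"
  shows "multi_mean js F \<theta> = multi_mean js F 0"
proof -
  \<comment> \<open>The points \<open>r T\<close> lead from 0 to \<open>\<theta>\<close>, one
    coordinate at a time, without leaving the strip.\<close>
  define r where "r T = (\<chi> j. if j \<in> T then \<theta> $ j else 0)" for T
  have \<rho>: "0 \<le> \<rho>"
  proof -
    fix j have "\<bar>Im (\<theta> $ j)\<bar> \<le> \<rho>" using \<theta> by (simp add: strip_def)
    then show ?thesis by simp
  qed
  have r: "r T \<in> strip \<rho>" for T using \<theta> \<rho> by (simp add: strip_def r_def)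
  have "multi_mean js F (r T) = multi_mean js F 0" if "finite T" for T
    using that
  proof (induction T)
    case empty
    have "r {} = 0" by (simp add: r_def vec_eq_iff)
    then show ?case by simp
  next
    case (insert j T)
    have *: "r (insert j T) = r T + axis j (\<theta> $ j)" using insert.hyps by (auto simp: r_def axis_def vec_eq_iff)
    have "multi_mean js F (r T + axis j (\<theta> $ j)) = multi_mean js F (r T)"
      by (rule multi_mean_shift_axis[OF F _ r]) (use js r[of "insert j T"] * in auto)
    then show ?case using * insert.IH by simp
  qed
  from this[OF finite[of UNIV]] show ?thesis by (simp add: r_def)
qed

section \<open>Fourier expansion of analytic periodic functions\<close>

definition index_len :: "int ^ 'i::finite \<Rightarrow> real" where
  "index_len k = of_int (\<Sum>j\<in>UNIV. \<bar>k $ j\<bar>)"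

lemma axis_zero: "axis j (0 :: 'a::zero) = 0"
  by (simp add: vec_eq_iff axis_def)

lemma fourier_mode_add: "fourier_mode (k + l) \<theta> = fourier_mode k \<theta> * fourier_mode l \<theta>"
  by (simp add: fourier_mode_def ring_distribs sum.distrib exp_add)

lemma fourier_mode_zero: "fourier_mode 0 \<theta> = 1"
  by (simp add: fourier_mode_def)

lemma fourier_mode_nonzero: "fourier_mode k \<theta> \<noteq> 0"
  by (simp add: fourier_mode_def)

lemma fourier_mode_axis: "fourier_mode k (\<theta> + axis j z) = fourier_mode k \<theta> * exp (\<i> * (of_int (k $ j) * z))"
proof -
  have "(\<Sum>i\<in>UNIV. of_int (k $ i) * axis j z $ i) = of_int (k $ j) * z"
    by (subst sum.remove[of _ j]) (auto simp: axis_def)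
  then show ?thesis by (simp add: fourier_mode_def ring_distribs sum.distrib exp_add)
qed

lemma fourier_mode_axis_real:
  "fourier_mode k (\<theta> + axis j (of_real s)) = fourier_mode k \<theta> * cis (of_int (k $ j) * s)"
  by (simp add: fourier_mode_axis cis_conv_exp)

lemma cis_int_2pi: "cis (of_int n * (2 * pi)) = 1"
  using cis_multiple_2pi[of "of_int n"] by (simp add: mult_ac)

lemma fourier_mode_periodic: "fourier_mode k (\<theta> + axis j (of_real (2 * pi))) = fourier_mode k \<theta>"
  unfolding fourier_mode_axis_real by (simp only: cis_int_2pi mult_1_right)

lemma continuous_on_fourier_mode: "continuous_on S (fourier_mode k)"
  unfolding fourier_mode_def by (intro continuous_intros)

lemma norm_fourier_mode: "cmod (fourier_mode k \<theta>) = exp (- (\<Sum>j\<in>UNIV. of_int (k $ j) * Im (\<theta> $ j)))"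
  by (simp add: fourier_mode_def)

lemma norm_fourier_mode_real: "\<theta> \<in> strip 0 \<Longrightarrow> cmod (fourier_mode k \<theta>) = 1"
  by (simp add: norm_fourier_mode strip_def)

lemma fourier_mode_flow:
  "fourier_mode k (\<chi> j. of_real (\<omega> $ j * t)) = cis ((\<Sum>j\<in>UNIV. of_int (k $ j) * \<omega> $ j) * t)"
  by (simp add: fourier_mode_def cis_conv_exp sum_distrib_right mult.assoc)

lemma cont_periodic_mult:
  "cont_periodic \<rho> F \<Longrightarrow> cont_periodic \<rho> G \<Longrightarrow> cont_periodic \<rho> (\<lambda>\<theta>. F \<theta> * G \<theta>)"
  by (simp add: cont_periodic_def continuous_on_mult)

lemma cont_periodic_diff:
  "cont_periodic \<rho> F \<Longrightarrow> cont_periodic \<rho> G \<Longrightarrow> cont_periodic \<rho> (\<lambda>\<theta>. F \<theta> - G \<theta>)"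
  by (simp add: cont_periodic_def continuous_on_diff)

lemma cont_periodic_fourier_mode: "cont_periodic \<rho> (fourier_mode k)"
  by (simp add: cont_periodic_def continuous_on_fourier_mode fourier_mode_periodic del: of_real_mult)

lemma strip_mono: "\<rho>' \<le> \<rho> \<Longrightarrow> strip \<rho>' \<subseteq> strip \<rho>"
  unfolding strip_def by (auto intro: order_trans)

lemma cont_periodic_mono: "cont_periodic \<rho> F \<Longrightarrow> \<rho>' \<le> \<rho> \<Longrightarrow> cont_periodic \<rho>' F"
  unfolding cont_periodic_def by (meson strip_mono subsetD continuous_on_subset)

lemma line_mean_factor:
  assumes "\<And>s. c (\<theta> + axis j (of_real s)) = c \<theta>"
  shows "line_mean j (\<lambda>\<theta>. F \<theta> * c \<theta>) \<theta> = line_mean j F \<theta> * c \<theta>"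
  by (simp add: line_mean_def assms)

lemma multi_mean_factor:
  assumes "\<And>\<theta> i s. i \<in> set js \<Longrightarrow> c (\<theta> + axis i (of_real s)) = c \<theta>"
  shows "multi_mean js (\<lambda>\<theta>. F \<theta> * c \<theta>) \<theta> = multi_mean js F \<theta> * c \<theta>"
  using assms
proof (induction js arbitrary: \<theta>)
  case (Cons j js)
  have "multi_mean js (\<lambda>\<theta>. F \<theta> * c \<theta>) = (\<lambda>\<theta>. multi_mean js F \<theta> * c \<theta>)"
    using Cons by auto
  then show ?case using line_mean_factor[of c \<theta> j] Cons.prems by simp
qed simp

lemma multi_mean_diff:
  assumes "cont_periodic \<rho> F" "cont_periodic \<rho> G" "\<theta> \<in> strip \<rho>"
  shows "multi_mean js (\<lambda>\<theta>. F \<theta> - G \<theta>) \<theta> = multi_mean js F \<theta> - multi_mean js G \<theta>"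
  using assms(3)
proof (induction js arbitrary: \<theta>)
  case (Cons j js)
  have c: "continuous_on (strip \<rho>) (multi_mean js F)" "continuous_on (strip \<rho>) (multi_mean js G)"
    using cont_periodic_multi_mean[OF assms(1)] cont_periodic_multi_mean[OF assms(2)]
    by (auto simp: cont_periodic_def)
  have "line_mean j (multi_mean js (\<lambda>\<theta>. F \<theta> - G \<theta>)) \<theta> = line_mean j (\<lambda>\<theta>. multi_mean js F \<theta> - multi_mean js G \<theta>) \<theta>"
    by (rule line_mean_cong[OF Cons.prems Cons.IH])
  also have "\<dots> = line_mean j (multi_mean js F) \<theta> - line_mean j (multi_mean js G) \<theta>"
    unfolding line_mean_def
    by (subst integral_diff)
       (auto intro!: integrable_continuous_real continuous_on_line c Cons.prems simp: diff_divide_distrib)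
  finally show ?case by simp
qed simp

lemma integral_cis_int: "integral {0..2*pi} (\<lambda>s. cis (of_int n * s)) = (if n = 0 then 2 * pi else 0)"
proof (cases "n = 0")
  case False
  have "((\<lambda>s. \<i> * of_real (of_int n) * cis (of_int n * s)) has_integral
      (cis (of_int n * (2 * pi)) - cis (of_int n * 0))) {0..2*pi}"
    by (rule fundamental_theorem_of_calculus) (simp, rule has_vector_derivative_cis)
  then have "((\<lambda>s. \<i> * of_int n * cis (of_int n * s)) has_integral 0) {0..2*pi}"
    by (simp only: cis_int_2pi) simp
  from has_integral_mult_right[OF this, of "1 / (\<i> * of_int n)"] False show ?thesis
    by (simp add: integral_unique)
qed (simp add: scaleR_conv_of_real)

lemma multi_mean_fourier_mode:
  "multi_mean js (fourier_mode k) \<theta> = (if \<forall>j\<in>set js. k $ j = 0 then fourier_mode k \<theta> else 0)"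
proof (induction js arbitrary: \<theta>)
  case (Cons j js)
  have IH: "multi_mean js (fourier_mode k) = (\<lambda>\<theta>. if \<forall>j\<in>set js. k $ j = 0 then fourier_mode k \<theta> else 0)"
    using Cons by auto
  have "line_mean j (fourier_mode k) \<theta> = (if k $ j = 0 then fourier_mode k \<theta> else 0)"
    unfolding line_mean_def fourier_mode_axis_real integral_mult_right integral_cis_int by simp
  moreover have "line_mean j (\<lambda>\<theta>. 0) \<theta> = 0" by (simp add: line_mean_def)
  ultimately show ?case
  proof (cases "\<forall>j\<in>set js. k $ j = 0")
    case False
    have "multi_mean js (fourier_mode k) = (\<lambda>\<theta>. 0)" unfolding IH if_not_P[OF False] ..
    then show ?thesis using False \<open>line_mean j (\<lambda>\<theta>. 0) \<theta> = 0\<close> by auto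
  qed (simp add: IH)
qed simp

text \<open>The bounds \<open>b n\<close> survive averaging, so Weierstrass' test permits termwise
  integration at every level of the iterated mean.\<close>

lemma multi_mean_sums:
  assumes f: "\<And>n. cont_periodic 0 (f n)" and b: "\<And>n \<theta>. \<theta> \<in> strip 0 \<Longrightarrow> cmod (f n \<theta>) \<le> b n"
    and sb: "summable b" and F: "\<And>\<theta>. \<theta> \<in> strip 0 \<Longrightarrow> (\<lambda>n. f n \<theta>) sums F \<theta>" and \<theta>: "\<theta> \<in> strip 0"
  shows "(\<lambda>n. multi_mean js (f n) \<theta>) sums multi_mean js F \<theta>"
  using \<theta>
proof (induction js arbitrary: \<theta>)
  case Nil then show ?case using F by simp
next
  case (Cons j js)
  define g where "g n s = multi_mean js (f n) (\<theta> + axis j (of_real s))" for n s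
  define G where "G s = multi_mean js F (\<theta> + axis j (of_real s))" for s
  have gG: "(\<lambda>n. g n s) sums G s" for s
    unfolding g_def G_def by (rule Cons.IH) (use Cons.prems in \<open>simp add: strip_axis_real\<close>)
  have im: "\<theta> \<in> strip 0" if "\<theta>' \<in> strip 0" "\<And>j. Im (\<theta> $ j) = Im (\<theta>' $ j)" for \<theta> \<theta>' :: "complex ^ 'a"
    using that by (simp add: strip_def)
  have gb: "cmod (g n s) \<le> b n" for n s
    unfolding g_def
    by (rule multi_mean_bound[OF f]) (use b im Cons.prems strip_axis_real in \<open>blast+\<close>)
  have cg: "continuous_on A (g n)" for n A
    unfolding g_def using cont_periodic_multi_mean[OF f] Cons.prems
    by (intro continuous_on_line[where \<rho> = 0]) (auto simp: cont_periodic_def)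
  have "uniform_limit {0..2*pi} (\<lambda>n s. \<Sum>i<n. g i s) (\<lambda>s. \<Sum>i. g i s) sequentially"
    by (rule Weierstrass_m_test[OF _ sb]) (use gb in auto)
  then have ul: "uniform_limit {0..2*pi} (\<lambda>n s. \<Sum>i<n. g i s) G sequentially"
    using gG by (simp add: sums_iff)
  obtain I J where I: "\<And>n. ((\<lambda>s. \<Sum>i<n. g i s) has_integral I n) {0..2*pi}"
    and J: "(G has_integral J) {0..2*pi}" "I \<longlonglongrightarrow> J"
    by (rule uniform_limit_integral[OF ul]) (auto intro!: continuous_intros cg)
  have "I n = (\<Sum>i<n. integral {0..2*pi} (g i))" for n
  proof -
    have "I n = integral {0..2*pi} (\<lambda>s. \<Sum>i<n. g i s)" by (rule integral_unique[OF I, symmetric])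
    also have "\<dots> = (\<Sum>i<n. integral {0..2*pi} (g i))"
      by (rule integral_sum) (auto intro!: integrable_continuous_real cg)
    finally show ?thesis .
  qed
  then have "I = (\<lambda>n. \<Sum>i<n. integral {0..2*pi} (g i))" by (rule ext)
  then have "(\<lambda>i. integral {0..2*pi} (g i)) sums J" using J(2) unfolding sums_def by metis
  from sums_divide[OF this, of "of_real (2 * pi)"] show ?case
    using integral_unique[OF J(1)] by (simp add: line_mean_def g_def[abs_def] G_def[abs_def])
qed

text \<open>With the other coordinates fixed, the inner average is a continuous periodic function of
  coordinate \<open>j\<close> orthogonal to all characters, hence 0 by
  \<open>continuous_periodic_eq_0\<close>. Assumption \<open>0\<close> ranges over all
  \<open>k\<close> because a character in direction \<open>j\<close> is absorbed as
  \<open>k + N\<close>.\<close>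

lemma fourier_uniqueness:
  assumes F: "cont_periodic 0 F" and js: "distinct js"
    and 0: "\<And>k \<theta>. \<theta> \<in> strip 0 \<Longrightarrow> multi_mean js (\<lambda>\<theta>. F \<theta> * fourier_mode k \<theta>) \<theta> = 0"
    and \<theta>: "\<theta> \<in> strip 0"
  shows "F \<theta> = 0"
  using js 0
proof (induction js)
  case Nil
  from Nil(2)[OF \<theta>, of 0] show ?case by (simp add: fourier_mode_zero)
next
  case (Cons j js)
  show ?case
  proof (rule Cons.IH)
    show "distinct js" using Cons.prems by simp
    fix k and \<theta> :: "complex ^ 'a" assume \<theta>: "\<theta> \<in> strip 0"
    define P where "P = multi_mean js (\<lambda>\<theta>. F \<theta> * fourier_mode k \<theta>)"
    define g where "g s = P (\<theta> + axis j (of_real s))" for s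
    have P: "cont_periodic 0 P"
      unfolding P_def by (intro cont_periodic_multi_mean cont_periodic_mult F cont_periodic_fourier_mode)
    have "g 0 = 0"
    proof (rule continuous_periodic_eq_0)
      show "continuous_on UNIV g"
        unfolding g_def using P \<theta> by (intro continuous_on_line[where \<rho> = 0]) (auto simp: cont_periodic_def)
      show "g (s + 2 * pi) = g s" for s
      proof -
        have "\<theta> + axis j (of_real s) \<in> strip 0" using \<theta> by (simp add: strip_axis_real)
        then have "P (\<theta> + axis j (of_real s) + axis j (of_real (2 * pi))) = P (\<theta> + axis j (of_real s))"
          using P by (simp add: cont_periodic_def)
        then show ?thesis by (simp add: g_def axis_add add.assoc)
      qed
      fix n :: int
      \<comment> \<open>\<open>fourier_mode N\<close> depends on coordinate \<open>j\<close> alone,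
        so it passes through the averages over \<open>js\<close>; distinctness of the list enters
        here.\<close>
      define N where "N = (\<chi> i. if i = j then n else 0)"
      have Nj: "fourier_mode N (\<theta> + axis i (of_real s)) = fourier_mode N \<theta> * (if i = j then cis (of_int n * s) else 1)" for i s and \<theta> :: "complex ^ 'a"
        by (simp add: fourier_mode_axis_real N_def)
      have inv: "fourier_mode N (\<theta>' + axis i (of_real s)) = fourier_mode N \<theta>'" if "i \<in> set js" for \<theta>' i s
        unfolding Nj using that Cons.prems(1) by auto
      have "multi_mean js (\<lambda>\<theta>. F \<theta> * fourier_mode (k + N) \<theta>) \<theta>' = P \<theta>' * fourier_mode N \<theta>'" for \<theta>'
        using multi_mean_factor[of js "fourier_mode N" "\<lambda>\<theta>. F \<theta> * fourier_mode k \<theta>" \<theta>', OF inv]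
        by (simp add: P_def fourier_mode_add mult.assoc)
      then have "line_mean j (\<lambda>\<theta>'. P \<theta>' * fourier_mode N \<theta>') \<theta> = 0"
        using Cons.prems(2)[OF \<theta>, of "k + N"] by (simp add: line_mean_def)
      then have "integral {0..2*pi} (\<lambda>s. g s * (fourier_mode N \<theta> * cis (of_int n * s))) = 0"
        by (simp add: line_mean_def Nj g_def)
      moreover have "(\<lambda>s. g s * (fourier_mode N \<theta> * cis (of_int n * s))) = (\<lambda>s. fourier_mode N \<theta> * (g s * cis (of_int n * s)))"
        by (simp add: fun_eq_iff mult_ac)
      ultimately show "integral {0..2*pi} (\<lambda>s. g s * cis (of_int n * s)) = 0"
        by (simp add: fourier_mode_nonzero)
    qed
    then show "multi_mean js (\<lambda>\<theta>. F \<theta> * fourier_mode k \<theta>) \<theta> = 0" by (simp add: g_def P_def axis_zero)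
  qed
qed

text \<open>A finite set of indices lies in a box, over which the sum of products is the product of
  sums.\<close>

lemma summable_prod_int_vec:
  fixes f :: "int \<Rightarrow> real"
  assumes f0: "\<And>n. 0 \<le> f n" and f: "f summable_on UNIV"
  shows "(\<lambda>k::int ^ 'i::finite. \<Prod>j\<in>UNIV. f (k $ j)) summable_on UNIV"
proof (rule nonneg_bounded_partial_sums_imp_summable_on)
  show "0 \<le> (\<Prod>j\<in>UNIV. f (k $ j))" for k :: "int ^ 'i" by (intro prod_nonneg) (use f0 in auto)
  have bound: "(\<Sum>k\<in>X. \<Prod>j\<in>UNIV. f (k $ j)) \<le> infsum f UNIV ^ CARD('i)" if X: "finite X" for X :: "(int ^ 'i) set"
  proof -
    define Y where "Y = (\<Union>k\<in>X. range (vec_nth k))"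
    have Y: "finite Y" using X by (simp add: Y_def)
    have "(\<Sum>k\<in>X. \<Prod>j\<in>UNIV. f (k $ j)) = (\<Sum>g\<in>vec_nth ` X. \<Prod>j\<in>UNIV. f (g j))"
      by (subst sum.reindex) (auto simp: inj_on_def vec_eq_iff)
    also have "\<dots> \<le> (\<Sum>g\<in>PiE (UNIV :: 'i set) (\<lambda>_. Y). \<Prod>j\<in>UNIV. f (g j))"
    proof (rule sum_mono2)
      show "finite (PiE (UNIV :: 'i set) (\<lambda>_. Y))" using Y by (intro finite_PiE) auto
      show "vec_nth ` X \<subseteq> PiE UNIV (\<lambda>_. Y)" unfolding Y_def PiE_UNIV_domain by blast
      show "0 \<le> (\<Prod>j\<in>UNIV. f (g j))" for g :: "'i \<Rightarrow> int" using f0 by (intro prod_nonneg) auto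
    qed
    also have "\<dots> = (\<Prod>j\<in>(UNIV::'i set). \<Sum>n\<in>Y. f n)"
      using prod_sum_PiE[of "UNIV :: 'i set" "\<lambda>_. Y" "\<lambda>_ n. f n"] Y by simp
    also have "\<dots> \<le> infsum f UNIV ^ CARD('i)"
      using finite_sum_le_infsum[OF f Y] f0 by (auto intro!: power_mono sum_nonneg)
    finally show ?thesis .
  qed
  show "\<forall>\<^sub>F X in finite_subsets_at_top (UNIV :: (int ^ 'i) set). (\<Sum>k\<in>X. \<Prod>j\<in>UNIV. f (k $ j)) \<le> infsum f UNIV ^ CARD('i)"
    by (intro eventually_finite_subsets_at_top_weakI bound)
qed

lemma summable_inverse_square_int: "(\<lambda>n::int. 1 / (1 + \<bar>real_of_int n\<bar>)\<^sup>2) summable_on UNIV"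
proof -
  define f where "f n = 1 / (1 + \<bar>real_of_int n\<bar>)\<^sup>2" for n
  have s: "(\<lambda>n::nat. 1 / (1 + real n)\<^sup>2) summable_on UNIV"
  proof (rule summable_nonneg_imp_summable_on)
    show "summable (\<lambda>n::nat. 1 / (1 + real n)\<^sup>2)"
      using summable_Suc_iff[THEN iffD2, OF inverse_power_summable[of 2, where 'a = real]]
      by (simp add: divide_inverse add.commute)
  qed simp
  have "f summable_on range int"
    by (subst summable_on_reindex) (use s in \<open>auto simp: o_def f_def\<close>)
  moreover have "f summable_on range (\<lambda>n. - int n)"
    by (subst summable_on_reindex) (use s in \<open>auto simp: o_def f_def inj_on_def\<close>)
  ultimately have "f summable_on (range int \<union> range (\<lambda>n. - int n))"
    by (rule summable_on_union)
  moreover have "range int \<union> range (\<lambda>n. - int n) = UNIV"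
    by (auto simp: image_iff) (metis int_cases2)
  ultimately show ?thesis by (simp add: f_def[abs_def])
qed

lemma index_len_nonneg: "0 \<le> index_len k"
  by (auto simp: index_len_def intro!: sum_nonneg)

lemma component_le_index_len: "\<bar>real_of_int (k $ j)\<bar> \<le> index_len k"
proof -
  have "\<bar>k $ j\<bar> \<le> (\<Sum>j\<in>UNIV. \<bar>k $ j\<bar>)" by (rule member_le_sum) auto
  then have "real_of_int \<bar>k $ j\<bar> \<le> index_len k" unfolding index_len_def by (rule of_int_le_iff[THEN iffD2])
  then show ?thesis by simp
qed

text \<open>\<open>1 + index_len k\<close> dominates \<open>1 + \<bar>k $ j\<bar>\<close> for every
  \<open>j\<close>, so two powers per coordinate give a product of convergent series. The widths of
  the resonant intervals are summed with this weight.\<close>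

lemma summable_index_len:
  "(\<lambda>k::int ^ 'i::finite. 1 / (1 + index_len k) ^ (2 * CARD('i))) summable_on UNIV"
proof (rule summable_on_comparison_test[OF summable_prod_int_vec[OF _ summable_inverse_square_int]])
  fix k :: "int ^ 'i"
  have "1 / (1 + index_len k) ^ (2 * CARD('i)) = (\<Prod>j\<in>(UNIV::'i set). 1 / (1 + index_len k)\<^sup>2)"
    by (simp add: power_mult power_one_over)
  also have "\<dots> \<le> (\<Prod>j\<in>UNIV. 1 / (1 + \<bar>real_of_int (k $ j)\<bar>)\<^sup>2)"
    using component_le_index_len[of k] index_len_nonneg[of k]
    by (intro prod_mono conjI divide_left_mono power_mono mult_pos_pos zero_less_power)
       (auto intro: add_pos_nonneg)
  finally show "1 / (1 + index_len k) ^ (2 * CARD('i)) \<le> (\<Prod>j\<in>UNIV. 1 / (1 + \<bar>real_of_int (k $ j)\<bar>)\<^sup>2)" .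
qed (simp_all add: index_len_nonneg add_nonneg_nonneg)

lemma summable_exp_index_len:
  assumes "0 < \<delta>" shows "(\<lambda>k::int ^ 'i::finite. exp (- \<delta> * index_len k)) summable_on UNIV"
proof -
  define C where "C = fact (2 * CARD('i)) / \<delta> ^ (2 * CARD('i)) * exp \<delta>"
  show ?thesis
  proof (rule summable_on_comparison_test[OF summable_on_cmult_right[OF summable_index_len, of C]])
    fix k :: "int ^ 'i"
    have p: "0 < (1 + index_len k) ^ (2 * CARD('i))" using index_len_nonneg[of k] by simp
    have "(1 + index_len k) ^ (2 * CARD('i)) \<le> fact (2 * CARD('i)) / \<delta> ^ (2 * CARD('i)) * exp (\<delta> * (1 + index_len k))"
      by (rule power_times_exp_le) (use assms index_len_nonneg[of k] in auto)
    also have "\<dots> = C * exp (\<delta> * index_len k)" by (simp add: C_def ring_distribs exp_add)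
    finally have "exp (- \<delta> * index_len k) * (1 + index_len k) ^ (2 * CARD('i)) \<le> exp (- \<delta> * index_len k) * (C * exp (\<delta> * index_len k))"
      by (rule mult_left_mono) simp
    also have "\<dots> = C" by (simp add: exp_minus)
    finally show "exp (- \<delta> * index_len k) \<le> C * (1 / (1 + index_len k) ^ (2 * CARD('i)))"
      using p by (simp add: pos_le_divide_eq)
  qed auto
qed

text \<open>The strip is closed but unbounded in the real directions; periods bring every point into
  a compact cell, one coordinate at a time.\<close>

lemma cont_periodic_bounded:
  assumes F: "cont_periodic \<rho> (F :: complex ^ 'i::finite \<Rightarrow> complex)"
  obtains M where "\<And>\<theta>. \<theta> \<in> strip \<rho> \<Longrightarrow> cmod (F \<theta>) \<le> M"
proof -
  define K where "K = {\<theta> :: complex ^ 'i. \<theta> \<in> strip \<rho> \<and> (\<forall>j. 0 \<le> Re (\<theta> $ j) \<and> Re (\<theta> $ j) \<le> 2 * pi)}"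
  have "closed K"
    unfolding K_def strip_def mem_Collect_eq
    by (intro closed_Collect_conj closed_Collect_all closed_Collect_le continuous_intros)
  moreover have "bounded K"
    unfolding bounded_iff
  proof (intro exI ballI)
    fix \<theta> assume \<theta>: "\<theta> \<in> K"
    have "norm \<theta> \<le> (\<Sum>j\<in>UNIV. cmod (\<theta> $ j))" unfolding norm_vec_def by (rule L2_set_le_sum) auto
    also have "\<dots> \<le> (\<Sum>j\<in>(UNIV::'i set). 2 * pi + \<rho>)"
    proof (rule sum_mono)
      fix j have "0 \<le> Re (\<theta> $ j)" "Re (\<theta> $ j) \<le> 2 * pi" "\<bar>Im (\<theta> $ j)\<bar> \<le> \<rho>" using \<theta> by (auto simp: K_def strip_def)
      then show "cmod (\<theta> $ j) \<le> 2 * pi + \<rho>" using cmod_le[of "\<theta> $ j"] by linarith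
    qed
    finally show "norm \<theta> \<le> (\<Sum>j\<in>(UNIV::'i set). 2 * pi + \<rho>)" .
  qed
  ultimately have "compact K" by (simp add: compact_eq_bounded_closed)
  moreover have "continuous_on K F"
    using F by (auto simp: cont_periodic_def K_def intro: continuous_on_subset)
  ultimately obtain M where M: "\<And>\<theta>. \<theta> \<in> K \<Longrightarrow> cmod (F \<theta>) \<le> M"
    using compact_imp_bounded[OF compact_continuous_image] by (force simp: bounded_iff)
  have nat1: "F (\<theta> + axis j (of_real (2 * pi * real n))) = F \<theta>" if "\<theta> \<in> strip \<rho>" for \<theta> j n
  proof (induction n)
    case 0
    then show ?case by (simp add: axis_zero)
  next
    case (Suc n)
    have "of_real (2 * pi * real (Suc n)) = complex_of_real (2 * pi * real n) + complex_of_real (2 * pi)"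
      by (simp add: algebra_simps)
    then have "\<theta> + axis j (of_real (2 * pi * real (Suc n))) = \<theta> + axis j (of_real (2 * pi * real n)) + axis j (of_real (2 * pi))"
      by (simp only: axis_add add.assoc)
    moreover have "\<theta> + axis j (of_real (2 * pi * real n)) \<in> strip \<rho>" using that by (simp only: strip_axis_real)
    ultimately show ?case using F Suc unfolding cont_periodic_def by metis
  qed
  have int1: "F (\<theta> + axis j (of_real (2 * pi * of_int n))) = F \<theta>" if "\<theta> \<in> strip \<rho>" for \<theta> j n
  proof (cases "0 \<le> n")
    case True then show ?thesis using nat1[OF that, of j "nat n"] by simp
  next
    case False
    let ?\<theta> = "\<theta> + axis j (of_real (2 * pi * of_int n))"
    have "?\<theta> \<in> strip \<rho>" using that by (simp only: strip_axis_real)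
    from nat1[OF this, of j "nat (- n)"]
    have "F (?\<theta> + axis j (of_real (2 * pi * real (nat (- n))))) = F ?\<theta>" .
    moreover have "?\<theta> + axis j (of_real (2 * pi * real (nat (- n)))) = \<theta>"
      using False by (simp add: vec_eq_iff axis_def)
    ultimately show ?thesis by metis
  qed
  show thesis
  proof (rule that)
    fix \<theta> :: "complex ^ 'i" assume \<theta>: "\<theta> \<in> strip \<rho>"
    define n where "n j = - \<lfloor>Re (\<theta> $ j) / (2 * pi)\<rfloor>" for j
    define r where "r T = (\<chi> j. if j \<in> T then \<theta> $ j + of_real (2 * pi * of_int (n j)) else \<theta> $ j)" for T
    have "Im (r T $ j) = Im (\<theta> $ j)" for T j by (simp add: r_def)
    then have rT: "r T \<in> strip \<rho>" for T using \<theta> by (simp add: strip_def)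
    have "F (r T) = F \<theta>" if "finite T" for T
      using that
    proof (induction T)
      case empty
      have "r {} = \<theta>" by (simp add: r_def vec_eq_iff)
      then show ?case by simp
    next
      case (insert j T)
      have "r (insert j T) = r T + axis j (of_real (2 * pi * of_int (n j)))"
        using insert.hyps by (auto simp: r_def vec_eq_iff axis_def)
      then show ?case using int1[OF rT] insert.IH by simp
    qed
    then have "F \<theta> = F (r UNIV)" by simp
    moreover have "r UNIV \<in> K"
    proof -
      have "0 \<le> Re (r UNIV $ j) \<and> Re (r UNIV $ j) \<le> 2 * pi" for j
      proof -
        define x where "x = Re (\<theta> $ j) / (2 * pi)"
        have x: "Re (\<theta> $ j) = 2 * pi * x" by (simp add: x_def)
        have "Re (r UNIV $ j) = 2 * pi * (x - of_int \<lfloor>x\<rfloor>)"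
          by (simp add: r_def n_def x_def[symmetric] x algebra_simps)
        moreover have "0 \<le> x - of_int \<lfloor>x\<rfloor>" "x - of_int \<lfloor>x\<rfloor> \<le> 1" by linarith+
        ultimately show ?thesis using mult_left_mono[of "x - of_int \<lfloor>x\<rfloor>" 1 "2 * pi"] by simp
      qed
      then show ?thesis using rT by (simp add: K_def)
    qed
    ultimately show "cmod (F \<theta>) \<le> M" using M by simp
  qed
qed

text \<open>By \<open>multi_mean_constant\<close> a coefficient may be computed at any imaginary
  part in the strip, and the best choice gives the exponential decay. The resulting series has the
  same coefficients as \<open>F\<close>, so \<open>fourier_uniqueness\<close> identifies the two on
  real points.\<close>

theorem fourier_expansion:
  fixes F :: "complex ^ 'i::finite \<Rightarrow> complex"
  assumes \<rho>: "0 < \<rho>" and F: "analytic_several_on F (strip \<rho>)"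
    and per: "\<And>\<theta> j. \<theta> \<in> strip \<rho> \<Longrightarrow> F (\<theta> + axis j (of_real (2 * pi))) = F \<theta>"
  obtains c M where "\<And>k. cmod (c k) \<le> M * exp (- \<rho> * index_len k)"
    and "\<And>\<theta>. \<theta> \<in> strip 0 \<Longrightarrow> ((\<lambda>k. c k * fourier_mode k \<theta>) has_sum F \<theta>) UNIV"
proof -
  obtain U where U: "open U" "strip \<rho> \<subseteq> U" "\<And>\<theta>. \<theta> \<in> U \<Longrightarrow> holomorphic_at F \<theta>"
    using F by (auto simp: analytic_several_on_def)
  have contF: "continuous_on (strip \<rho>) F"
  proof (intro continuous_at_imp_continuous_on ballI)
    fix \<theta> :: "complex ^ 'i" assume "\<theta> \<in> strip \<rho>"
    then obtain D where "(F has_derivative D) (at \<theta>)" using U unfolding holomorphic_at_def by blast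
    then show "isCont F \<theta>" by (rule has_derivative_continuous)
  qed
  have cp: "cont_periodic \<rho> F" using contF per by (simp add: cont_periodic_def)
  have sh: "separately_holomorphic \<rho> (\<lambda>\<theta>. F \<theta> * fourier_mode k \<theta>)" for k
    unfolding separately_holomorphic_def
  proof (intro ballI allI impI)
    fix \<theta> :: "complex ^ 'i" and j z assume "\<theta> + axis j z \<in> strip \<rho>"
    then obtain D where D: "(F has_derivative D) (at (\<theta> + axis j z))" "\<And>c v. D (c *s v) = c * D v"
      using U by (force simp: holomorphic_at_def)
    have "linear (axis j :: complex \<Rightarrow> complex ^ 'i)"
      by (rule linearI) (auto simp: vec_eq_iff axis_def)
    then have "bounded_linear (axis j :: complex \<Rightarrow> complex ^ 'i)" by (simp add: linear_conv_bounded_linear)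
    then have "((\<lambda>z. \<theta> + axis j z) has_derivative axis j) (at z)"
      using bounded_linear_imp_has_derivative by (auto intro!: derivative_eq_intros)
    from has_derivative_compose[OF this D(1)]
    have "((\<lambda>z. F (\<theta> + axis j z)) has_derivative (\<lambda>h. D (axis j h))) (at z)" .
    moreover have "D (axis j h) = D (axis j 1) * h" for h
    proof -
      have "axis j h = h *s axis j (1::complex)" by (simp add: vec_eq_iff axis_def)
      then show ?thesis using D(2) by (metis mult.commute)
    qed
    then have "(\<lambda>h. D (axis j h)) = (*) (D (axis j 1))" by (rule ext)
    ultimately have "((\<lambda>z. F (\<theta> + axis j z)) has_field_derivative D (axis j 1)) (at z)"
      unfolding has_field_derivative_def by (simp only:)
    moreover have "((\<lambda>z. fourier_mode k (\<theta> + axis j z)) has_field_derivative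
        fourier_mode k \<theta> * (\<i> * of_int (k $ j) * exp (\<i> * (of_int (k $ j) * z)))) (at z)"
      unfolding fourier_mode_axis by (auto intro!: derivative_eq_intros)
    ultimately show "(\<lambda>z. F (\<theta> + axis j z) * fourier_mode k (\<theta> + axis j z)) field_differentiable at z"
      using DERIV_mult field_differentiable_def by blast
  qed
  obtain M where M: "\<And>\<theta>. \<theta> \<in> strip \<rho> \<Longrightarrow> cmod (F \<theta>) \<le> M" using cont_periodic_bounded[OF cp] by blast
  obtain js :: "'i list" where js: "set js = UNIV" "distinct js" using finite_distinct_list[of "UNIV :: 'i set"] by auto
  define c where "c k = multi_mean js (\<lambda>\<theta>. F \<theta> * fourier_mode (- k) \<theta>) 0" for k
  have cpk: "cont_periodic \<rho> (\<lambda>\<theta>. F \<theta> * fourier_mode k \<theta>)" for k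
    by (intro cont_periodic_mult cp cont_periodic_fourier_mode)
  have const: "multi_mean js (\<lambda>\<theta>. F \<theta> * fourier_mode (- k) \<theta>) \<theta> = c k" if "\<theta> \<in> strip \<rho>" for k \<theta>
    unfolding c_def by (rule multi_mean_constant[OF cpk sh js(1) that])
  have decay: "cmod (c k) \<le> M * exp (- \<rho> * index_len k)" for k
  proof -
    \<comment> \<open>Imaginary parts at the edge of the strip, with the signs that make the mode
      \<open>- k\<close> smallest: its modulus becomes
      \<open>exp (- \<rho> * index_len k)\<close>.\<close>
    define \<theta> where "\<theta> = (\<chi> j. Complex 0 (- (of_int (sgn (k $ j)) * \<rho>)))"
    have sg: "\<bar>of_int (sgn x) * \<rho>\<bar> \<le> \<rho>" for x :: int using \<rho> by (simp add: sgn_if)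
    have "\<theta> \<in> strip \<rho>" using sg by (simp add: \<theta>_def strip_def)
    moreover have "cmod (multi_mean js (\<lambda>\<theta>. F \<theta> * fourier_mode (- k) \<theta>) \<theta>) \<le> M * exp (- \<rho> * index_len k)"
    proof (rule multi_mean_bound[OF cpk])
      fix \<theta>' assume im: "\<And>j. Im (\<theta>' $ j) = Im (\<theta> $ j)"
      have "\<theta>' \<in> strip \<rho>" using \<open>\<theta> \<in> strip \<rho>\<close> unfolding strip_def mem_Collect_eq im .
      have "(\<Sum>j\<in>UNIV. of_int (k $ j) * (of_int (sgn (k $ j)) * \<rho>)) = \<rho> * index_len k"
        unfolding index_len_def of_int_sum sum_distrib_left
      proof (intro sum.cong refl)
        have "n * sgn n = \<bar>n\<bar>" for n :: int by (simp add: sgn_if abs_if)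
        then have "real_of_int n * of_int (sgn n) = of_int \<bar>n\<bar>" for n by (metis of_int_mult)
        then show "of_int (k $ j) * (of_int (sgn (k $ j)) * \<rho>) = \<rho> * of_int \<bar>k $ j\<bar>" for j
          by (metis mult.assoc mult.commute)
      qed
      then have "cmod (fourier_mode (- k) \<theta>') = exp (- \<rho> * index_len k)"
        by (simp add: norm_fourier_mode im \<theta>_def sum_negf)
      then show "cmod (F \<theta>' * fourier_mode (- k) \<theta>') \<le> M * exp (- \<rho> * index_len k)"
        using M[OF \<open>\<theta>' \<in> strip \<rho>\<close>] by (simp add: norm_mult)
    qed fact
    ultimately show ?thesis using const by metis
  qed
  have ab: "(\<lambda>k. cmod (c k)) summable_on UNIV"
    by (rule summable_on_comparison_test[OF summable_on_cmult_right[OF summable_exp_index_len[OF \<rho>], of M]])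
       (use decay in auto)
  have ab': "(\<lambda>k. cmod (c k * fourier_mode k \<theta>)) summable_on UNIV" if "\<theta> \<in> strip 0" for \<theta>
    using ab norm_fourier_mode_real[OF that] by (simp add: norm_mult)
  define H where "H \<theta> = (\<Sum>\<^sub>\<infinity>k. c k * fourier_mode k \<theta>)" for \<theta>
  have H: "((\<lambda>k. c k * fourier_mode k \<theta>) has_sum H \<theta>) UNIV" if "\<theta> \<in> strip 0" for \<theta>
    unfolding H_def by (rule has_sum_infsum[OF abs_summable_summable[OF ab'[OF that]]])
  define e :: "nat \<Rightarrow> int ^ 'i" where "e = from_nat_into UNIV"
  have e: "bij_betw e UNIV UNIV"
    unfolding e_def by (rule bij_betw_from_nat_into[OF _ infinite_UNIV_vec[OF infinite_UNIV_int]]) simp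
  have sums: "(\<lambda>n. c (e n) * fourier_mode (e n) \<theta>) sums H \<theta>" if "\<theta> \<in> strip 0" for \<theta>
  proof (rule has_sum_imp_sums)
    show "((\<lambda>n. c (e n) * fourier_mode (e n) \<theta>) has_sum H \<theta>) UNIV"
      unfolding has_sum_reindex_bij_betw[OF e, of "\<lambda>k. c k * fourier_mode k \<theta>"] by (rule H[OF that])
  qed
  have sc: "summable (\<lambda>n. cmod (c (e n)))"
  proof (rule summable_on_imp_summable)
    show "(\<lambda>n. cmod (c (e n))) summable_on UNIV"
      unfolding summable_on_reindex_bij_betw[OF e, of "\<lambda>k. cmod (c k)"] by (rule ab)
  qed
  have mode_cp: "cont_periodic 0 (\<lambda>\<theta>. c (e n) * fourier_mode (e n + k) \<theta>)" for n k
    using cont_periodic_fourier_mode[of 0 "e n + k"] by (auto simp: cont_periodic_def intro: continuous_intros)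
  have cpH: "cont_periodic 0 H"
    unfolding cont_periodic_def
  proof (intro conjI ballI allI)
    have "uniform_limit (strip 0) (\<lambda>n \<theta>. \<Sum>i<n. c (e i) * fourier_mode (e i) \<theta>) (\<lambda>\<theta>. \<Sum>i. c (e i) * fourier_mode (e i) \<theta>) sequentially"
      by (rule Weierstrass_m_test[OF _ sc]) (simp add: norm_mult norm_fourier_mode_real)
    then have "continuous_on (strip 0) (\<lambda>\<theta>. \<Sum>i. c (e i) * fourier_mode (e i) \<theta>)"
    proof (rule uniform_limit_theorem[rotated])
      show "\<forall>\<^sub>F n in sequentially. continuous_on (strip 0) (\<lambda>\<theta>. \<Sum>i<n. c (e i) * fourier_mode (e i) \<theta>)"
        by (intro always_eventually allI continuous_intros continuous_on_fourier_mode)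
    qed simp
    then show "continuous_on (strip 0) H"
      by (rule continuous_on_eq) (use sums in \<open>simp add: sums_iff\<close>)
    show "H (\<theta> + axis j (of_real (2 * pi))) = H \<theta>" for \<theta> j
      unfolding H_def fourier_mode_periodic ..
  qed
  have cp0: "cont_periodic 0 F" using cont_periodic_mono[OF cp] \<rho> by simp
  \<comment> \<open>By orthogonality only the term with \<open>e n = k\<close> contributes to the
    average.\<close>
  have meanH: "multi_mean js (\<lambda>\<theta>. H \<theta> * fourier_mode (- k) \<theta>) \<theta> = c k" if \<theta>: "\<theta> \<in> strip 0" for k \<theta>
  proof -
    have 1: "(\<lambda>n. multi_mean js (\<lambda>\<theta>. c (e n) * fourier_mode (e n + - k) \<theta>) \<theta>) sums
        multi_mean js (\<lambda>\<theta>. H \<theta> * fourier_mode (- k) \<theta>) \<theta>"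
    proof (rule multi_mean_sums[OF mode_cp _ sc _ \<theta>])
      show "cmod (c (e n) * fourier_mode (e n + - k) \<theta>) \<le> cmod (c (e n))" if "\<theta> \<in> strip 0" for n \<theta>
        using norm_fourier_mode_real[OF that] by (simp add: norm_mult)
      show "(\<lambda>n. c (e n) * fourier_mode (e n + - k) \<theta>) sums (H \<theta> * fourier_mode (- k) \<theta>)" if "\<theta> \<in> strip 0" for \<theta>
        using sums_mult2[OF sums[OF that], of "fourier_mode (- k) \<theta>"] by (simp only: fourier_mode_add mult.assoc)
    qed
    obtain N where N: "e N = k" using e by (metis bij_betw_imp_surj_on imageE UNIV_I)
    have eN: "e n = k \<longleftrightarrow> n = N" for n using e N by (auto simp: bij_betw_def inj_on_def)
    have "multi_mean js (\<lambda>\<theta>. c (e n) * fourier_mode (e n + - k) \<theta>) \<theta> = (if n = N then c k else 0)" for n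
    proof -
      have "multi_mean js (\<lambda>\<theta>. fourier_mode (e n + - k) \<theta> * c (e n)) \<theta> = multi_mean js (fourier_mode (e n + - k)) \<theta> * c (e n)"
        by (rule multi_mean_factor) simp
      also have "\<dots> = (if e n = k then c k else 0)"
      proof (cases "e n = k")
        case False
        then have "\<not> (\<forall>j\<in>set js. (e n + - k) $ j = 0)" by (simp add: js(1) vec_eq_iff)
        then show ?thesis unfolding multi_mean_fourier_mode by (simp only: if_not_P False) simp
      qed (simp add: multi_mean_fourier_mode fourier_mode_zero)
      finally show ?thesis by (simp add: mult.commute eN)
    qed
    then have 2: "(\<lambda>n. multi_mean js (\<lambda>\<theta>. c (e n) * fourier_mode (e n + - k) \<theta>) \<theta>) sums c k"
      using sums_single[of N "\<lambda>_. c k"] by simp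
    from sums_unique2[OF 1 2] show ?thesis .
  qed
  have FH: "F \<theta> - H \<theta> = 0" if \<theta>: "\<theta> \<in> strip 0" for \<theta>
  proof (rule fourier_uniqueness[OF _ js(2) _ \<theta>])
    show "cont_periodic 0 (\<lambda>\<theta>. F \<theta> - H \<theta>)" by (rule cont_periodic_diff[OF cp0 cpH])
    fix k and \<theta> :: "complex ^ 'i" assume \<theta>: "\<theta> \<in> strip 0"
    then have "\<theta> \<in> strip \<rho>" using strip_mono[of 0 \<rho>] \<rho> by auto
    have "multi_mean js (\<lambda>\<theta>. F \<theta> * fourier_mode (- (- k)) \<theta> - H \<theta> * fourier_mode (- (- k)) \<theta>) \<theta> =
        multi_mean js (\<lambda>\<theta>. F \<theta> * fourier_mode (- (- k)) \<theta>) \<theta> - multi_mean js (\<lambda>\<theta>. H \<theta> * fourier_mode (- (- k)) \<theta>) \<theta>"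
      by (rule multi_mean_diff[OF _ _ \<theta>]) (intro cont_periodic_mult cp0 cpH cont_periodic_fourier_mode)+
    also have "\<dots> = c (- k) - c (- k)" by (simp only: meanH[OF \<theta>] const[OF \<open>\<theta> \<in> strip \<rho>\<close>])
    finally show "multi_mean js (\<lambda>\<theta>. (F \<theta> - H \<theta>) * fourier_mode k \<theta>) \<theta> = 0"
      by (simp add: algebra_simps)
  qed
  have exp: "((\<lambda>k. c k * fourier_mode k \<theta>) has_sum F \<theta>) UNIV" if "\<theta> \<in> strip 0" for \<theta>
  proof -
    have "F \<theta> = H \<theta>" using FH[OF that] by simp
    then show ?thesis using H[OF that] by metis
  qed
  show thesis by (rule that[of c M, OF decay exp])
qed

section \<open>Density of the nonresonant parameters\<close>

lemma measure_cover_le: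
  fixes A E :: "real set"
  assumes A: "A \<in> lmeasurable" and E: "E \<in> lmeasurable"
    and sub: "A \<subseteq> E \<union> (\<Union>n. cball (z n) (\<rho> n))" and \<rho>: "\<And>n. 0 \<le> \<rho> n" "summable \<rho>"
  shows "measure lebesgue A \<le> measure lebesgue E + 2 * suminf \<rho>"
proof -
  have c: "emeasure lebesgue (cball (z n) (\<rho> n)) = ennreal (2 * \<rho> n)" for n
    using \<rho>(1)[of n] by (simp add: cball_eq_atLeastAtMost)
  have s0: "0 \<le> suminf \<rho>" using \<rho> by (simp add: suminf_nonneg)
  have "emeasure lebesgue A \<le> emeasure lebesgue (E \<union> (\<Union>n. cball (z n) (\<rho> n)))"
    by (rule emeasure_mono[OF sub]) (use E in \<open>auto simp: fmeasurableD\<close>)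
  also have "\<dots> \<le> emeasure lebesgue E + emeasure lebesgue (\<Union>n. cball (z n) (\<rho> n))"
    by (rule emeasure_subadditive) (use E in \<open>auto simp: fmeasurableD\<close>)
  also have "emeasure lebesgue (\<Union>n. cball (z n) (\<rho> n)) \<le> (\<Sum>n. emeasure lebesgue (cball (z n) (\<rho> n)))"
    by (rule emeasure_subadditive_countably) auto
  also have "(\<Sum>n. emeasure lebesgue (cball (z n) (\<rho> n))) = ennreal (\<Sum>n. 2 * \<rho> n)"
    unfolding c by (rule suminf_ennreal2) (use \<rho> in \<open>auto intro: summable_mult\<close>)
  also have "(\<Sum>n. 2 * \<rho> n) = 2 * suminf \<rho>" using \<rho>(2) by (rule suminf_mult)
  also have "emeasure lebesgue E = ennreal (measure lebesgue E)" using E by (simp add: emeasure_eq_measure2)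
  finally have "ennreal (measure lebesgue A) \<le> ennreal (measure lebesgue E + 2 * suminf \<rho>)"
    using A s0 by (simp add: emeasure_eq_measure2 add_left_mono)
  then show ?thesis using s0 by (simp add: ennreal_plus[symmetric] del: ennreal_plus)
qed

text \<open>McShane's construction: the infimum of the cones
  \<open>f y + L * \<bar>x - y\<bar>\<close> over \<open>y\<close> in \<open>T\<close>. The
  extension lives on the whole line, so the intermediate value theorem applies although
  \<open>T\<close> may have gaps.\<close>

lemma lipschitz_extension:
  fixes f :: "real \<Rightarrow> real"
  assumes T: "T \<noteq> {}" and L: "0 \<le> L" and lip: "\<And>x y. x \<in> T \<Longrightarrow> y \<in> T \<Longrightarrow> \<bar>f x - f y\<bar> \<le> L * \<bar>x - y\<bar>"
  obtains g where "\<And>x. x \<in> T \<Longrightarrow> g x = f x" "\<And>x y. \<bar>g x - g y\<bar> \<le> L * \<bar>x - y\<bar>"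
proof -
  define g where "g x = (INF y\<in>T. f y + L * \<bar>x - y\<bar>)" for x
  obtain t where t: "t \<in> T" using T by blast
  have low: "f t - L * \<bar>x - t\<bar> \<le> f y + L * \<bar>x - y\<bar>" if "t \<in> T" "y \<in> T" for x y t
  proof -
    have "L * \<bar>t - y\<bar> \<le> L * (\<bar>x - t\<bar> + \<bar>x - y\<bar>)" using L by (intro mult_left_mono) auto
    then show ?thesis using lip[OF that] by (simp add: algebra_simps)
  qed
  have bdd: "bdd_below ((\<lambda>y. f y + L * \<bar>x - y\<bar>) ` T)" for x
    by (rule bdd_belowI2[where m = "f t - L * \<bar>x - t\<bar>"]) (rule low[OF t])
  have "g x = f x" if "x \<in> T" for x
  proof (rule antisym)
    show "g x \<le> f x" unfolding g_def using cINF_lower[OF bdd that, of x] by simp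
    show "f x \<le> g x" unfolding g_def by (rule cINF_greatest[OF T]) (use low[OF that, of _ x] in simp)
  qed
  moreover have half: "g x \<le> g y + L * \<bar>x - y\<bar>" for x y
  proof -
    have "g x - L * \<bar>x - y\<bar> \<le> g y"
      unfolding g_def[of y]
    proof (rule cINF_greatest[OF T])
      fix z assume z: "z \<in> T"
      have "g x \<le> f z + L * \<bar>x - z\<bar>" unfolding g_def by (rule cINF_lower[OF bdd z])
      moreover have "L * \<bar>x - z\<bar> \<le> L * (\<bar>x - y\<bar> + \<bar>y - z\<bar>)" using L by (intro mult_left_mono) auto
      ultimately show "g x - L * \<bar>x - y\<bar> \<le> f z + L * \<bar>y - z\<bar>" by (simp add: algebra_simps)
    qed
    then show ?thesis by simp
  qed
  moreover have "\<bar>g x - g y\<bar> \<le> L * \<bar>x - y\<bar>" for x y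
    using half[of x y] half[of y x] by (simp add: abs_minus_commute abs_le_iff algebra_simps)
  ultimately show thesis using that by blast
qed

text \<open>The good parameters \<open>f \<nu>\<close> have full density at \<open>0\<close>: a Lipschitz extension \<open>g\<close> of \<open>f\<close> maps
  \<open>[0, x]\<close> onto \<open>(0, \<epsilon>\<^sub>0)\<close>, and it maps the resonant intervals to a set of measure \<open>O(x\<^sup>3)\<close>,
  whereas \<open>x\<^sup>2\<close> is comparable with \<open>\<epsilon>\<^sub>0\<close>.\<close>

lemma for_most_small_image:
  fixes c r s :: "nat \<Rightarrow> real" and f :: "real \<Rightarrow> real"
  assumes r: "\<And>n. 0 \<le> r n" and s: "\<And>n. 0 \<le> s n" "summable s" and B: "0 \<le> B"
    and close: "\<And>n \<nu> x. 0 \<le> \<nu> \<Longrightarrow> \<nu> \<le> x \<Longrightarrow> \<bar>\<nu> - c n\<bar> < r n \<Longrightarrow> r n \<le> B * x ^ 3 * s n"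
    and p: "0 < p" and \<nu>1: "0 < \<nu>1" and L: "P * \<nu>1 \<le> L" "0 \<le> P"
  defines "N \<equiv> {\<nu>. 0 < \<nu> \<and> \<nu> \<le> \<nu>1 \<and> (\<forall>n. r n \<le> \<bar>\<nu> - c n\<bar>)}"
  assumes size: "\<And>\<nu>. \<nu> \<in> N \<Longrightarrow> p * \<nu>\<^sup>2 \<le> f \<nu>" "\<And>\<nu>. \<nu> \<in> N \<Longrightarrow> f \<nu> \<le> P * \<nu>\<^sup>2"
    and lip: "\<And>\<nu> \<nu>'. \<nu> \<in> N \<Longrightarrow> \<nu>' \<in> N \<Longrightarrow> \<bar>f \<nu> - f \<nu>'\<bar> \<le> L * \<bar>\<nu> - \<nu>'\<bar>"
  shows "for_most_small (\<lambda>\<epsilon>. \<epsilon> \<in> f ` N)"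
proof -
  have L0: "0 \<le> L" using L \<nu>1 by (smt (verit) mult_nonneg_nonneg)
  \<comment> \<open>The value 0 at 0 is added before extending, so that \<open>g 0 = 0\<close> is
    the lower end for the intermediate value theorem. The assumption
    \<open>P * \<nu>1 \<le> L\<close> keeps the Lipschitz constant \<open>L\<close>.\<close>
  define f0 where "f0 \<nu> = (if \<nu> = 0 then 0 else f \<nu>)" for \<nu>
  define T where "T = insert 0 N"
  have N0: "0 \<notin> N" by (simp add: N_def)
  have f_le: "\<bar>f \<nu>\<bar> \<le> L * \<bar>\<nu>\<bar>" if "\<nu> \<in> N" for \<nu>
  proof -
    have \<nu>: "0 < \<nu>" "\<nu> \<le> \<nu>1" using that by (auto simp: N_def)
    have "0 \<le> f \<nu>" using size(1)[OF that] p by (smt (verit) zero_le_power2 mult_nonneg_nonneg)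
    moreover have "P * \<nu>\<^sup>2 \<le> P * (\<nu>1 * \<nu>)" using \<nu> L by (intro mult_left_mono) (auto simp: power2_eq_square)
    moreover have "P * (\<nu>1 * \<nu>) \<le> L * \<nu>"
      unfolding mult.assoc[symmetric] using L \<nu> by (intro mult_right_mono) auto
    ultimately have "0 \<le> f \<nu>" "f \<nu> \<le> L * \<nu>" using size(2)[OF that] by linarith+
    then show ?thesis using \<nu> by simp
  qed
  have lip0: "\<bar>f0 x - f0 y\<bar> \<le> L * \<bar>x - y\<bar>" if "x \<in> T" "y \<in> T" for x y
    using that lip[of x y] f_le[of x] f_le[of y] N0 by (auto simp: T_def f0_def)
  obtain g where g: "\<And>x. x \<in> T \<Longrightarrow> g x = f0 x" "\<And>x y. \<bar>g x - g y\<bar> \<le> L * \<bar>x - y\<bar>"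
    using lipschitz_extension[of T L f0] L0 lip0 by (auto simp: T_def)
  have contg: "continuous_on A g" for A
  proof (rule lipschitz_on_continuous_on)
    show "L-lipschitz_on A g" using g(2) L0 by (intro lipschitz_onI) (auto simp: dist_real_def)
  qed
  have gN: "g \<nu> = f \<nu>" if "\<nu> \<in> N" for \<nu> using g(1)[of \<nu>] that N0 by (auto simp: T_def f0_def)
  have g0: "g 0 = 0" using g(1)[of 0] by (simp add: T_def f0_def)
  \<comment> \<open>Measurability: the sets \<open>?K n\<close> exhaust \<open>N\<close> and are
    compact, so the image of \<open>N\<close> is a countable union of compact sets.\<close>
  have fN: "f ` N = (\<Union>n. g ` {\<nu>. 1 / real (Suc n) \<le> \<nu> \<and> \<nu> \<le> \<nu>1 \<and> (\<forall>n. r n \<le> \<bar>\<nu> - c n\<bar>)})" (is "_ = (\<Union>n. g ` ?K n)")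
  proof -
    have "N = (\<Union>n. ?K n)"
    proof
      show "N \<subseteq> (\<Union>n. ?K n)"
      proof
        fix \<nu> assume \<nu>: "\<nu> \<in> N"
        then obtain n where "1 / real (Suc n) < \<nu>" using reals_Archimedean[of \<nu>] by (auto simp: N_def inverse_eq_divide)
        then show "\<nu> \<in> (\<Union>n. ?K n)" using \<nu> by (auto simp: N_def intro: less_imp_le)
      qed
      show "(\<Union>n. ?K n) \<subseteq> N"
        by (auto simp: N_def intro: less_le_trans[of 0 "1 / real (Suc _)"])
    qed
    moreover have "f ` N = g ` N" using gN by simp
    ultimately show ?thesis by (metis image_UN)
  qed
  have "closed (?K n)" for n
    by (intro closed_Collect_conj closed_Collect_all closed_Collect_le continuous_intros)
  moreover have "?K n \<subseteq> {0..\<nu>1}" for n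
  proof
    fix \<nu> assume "\<nu> \<in> ?K n"
    moreover have "0 < 1 / real (Suc n)" by simp
    ultimately have "0 < \<nu>" "\<nu> \<le> \<nu>1" using less_le_trans by blast+
    then show "\<nu> \<in> {0..\<nu>1}" by simp
  qed
  ultimately have "compact (?K n)" for n
    using bounded_subset[OF bounded_closed_interval] by (simp only: compact_eq_bounded_closed) blast
  then have cK: "compact (g ` ?K n)" for n by (intro compact_continuous_image contg)
  have fN_sets: "f ` N \<in> sets borel"
    unfolding fN by (intro sets.countable_UN) (use borel_compact[OF cK] in auto)
  define E where "E \<epsilon> = f ` N \<inter> {0<..<\<epsilon>}" for \<epsilon>
  have E: "E \<epsilon> \<in> lmeasurable" for \<epsilon>
  proof -
    have "E \<epsilon> \<in> sets borel" using fN_sets by (simp add: E_def)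
    then have "E \<epsilon> \<in> sets lebesgue" by simp
    then show ?thesis unfolding E_def by (intro fmeasurableI2[OF lmeasurable_interval(2)[of 0 \<epsilon>]]) auto
  qed
  have E_le: "measure lebesgue (E \<epsilon>) \<le> \<epsilon>" if "0 < \<epsilon>" for \<epsilon>
  proof -
    have "measure lebesgue (E \<epsilon>) \<le> measure lebesgue {0<..<\<epsilon>}"
      by (rule measure_mono_fmeasurable) (use E in \<open>auto simp: E_def fmeasurableD\<close>)
    then show ?thesis using that by simp
  qed
  define S where "S = suminf s"
  have S: "0 \<le> S" unfolding S_def using s by (simp add: suminf_nonneg)
  have S_sum: "measure lebesgue A \<le> measure lebesgue D + 2 * (C * S)"
    if "A \<in> lmeasurable" "D \<in> lmeasurable" "A \<subseteq> D \<union> (\<Union>n. cball (z n) (C * s n))" "0 \<le> C"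
    for A D :: "real set" and z C
    using measure_cover_le[OF that(1-3)] that(4) s by (simp add: S_def suminf_mult summable_mult)
  \<comment> \<open>The choice of \<open>x\<close> ensures that a good exponent in
    \<open>[x / 2, x]\<close> is mapped to at least \<open>\<epsilon>\<close>; the last assumption
    says that the resonant intervals are too short to cover \<open>[x / 2, x]\<close>.\<close>
  have key: "\<epsilon> - 2 * (L * (B * x ^ 3) * S) \<le> measure lebesgue (E \<epsilon>)"
    if \<epsilon>: "0 < \<epsilon>" and x: "0 < x" "x \<le> \<nu>1" "p * (x / 2)\<^sup>2 = \<epsilon>" "4 * (B * x ^ 3 * S) < x" for \<epsilon> x
  proof -
    have Bx: "0 \<le> B * x ^ 3" using B x by simp
    have "\<exists>\<nu>\<in>{x/2..x}. \<nu> \<in> N"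
    proof (rule ccontr)
      assume no: "\<not> ?thesis"
      have "{x/2..x} \<subseteq> {} \<union> (\<Union>n. cball (c n) (B * x ^ 3 * s n))"
      proof
        fix \<nu> assume \<nu>: "\<nu> \<in> {x/2..x}"
        then have "\<nu> \<notin> N" using no by blast
        then obtain n where n: "\<bar>\<nu> - c n\<bar> < r n" using \<nu> x by (auto simp: N_def not_le)
        then have "\<bar>\<nu> - c n\<bar> \<le> B * x ^ 3 * s n" using close[OF _ _ n, of x] \<nu> x by auto
        then show "\<nu> \<in> {} \<union> (\<Union>n. cball (c n) (B * x ^ 3 * s n))" by (auto simp: dist_real_def abs_minus_commute)
      qed
      from S_sum[OF _ _ this Bx] have "x - x / 2 \<le> 2 * (B * x ^ 3 * S)" using x by simp
      then show False using x by simp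
    qed
    then obtain \<nu> where \<nu>: "x / 2 \<le> \<nu>" "\<nu> \<le> x" "\<nu> \<in> N" by auto
    have "\<epsilon> \<le> p * \<nu>\<^sup>2" unfolding x(3)[symmetric] using \<nu> x p by (intro mult_left_mono power_mono) auto
    then have g\<nu>: "\<epsilon> \<le> g \<nu>" using size(1)[OF \<nu>(3)] gN[OF \<nu>(3)] by simp
    have "{0<..<\<epsilon>} \<subseteq> E \<epsilon> \<union> (\<Union>n. cball (g (c n)) (L * (B * x ^ 3) * s n))"
    proof
      fix e assume e: "e \<in> {0<..<\<epsilon>}"
      \<comment> \<open>Continuity of \<open>g\<close> gives a preimage \<open>y\<close> in
        \<open>[0, \<nu>]\<close>. If it is not in \<open>N\<close>, it lies in a resonant interval,
        and its image is within \<open>L * (B * x ^ 3) * s n\<close> of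
        \<open>g (c n)\<close>.\<close>
      have "\<exists>y\<ge>0. y \<le> \<nu> \<and> g y = e"
        by (rule IVT') (use e g0 g\<nu> \<nu> x contg in auto)
      then obtain y where y: "0 \<le> y" "y \<le> \<nu>" "g y = e" by blast
      have "0 < y" using y g0 e by (cases "y = 0") auto
      show "e \<in> E \<epsilon> \<union> (\<Union>n. cball (g (c n)) (L * (B * x ^ 3) * s n))"
      proof (cases "y \<in> N")
        case True
        then have "e \<in> f ` N" using gN y(3) by force
        then show ?thesis using e by (simp add: E_def)
      next
        case False
        then obtain n where n: "\<bar>y - c n\<bar> < r n" using \<open>0 < y\<close> y \<nu> x by (auto simp: N_def not_le)
        have "r n \<le> B * x ^ 3 * s n" using close[OF y(1) _ n, of x] y \<nu> by simp
        then have "L * \<bar>y - c n\<bar> \<le> L * (B * x ^ 3 * s n)" using n L0 by (intro mult_left_mono) auto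
        then have "\<bar>g y - g (c n)\<bar> \<le> L * (B * x ^ 3) * s n" using g(2)[of y "c n"] by (simp add: mult_ac)
        then show ?thesis using y(3) by (auto simp: dist_real_def abs_minus_commute)
      qed
    qed
    from S_sum[OF _ E this] have "\<epsilon> \<le> measure lebesgue (E \<epsilon>) + 2 * (L * (B * x ^ 3) * S)"
      using \<epsilon> L0 Bx by simp
    then show ?thesis by simp
  qed
  define X where "X \<epsilon> = 2 * sqrt (\<epsilon> / p)" for \<epsilon>
  have X0: "(X \<longlongrightarrow> 0) (at_right 0)"
  proof -
    have "isCont X 0" unfolding X_def using p by (intro continuous_intros) auto
    then have "(X \<longlongrightarrow> X 0) (at 0)" by (simp add: isCont_def)
    then show ?thesis by (simp add: X_def filterlim_at_split)
  qed
  define D where "D = 2 * (L * B * S)"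
  have D: "0 \<le> D" using L0 B S by (simp add: D_def)
  have lower: "\<forall>\<^sub>F \<epsilon> in at_right 0. 0 < \<epsilon> \<and> 1 - 4 / p * D * X \<epsilon> \<le> measure lebesgue (E \<epsilon>) / \<epsilon>"
  proof -
    have "((\<lambda>\<epsilon>. 4 * (B * S) * (X \<epsilon>)\<^sup>2) \<longlongrightarrow> 4 * (B * S) * 0\<^sup>2) (at_right 0)"
      by (intro tendsto_intros X0)
    then have l2: "((\<lambda>\<epsilon>. 4 * (B * S) * (X \<epsilon>)\<^sup>2) \<longlongrightarrow> 0) (at_right 0)" by simp
    have "\<forall>\<^sub>F \<epsilon> in at_right 0. X \<epsilon> < \<nu>1" using order_tendstoD(2)[OF X0 \<nu>1] .
    moreover have "\<forall>\<^sub>F \<epsilon> in at_right 0. 4 * (B * S) * (X \<epsilon>)\<^sup>2 < 1" using order_tendstoD(2)[OF l2] by simp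
    moreover have "\<forall>\<^sub>F \<epsilon>::real in at_right 0. 0 < \<epsilon>" by (simp add: eventually_at_right_less)
    ultimately show ?thesis
    proof eventually_elim
      case (elim \<epsilon>)
      have Xp: "0 < X \<epsilon>" using elim p by (simp add: X_def)
      have X2: "p * (X \<epsilon> / 2)\<^sup>2 = \<epsilon>" using elim p by (simp add: X_def)
      have "4 * (B * X \<epsilon> ^ 3 * S) = (4 * (B * S) * (X \<epsilon>)\<^sup>2) * X \<epsilon>" by (simp add: power2_eq_square power3_eq_cube)
      also have "\<dots> < 1 * X \<epsilon>" using elim Xp by (intro mult_strict_right_mono)
      finally have "4 * (B * X \<epsilon> ^ 3 * S) < X \<epsilon>" by simp
      from key[OF elim(3) Xp less_imp_le[OF elim(1)] X2 this]
      have "\<epsilon> - D * X \<epsilon> ^ 3 \<le> measure lebesgue (E \<epsilon>)" by (simp add: D_def mult_ac)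
      \<comment> \<open>The cube of \<open>X \<epsilon>\<close> is \<open>X \<epsilon>\<close> times
        a multiple of \<open>\<epsilon>\<close>, so the relative loss is of order
        \<open>X \<epsilon>\<close> and tends to 0.\<close>
      moreover have "D * X \<epsilon> ^ 3 = (4 / p * D * X \<epsilon>) * \<epsilon>"
      proof -
        have "X \<epsilon> ^ 3 = X \<epsilon> * (X \<epsilon>)\<^sup>2" by (simp add: power2_eq_square power3_eq_cube)
        also have "(X \<epsilon>)\<^sup>2 = 4 / p * \<epsilon>" using X2 p by (simp add: field_simps)
        finally show ?thesis by simp
      qed
      ultimately have "(1 - 4 / p * D * X \<epsilon>) * \<epsilon> \<le> measure lebesgue (E \<epsilon>)" by (simp add: algebra_simps)
      then show ?case using elim by (simp add: pos_le_divide_eq)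
    qed
  qed
  have lim1: "((\<lambda>\<epsilon>. 1 - 4 / p * D * X \<epsilon>) \<longlongrightarrow> 1 - 4 / p * D * 0) (at_right 0)"
    by (intro tendsto_intros X0)
  have ratio: "((\<lambda>\<epsilon>. measure lebesgue (E \<epsilon>) / \<epsilon>) \<longlongrightarrow> 1) (at_right 0)"
  proof (rule tendsto_sandwich[where f = "\<lambda>\<epsilon>. 1 - 4 / p * D * X \<epsilon>" and h = "\<lambda>_. 1"])
    show "\<forall>\<^sub>F \<epsilon> in at_right 0. 1 - 4 / p * D * X \<epsilon> \<le> measure lebesgue (E \<epsilon>) / \<epsilon>"
      using lower by eventually_elim simp
    show "\<forall>\<^sub>F \<epsilon> in at_right 0. measure lebesgue (E \<epsilon>) / \<epsilon> \<le> 1"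
      using eventually_at_right_less[of 0] by eventually_elim (use E_le in \<open>simp add: divide_le_eq\<close>)
  qed (use lim1 in auto)
  have "\<forall>\<^sub>F \<epsilon> in at_right 0. 1 / 2 < measure lebesgue (E \<epsilon>) / \<epsilon>"
    by (rule order_tendstoD(1)[OF ratio]) simp
  moreover have "\<forall>\<^sub>F \<epsilon>::real in at_right 0. 0 < \<epsilon>" by (simp add: eventually_at_right_less)
  ultimately have "\<forall>\<^sub>F \<epsilon>\<^sub>0 in at_right 0. E \<epsilon>\<^sub>0 \<subseteq> {0<..<\<epsilon>\<^sub>0} \<and> E \<epsilon>\<^sub>0 \<in> lmeasurable \<and>
      measure lebesgue (E \<epsilon>\<^sub>0) > 0 \<and> (\<forall>\<epsilon>\<in>E \<epsilon>\<^sub>0. \<epsilon> \<in> f ` N)"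
  proof eventually_elim
    case (elim \<epsilon>)
    then have "0 < measure lebesgue (E \<epsilon>)" by (simp add: less_divide_eq)
    then show ?case using E[of \<epsilon>] by (auto simp: E_def)
  qed
  then show ?thesis using ratio unfolding for_most_small_def by blast
qed

section \<open>Reduction to a rotation\<close>

lemma cmod_fourier_mode_le:
  assumes "\<theta> \<in> strip \<sigma>" shows "cmod (fourier_mode k \<theta>) \<le> exp (\<sigma> * index_len k)"
proof -
  have "- (\<Sum>j\<in>UNIV. of_int (k $ j) * Im (\<theta> $ j)) = (\<Sum>j\<in>UNIV. - (of_int (k $ j) * Im (\<theta> $ j)))"
    by (simp add: sum_negf)
  also have "\<dots> \<le> (\<Sum>j\<in>UNIV. \<sigma> * of_int \<bar>k $ j\<bar>)"
  proof (rule sum_mono)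
    fix j
    have "\<bar>Im (\<theta> $ j)\<bar> \<le> \<sigma>" using assms by (simp add: strip_def)
    then have "\<bar>real_of_int (k $ j)\<bar> * \<bar>Im (\<theta> $ j)\<bar> \<le> \<bar>real_of_int (k $ j)\<bar> * \<sigma>" by (intro mult_left_mono) auto
    then show "- (of_int (k $ j) * Im (\<theta> $ j)) \<le> \<sigma> * of_int \<bar>k $ j\<bar>"
      using abs_ge_minus_self[of "of_int (k $ j) * Im (\<theta> $ j)"] by (simp add: abs_mult mult.commute)
  qed
  also have "\<dots> = \<sigma> * index_len k" by (simp add: index_len_def sum_distrib_left)
  finally show ?thesis by (simp add: norm_fourier_mode)
qed

text \<open>Half of the width \<open>\<sigma>\<close> bounds the modes on \<open>U\<close>, the
  other half absorbs the factor \<open>index_len\<close> produced by differentiation; the termwise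
  derivatives then converge uniformly and stay complex linear. The width \<open>\<sigma> / 4\<close>
  leaves room for the open neighbourhood \<open>U\<close>.\<close>

lemma fourier_series_holomorphic:
  fixes a :: "nat \<Rightarrow> complex" and \<kappa> :: "nat \<Rightarrow> int ^ 'i::finite"
  assumes a: "summable (\<lambda>n. cmod (a n) * exp (\<sigma> * index_len (\<kappa> n)))" and \<sigma>: "0 < \<sigma>"
  defines "F \<equiv> \<lambda>\<theta>. \<Sum>n. a n * fourier_mode (\<kappa> n) \<theta>"
  shows "analytic_several_on F (strip (\<sigma> / 4))"
proof -
  define U :: "(complex ^ 'i) set" where "U = {\<theta>. \<forall>j. \<bar>Im (\<theta> $ j)\<bar> < \<sigma> / 2}"
  have "open {\<theta> :: complex ^ 'i. \<bar>Im (\<theta> $ j)\<bar> < \<sigma> / 2}" for j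
    by (intro open_Collect_less continuous_intros)
  moreover have "U = (\<Inter>j. {\<theta>. \<bar>Im (\<theta> $ j)\<bar> < \<sigma> / 2})" by (auto simp: U_def)
  ultimately have U: "open U" by (simp add: open_INT)
  have cU: "convex U"
  proof -
    have "convex ((\<lambda>\<theta> :: complex ^ 'i. Im (\<theta> $ j)) -` ball 0 (\<sigma> / 2))" for j
      by (intro convex_linear_vimage convex_ball linearI) auto
    moreover have "U = (\<Inter>j. (\<lambda>\<theta>. Im (\<theta> $ j)) -` ball 0 (\<sigma> / 2))" by (auto simp: U_def)
    ultimately show ?thesis by (simp add: convex_INT)
  qed
  have sub: "strip (\<sigma> / 4) \<subseteq> U"
  proof
    fix \<theta> :: "complex ^ 'i" assume "\<theta> \<in> strip (\<sigma> / 4)"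
    then have "\<bar>Im (\<theta> $ j)\<bar> \<le> \<sigma> / 4" for j by (simp add: strip_def)
    moreover have "\<sigma> / 4 < \<sigma> / 2" using \<sigma> by simp
    ultimately have "\<bar>Im (\<theta> $ j)\<bar> < \<sigma> / 2" for j using le_less_trans by blast
    then show "\<theta> \<in> U" by (simp add: U_def)
  qed
  have US: "\<theta> \<in> strip (\<sigma> / 2)" if "\<theta> \<in> U" for \<theta> using that by (simp add: U_def strip_def less_imp_le)
  have mode: "cmod (fourier_mode k \<theta>) \<le> exp (\<sigma> / 2 * index_len k)" if "\<theta> \<in> U" for k \<theta>
    by (rule cmod_fourier_mode_le[OF US[OF that]])
  define T :: "nat \<Rightarrow> complex ^ 'i \<Rightarrow> complex" where "T n h = \<i> * (\<Sum>j\<in>UNIV. of_int (\<kappa> n $ j) * h $ j)" for n h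
  define f' where "f' n \<theta> h = a n * (fourier_mode (\<kappa> n) \<theta> * T n h)" for n \<theta> h
  define b where "b n = 2 / \<sigma> * (cmod (a n) * exp (\<sigma> * index_len (\<kappa> n)))" for n
  have b: "summable b" unfolding b_def by (intro summable_mult a)
  have T: "cmod (T n h) \<le> index_len (\<kappa> n) * norm h" for n h
  proof -
    have "cmod (T n h) = cmod (\<Sum>j\<in>UNIV. of_int (\<kappa> n $ j) * h $ j)" by (simp add: T_def norm_mult)
    also have "\<dots> \<le> (\<Sum>j\<in>UNIV. cmod (of_int (\<kappa> n $ j) * h $ j))" by (rule norm_sum)
    also have "\<dots> \<le> (\<Sum>j\<in>UNIV. of_int \<bar>\<kappa> n $ j\<bar> * norm h)"
      by (intro sum_mono) (auto simp: norm_mult intro!: mult_left_mono Finite_Cartesian_Product.norm_nth_le)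
    also have "\<dots> = index_len (\<kappa> n) * norm h" by (simp add: index_len_def sum_distrib_right)
    finally show ?thesis .
  qed
  have fb: "cmod (f' n \<theta> h) \<le> b n * norm h" if "\<theta> \<in> U" for n \<theta> h
  proof -
    define l where "l = index_len (\<kappa> n)"
    have l: "0 \<le> l" unfolding l_def by (rule index_len_nonneg)
    have "l \<le> 2 / \<sigma> * exp (\<sigma> / 2 * l)" using power_times_exp_le[OF l, of "\<sigma> / 2" 1] \<sigma> by simp
    then have "exp (\<sigma> / 2 * l) * l \<le> exp (\<sigma> / 2 * l) * (2 / \<sigma> * exp (\<sigma> / 2 * l))" by (intro mult_left_mono) auto
    also have "\<dots> = 2 / \<sigma> * exp (\<sigma> * l)"
      using exp_add[of "\<sigma> / 2 * l" "\<sigma> / 2 * l"] by (simp add: mult_ac)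
    finally have e: "exp (\<sigma> / 2 * l) * l \<le> 2 / \<sigma> * exp (\<sigma> * l)" .
    have "cmod (f' n \<theta> h) = cmod (a n) * (cmod (fourier_mode (\<kappa> n) \<theta>) * cmod (T n h))" by (simp add: f'_def norm_mult)
    also have "\<dots> \<le> cmod (a n) * (exp (\<sigma> / 2 * l) * (l * norm h))"
      unfolding l_def by (intro mult_left_mono mult_mono mode T that) auto
    also have "\<dots> = cmod (a n) * (exp (\<sigma> / 2 * l) * l) * norm h" by simp
    also have "\<dots> \<le> cmod (a n) * (2 / \<sigma> * exp (\<sigma> * l)) * norm h" by (intro mult_right_mono mult_left_mono e) auto
    finally show ?thesis by (simp add: b_def l_def mult_ac)
  qed
  have sf: "summable (\<lambda>n. f' n \<theta> h)" if "\<theta> \<in> U" for \<theta> h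
    by (rule summable_comparison_test'[OF summable_mult2[OF b, of "norm h"], of 0]) (use fb[OF that] in simp)
  define G where "G \<theta> h = (\<Sum>n. f' n \<theta> h)" for \<theta> h
  have Fs: "summable (\<lambda>n. a n * fourier_mode (\<kappa> n) \<theta>)" if "\<theta> \<in> U" for \<theta>
  proof (rule summable_comparison_test'[OF a, of 0])
    fix n
    have "exp (\<sigma> / 2 * index_len (\<kappa> n)) \<le> exp (\<sigma> * index_len (\<kappa> n))"
      using index_len_nonneg[of "\<kappa> n"] \<sigma> by (simp add: mult_right_mono)
    then show "norm (a n * fourier_mode (\<kappa> n) \<theta>) \<le> cmod (a n) * exp (\<sigma> * index_len (\<kappa> n))"
      using order_trans[OF mode[OF that, of "\<kappa> n"]] unfolding norm_mult by (intro mult_left_mono) auto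
  qed
  have z: "0 \<in> U" using \<sigma> by (simp add: U_def)
  have dT: "(fourier_mode (\<kappa> n) has_derivative (\<lambda>h. fourier_mode (\<kappa> n) \<theta> * T n h)) (at \<theta> within U)" for n \<theta>
  proof -
    have "linear (T n)"
      by (rule linearI) (simp_all add: T_def ring_distribs sum.distrib scaleR_sum_right[symmetric])
    then have "(T n has_derivative T n) (at \<theta> within U)"
      by (intro bounded_linear_imp_has_derivative) (simp add: linear_conv_bounded_linear)
    from has_derivative_compose[OF this DERIV_exp[unfolded has_field_derivative_def]] show ?thesis
      by (simp add: fourier_mode_def[abs_def] T_def)
  qed
  have "\<exists>g. \<forall>\<theta>\<in>U. (\<lambda>n. a n * fourier_mode (\<kappa> n) \<theta>) sums g \<theta> \<and> (g has_derivative G \<theta>) (at \<theta> within U)"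
  proof (rule has_derivative_series[where f' = f' and x = 0 and l = "F 0", OF cU])
    show "((\<lambda>\<theta>. a n * fourier_mode (\<kappa> n) \<theta>) has_derivative f' n \<theta>) (at \<theta> within U)" if "\<theta> \<in> U" for n \<theta>
      unfolding f'_def[abs_def] by (rule has_derivative_mult_right[OF dT])
    show "(\<lambda>n. a n * fourier_mode (\<kappa> n) 0) sums F 0" unfolding F_def by (rule summable_sums[OF Fs[OF z]])
    fix e :: real assume e: "e > 0"
    have "(\<lambda>n. \<Sum>i. b (i + n)) \<longlonglongrightarrow> 0" using b by (rule suminf_exist_split2)
    then have "\<forall>\<^sub>F n in sequentially. (\<Sum>i. b (i + n)) < e" using order_tendstoD(2) e by blast
    then show "\<forall>\<^sub>F n in sequentially. \<forall>\<theta>\<in>U. \<forall>h. norm ((\<Sum>i<n. f' i \<theta> h) - G \<theta> h) \<le> e * norm h"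
    proof eventually_elim
      case (elim n)
      show ?case
      proof (intro ballI allI)
        fix \<theta> h assume \<theta>: "\<theta> \<in> U"
        have bn: "summable (\<lambda>i. b (i + n))" using b by (rule summable_ignore_initial_segment)
        have "(\<Sum>i<n. f' i \<theta> h) - G \<theta> h = - (\<Sum>i. f' (i + n) \<theta> h)"
          unfolding G_def using suminf_split_initial_segment[OF sf[OF \<theta>], of h n] by simp
        then have "norm ((\<Sum>i<n. f' i \<theta> h) - G \<theta> h) = norm (\<Sum>i. f' (i + n) \<theta> h)" by simp
        also have "\<dots> \<le> (\<Sum>i. b (i + n) * norm h)"
          by (rule norm_suminf_le[OF fb[OF \<theta>] summable_mult2[OF bn]])
        also have "\<dots> = (\<Sum>i. b (i + n)) * norm h" using bn by (simp add: suminf_mult2)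
        also have "\<dots> \<le> e * norm h" using elim by (intro mult_right_mono) auto
        finally show "norm ((\<Sum>i<n. f' i \<theta> h) - G \<theta> h) \<le> e * norm h" .
      qed
    qed
  qed (rule z)
  then obtain g where g: "\<And>\<theta>. \<theta> \<in> U \<Longrightarrow> (\<lambda>n. a n * fourier_mode (\<kappa> n) \<theta>) sums g \<theta>"
    "\<And>\<theta>. \<theta> \<in> U \<Longrightarrow> (g has_derivative G \<theta>) (at \<theta> within U)" by blast
  have gF: "g \<theta> = F \<theta>" if "\<theta> \<in> U" for \<theta> using g(1)[OF that] by (simp add: F_def sums_iff)
  have "holomorphic_at F \<theta>" if \<theta>: "\<theta> \<in> U" for \<theta>
    unfolding holomorphic_at_def
  proof (intro exI conjI allI)
    have "(F has_derivative G \<theta>) (at \<theta> within U)"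
      by (rule has_derivative_transform[OF \<theta> _ g(2)[OF \<theta>]]) (simp add: gF)
    then show "(F has_derivative G \<theta>) (at \<theta>)" by (simp only: at_within_open[OF \<theta> U])
    show "G \<theta> (c *s h) = c * G \<theta> h" for c h
    proof -
      have "T n (c *s h) = c * T n h" for n
        by (simp add: T_def sum_distrib_left mult_ac)
      then have "f' n \<theta> (c *s h) = c * f' n \<theta> h" for n by (simp add: f'_def)
      then show ?thesis unfolding G_def using suminf_mult[OF sf[OF \<theta>], of c h] by simp
    qed
  qed
  then show ?thesis unfolding analytic_several_on_def using U sub by blast
qed

lemma mode_of_real: "cmod (fourier_mode k (\<chi> j. of_real (x $ j))) = 1"
  by (simp add: norm_fourier_mode)

locale torus_flow = frequency_group "\<lambda>k. \<Sum>j\<in>UNIV. of_int (k $ j) * \<omega> $ j" index_len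
  for \<omega> :: "real ^ 'i::finite"
begin

text \<open>Replacing \<open>cis\<close> by the Fourier modes in the series of \<open>f\<close>
  along the flow gives its hull on the complexified torus.\<close>

lemma wiener_imp_analytic_quasi_periodic:
  assumes "wiener \<sigma> M (\<lambda>t. of_real (f t))" "0 < \<sigma>"
  shows "analytic_quasi_periodic (\<sigma> / 4) \<omega> f"
proof -
  obtain a \<kappa> where r: "fourier_rep \<sigma> a \<kappa> M (\<lambda>t. of_real (f t))" using assms by (auto simp: wiener_def)
  have s: "summable (\<lambda>n. cmod (a n) * exp (\<sigma> * index_len (\<kappa> n)))"
    using r by (auto simp: fourier_rep_def intro: summable_on_imp_summable)
  define F where "F \<theta> = (\<Sum>n. a n * fourier_mode (\<kappa> n) \<theta>)" for \<theta>
  have "analytic_several_on F (strip (\<sigma> / 4))"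
    unfolding F_def[abs_def] by (rule fourier_series_holomorphic[OF s assms(2)])
  moreover have "F (\<theta> + axis j (of_real (2 * pi))) = F \<theta>" for \<theta> j
    unfolding F_def fourier_mode_periodic ..
  moreover have "of_real (f t) = F (\<chi> j. of_real (\<omega> $ j * t))" for t
    using fourier_rep_sums(2)[OF r, of t] assms(2) unfolding F_def fourier_mode_flow by (simp add: sums_iff)
  ultimately show ?thesis unfolding analytic_quasi_periodic_def by blast
qed

text \<open>The same series at real points; this continuous hull serves for the solutions of Hill's
  equation.\<close>

lemma wiener_hull:
  assumes "wiener \<sigma> M f" "0 \<le> \<sigma>"
  obtains P :: "real ^ 'i \<Rightarrow> complex" where "continuous_on UNIV P"
    "\<And>\<theta> j. P (\<theta> + axis j (2 * pi)) = P \<theta>" "\<And>t. f t = P (\<chi> j. \<omega> $ j * t)"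
proof -
  obtain a \<kappa> where r: "fourier_rep \<sigma> a \<kappa> M f" using assms by (auto simp: wiener_def)
  define c :: "real ^ 'i \<Rightarrow> complex ^ 'i" where "c x = (\<chi> j. of_real (x $ j))" for x
  define P where "P x = (\<Sum>n. a n * fourier_mode (\<kappa> n) (c x))" for x
  have cc: "continuous_on UNIV c" unfolding c_def by (intro continuous_intros)
  have ul: "uniform_limit UNIV (\<lambda>n x. \<Sum>i<n. a i * fourier_mode (\<kappa> i) (c x)) (\<lambda>x. \<Sum>i. a i * fourier_mode (\<kappa> i) (c x)) sequentially"
    by (rule Weierstrass_m_test[OF _ fourier_rep_sums(1)[OF r assms(2)]]) (simp add: norm_mult mode_of_real c_def)
  have cm: "continuous_on UNIV (\<lambda>x. fourier_mode k (c x))" for k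
    by (rule continuous_on_compose2[OF continuous_on_fourier_mode cc]) auto
  have "continuous_on UNIV P"
    unfolding P_def[abs_def]
    by (rule uniform_limit_theorem[OF _ ul]) (intro always_eventually allI continuous_intros cm, simp)
  moreover have "P (\<theta> + axis j (2 * pi)) = P \<theta>" for \<theta> j
  proof -
    have "c (\<theta> + axis j (2 * pi)) = c \<theta> + axis j (of_real (2 * pi))" by (simp add: c_def vec_eq_iff axis_def)
    then show ?thesis by (simp only: P_def fourier_mode_periodic)
  qed
  moreover have "f t = P (\<chi> j. \<omega> $ j * t)" for t
  proof -
    have "c (\<chi> j. \<omega> $ j * t) = (\<chi> j. of_real (\<omega> $ j * t))" by (simp add: c_def)
    then show ?thesis
      using fourier_rep_sums(2)[OF r assms(2), of t] unfolding P_def by (simp only: fourier_mode_flow sums_iff)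
  qed
  ultimately show thesis by (rule that)
qed

end

section \<open>Planar systems: the rotation normal form and the frame of a Floquet solution\<close>

lemma has_vector_derivative_vec2:
  fixes z :: "real \<Rightarrow> real ^ 2"
  shows "(z has_vector_derivative z') (at t) \<longleftrightarrow>
    ((\<lambda>t. z t $ 1) has_real_derivative z' $ 1) (at t) \<and> ((\<lambda>t. z t $ 2) has_real_derivative z' $ 2) (at t)"
proof
  assume "(z has_vector_derivative z') (at t)"
  then show "((\<lambda>t. z t $ 1) has_real_derivative z' $ 1) (at t) \<and> ((\<lambda>t. z t $ 2) has_real_derivative z' $ 2) (at t)"
    unfolding has_real_derivative_iff_has_vector_derivative
    using bounded_linear.has_vector_derivative[OF bounded_linear_vec_nth] by blast
next
  assume d: "((\<lambda>t. z t $ 1) has_real_derivative z' $ 1) (at t) \<and> ((\<lambda>t. z t $ 2) has_real_derivative z' $ 2) (at t)"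
  have b: "bounded_linear (\<lambda>x::real. x *\<^sub>R (axis i 1 :: real ^ 2))" for i by (rule bounded_linear_scaleR_left)
  have "((\<lambda>t. (z t $ 1) *\<^sub>R axis 1 1 + (z t $ 2) *\<^sub>R axis 2 1) has_vector_derivative
      (z' $ 1) *\<^sub>R axis 1 1 + (z' $ 2) *\<^sub>R (axis 2 1 :: real ^ 2)) (at t)"
    using d unfolding has_real_derivative_iff_has_vector_derivative
    by (intro has_vector_derivative_add bounded_linear.has_vector_derivative[OF b]) auto
  moreover have "(x $ 1) *\<^sub>R axis 1 1 + (x $ 2) *\<^sub>R axis 2 1 = x" for x :: "real ^ 2"
    by (simp add: vec_eq_iff forall_2 axis_def)
  ultimately show "(z has_vector_derivative z') (at t)" by (simp only:)
qed

lemma hill_linear_system_iff: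
  "linear_system_solution (hill_matrix a \<epsilon>) z \<longleftrightarrow>
     (\<forall>t. ((\<lambda>t. z t $ 1) has_real_derivative z t $ 2) (at t) \<and>
          ((\<lambda>t. z t $ 2) has_real_derivative - \<epsilon> * a t * z t $ 1) (at t))"
  by (simp add: linear_system_solution_def has_vector_derivative_vec2 hill_matrix_def
      matrix_vector_mult_def sum_2)

text \<open>\<open>\<nu>\<close> times \<open>J2\<close>, the oscillator with Hamiltonian
  \<open>\<nu> * (w \<bullet> w) / 2\<close>; its flow is rotation by the angle
  \<open>\<nu> * t\<close>.\<close>

definition rotation_generator :: "real \<Rightarrow> real ^ 2 ^ 2" where
  "rotation_generator \<nu> = vector [vector [0, \<nu>], vector [- \<nu>, 0]]"

lemma rotation_linear_system_iff:
  "linear_system_solution (\<lambda>t. rotation_generator \<nu>) z \<longleftrightarrow>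
     (\<forall>t. ((\<lambda>t. z t $ 1) has_real_derivative \<nu> * z t $ 2) (at t) \<and>
          ((\<lambda>t. z t $ 2) has_real_derivative - \<nu> * z t $ 1) (at t))"
  by (simp add: linear_system_solution_def has_vector_derivative_vec2 rotation_generator_def
      matrix_vector_mult_def sum_2)

lemma hamiltonian_rotation_generator: "hamiltonian_matrix (rotation_generator \<nu>)"
  unfolding hamiltonian_matrix_def
  by (rule exI[of _ "mat \<nu>"])
     (simp add: rotation_generator_def J2_def vec_eq_iff forall_2 matrix_matrix_mult_def sum_2 mat_def transpose_def)

lemma eigenvalues_rotation_generator:
  assumes "\<nu> \<noteq> 0"
  shows "complex_eigenvalues (rotation_generator \<nu>) = {\<i> * of_real \<nu>, - (\<i> * of_real \<nu>)}"
proof (intro equalityI subsetI)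
  fix \<mu> assume "\<mu> \<in> complex_eigenvalues (rotation_generator \<nu>)"
  then obtain v :: "complex ^ 2" where v: "v \<noteq> 0" "(\<chi> i j. complex_of_real (rotation_generator \<nu> $ i $ j)) *v v = \<mu> *s v"
    by (auto simp: complex_eigenvalues_def)
  then have e: "of_real \<nu> * v $ 2 = \<mu> * v $ 1" "- of_real \<nu> * v $ 1 = \<mu> * v $ 2"
    by (simp_all add: rotation_generator_def vec_eq_iff forall_2 matrix_vector_mult_def sum_2)
  have "(\<mu>\<^sup>2 + (of_real \<nu>)\<^sup>2) * v $ 1 = \<mu> * (\<mu> * v $ 1) - of_real \<nu> * (- of_real \<nu> * v $ 1)"
    by (simp add: algebra_simps power2_eq_square)
  also have "\<dots> = 0" unfolding e(2) e(1)[symmetric] by (simp add: algebra_simps)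
  finally have 1: "(\<mu>\<^sup>2 + (of_real \<nu>)\<^sup>2) * v $ 1 = 0" .
  have "v $ 1 \<noteq> 0"
  proof
    assume "v $ 1 = 0"
    then have "v $ 2 = 0" using e(1) assms by simp
    then show False using v(1) \<open>v $ 1 = 0\<close> by (simp add: vec_eq_iff forall_2)
  qed
  then have "\<mu>\<^sup>2 = (\<i> * of_real \<nu>)\<^sup>2" using 1 by (simp add: power_mult_distrib eq_neg_iff_add_eq_0)
  then show "\<mu> \<in> {\<i> * of_real \<nu>, - (\<i> * of_real \<nu>)}" by (simp add: power2_eq_iff)
next
  fix \<mu> assume "\<mu> \<in> {\<i> * of_real \<nu>, - (\<i> * of_real \<nu>)}"
  then have \<mu>: "\<mu> * \<mu> = - (of_real \<nu> * of_real \<nu>)" by (auto simp: algebra_simps)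
  define v :: "complex ^ 2" where "v = vector [of_real \<nu>, \<mu>]"
  have "v \<noteq> 0" using assms by (simp add: v_def vec_eq_iff forall_2)
  moreover have "(\<chi> i j. complex_of_real (rotation_generator \<nu> $ i $ j)) *v v = \<mu> *s v"
    using \<mu> by (simp add: v_def rotation_generator_def vec_eq_iff forall_2 matrix_vector_mult_def sum_2)
  ultimately show "\<mu> \<in> complex_eigenvalues (rotation_generator \<nu>)" by (auto simp: complex_eigenvalues_def)
qed

text \<open>\<open>(q + \<i> r) exp (\<i> \<nu> t)\<close> solves Hill's equation with derivative \<open>(s + \<i> u) exp (\<i> \<nu> t)\<close>, and
  \<open>\<kappa>\<close> is the Wronskian.\<close>

locale floquet_frame =
  fixes a q r s u :: "real \<Rightarrow> real" and \<epsilon> \<nu> \<kappa> :: real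
  assumes dq: "(q has_real_derivative s t + \<nu> * r t) (at t)"
    and dr: "(r has_real_derivative u t - \<nu> * q t) (at t)"
    and ds: "(s has_real_derivative - \<epsilon> * a t * q t + \<nu> * u t) (at t)"
    and du: "(u has_real_derivative - \<epsilon> * a t * r t - \<nu> * s t) (at t)"
    and wronskian: "q t * u t - r t * s t = \<kappa>" and \<kappa>: "0 < \<kappa>"
begin

text \<open>The columns come from the real and imaginary parts of the Floquet factors, so the frame
  is real. In dimension two symplectic means determinant 1, which division by
  \<open>sqrt \<kappa>\<close> achieves.\<close>

definition frame :: "real \<Rightarrow> real ^ 2 ^ 2" where
  "frame t = vector [vector [q t / sqrt \<kappa>, r t / sqrt \<kappa>], vector [s t / sqrt \<kappa>, u t / sqrt \<kappa>]]"

lemma frame_symplectic: "transpose (frame t) ** J2 ** frame t = J2"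
proof -
  have "q t * u t / \<kappa> - r t * s t / \<kappa> = 1" using wronskian[of t] \<kappa> by (simp add: diff_divide_distrib[symmetric])
  then show ?thesis
    using \<kappa>
    by (simp add: frame_def J2_def vec_eq_iff forall_2 matrix_matrix_mult_def transpose_def sum_2 algebra_simps)
qed

lemma frame_mult: "(frame t *v w) $ 1 = (q t * w $ 1 + r t * w $ 2) / sqrt \<kappa>"
  "(frame t *v w) $ 2 = (s t * w $ 1 + u t * w $ 2) / sqrt \<kappa>"
  by (simp_all add: frame_def matrix_vector_mult_def sum_2 add_divide_distrib)

text \<open>Cramer's rule: the two expressions are the coordinates of \<open>(x, y)\<close> in the
  frame, divided by \<open>sqrt \<kappa>\<close>. In these coordinates every solution rotates with
  speed \<open>\<nu>\<close>.\<close>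

lemma coordinates_derivative:
  assumes "(x has_real_derivative y t) (at t)" "(y has_real_derivative - \<epsilon> * a t * x t) (at t)"
  shows "((\<lambda>t. (u t * x t - r t * y t) / \<kappa>) has_real_derivative \<nu> * ((q t * y t - s t * x t) / \<kappa>)) (at t)"
    "((\<lambda>t. (q t * y t - s t * x t) / \<kappa>) has_real_derivative - \<nu> * ((u t * x t - r t * y t) / \<kappa>)) (at t)"
proof -
  have "((\<lambda>t. u t * x t - r t * y t) has_real_derivative \<nu> * (q t * y t - s t * x t)) (at t)"
    by (rule derivative_eq_intros assms dq dr ds du refl)+ (simp add: algebra_simps)
  from DERIV_cdivide[OF this, of \<kappa>]
  show "((\<lambda>t. (u t * x t - r t * y t) / \<kappa>) has_real_derivative \<nu> * ((q t * y t - s t * x t) / \<kappa>)) (at t)" by simp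
  have "((\<lambda>t. q t * y t - s t * x t) has_real_derivative - \<nu> * (u t * x t - r t * y t)) (at t)"
    by (rule derivative_eq_intros assms dq dr ds du refl)+ (simp add: algebra_simps)
  from DERIV_cdivide[OF this, of \<kappa>]
  show "((\<lambda>t. (q t * y t - s t * x t) / \<kappa>) has_real_derivative - \<nu> * ((u t * x t - r t * y t) / \<kappa>)) (at t)" by simp
qed

lemma coordinates: "q t * ((u t * x - r t * y) / \<kappa>) + r t * ((q t * y - s t * x) / \<kappa>) = x"
proof -
  have "q t * (u t * x - r t * y) + r t * (q t * y - s t * x) = (q t * u t - r t * s t) * x"
    by (simp add: algebra_simps)
  then show ?thesis using \<kappa> wronskian[of t] by (simp add: add_divide_distrib[symmetric])
qed

lemma frame_reduces:
  "linear_system_solution (hill_matrix a \<epsilon>) (\<lambda>t. frame t *v w t) \<longleftrightarrow>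
   linear_system_solution (\<lambda>t. rotation_generator \<nu>) w"
proof
  assume "linear_system_solution (\<lambda>t. rotation_generator \<nu>) w"
  then have w: "((\<lambda>t. w t $ 1) has_real_derivative \<nu> * w t $ 2) (at t)"
    "((\<lambda>t. w t $ 2) has_real_derivative - \<nu> * w t $ 1) (at t)" for t
    by (auto simp: rotation_linear_system_iff)
  have n: "((\<lambda>t. q t * w t $ 1 + r t * w t $ 2) has_real_derivative s t * w t $ 1 + u t * w t $ 2) (at t)"
    "((\<lambda>t. s t * w t $ 1 + u t * w t $ 2) has_real_derivative - \<epsilon> * a t * (q t * w t $ 1 + r t * w t $ 2)) (at t)" for t
    by ((rule derivative_eq_intros w dq dr ds du refl)+, simp add: algebra_simps)+
  have "((\<lambda>t. (q t * w t $ 1 + r t * w t $ 2) / sqrt \<kappa>) has_real_derivative (s t * w t $ 1 + u t * w t $ 2) / sqrt \<kappa>) (at t)"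
    "((\<lambda>t. (s t * w t $ 1 + u t * w t $ 2) / sqrt \<kappa>) has_real_derivative
      - \<epsilon> * a t * ((q t * w t $ 1 + r t * w t $ 2) / sqrt \<kappa>)) (at t)" for t
    using DERIV_cdivide[OF n(1)[of t], of "sqrt \<kappa>"] DERIV_cdivide[OF n(2)[of t], of "sqrt \<kappa>"] by simp_all
  then show "linear_system_solution (hill_matrix a \<epsilon>) (\<lambda>t. frame t *v w t)"
    by (simp add: hill_linear_system_iff frame_mult)
next
  assume "linear_system_solution (hill_matrix a \<epsilon>) (\<lambda>t. frame t *v w t)"
  then have z: "((\<lambda>t. (q t * w t $ 1 + r t * w t $ 2) / sqrt \<kappa>) has_real_derivative (s t * w t $ 1 + u t * w t $ 2) / sqrt \<kappa>) (at t)"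
    "((\<lambda>t. (s t * w t $ 1 + u t * w t $ 2) / sqrt \<kappa>) has_real_derivative
      - \<epsilon> * a t * ((q t * w t $ 1 + r t * w t $ 2) / sqrt \<kappa>)) (at t)" for t
    by (simp_all add: hill_linear_system_iff frame_mult)
  have inv: "u t * (q t * x + r t * y) - r t * (s t * x + u t * y) = \<kappa> * x"
    "q t * (s t * x + u t * y) - s t * (q t * x + r t * y) = \<kappa> * y" for t x y
    unfolding wronskian[of t, symmetric] by (simp_all add: algebra_simps)
  \<comment> \<open>The coordinates are normalized with \<open>\<kappa>\<close> and the frame with
    \<open>sqrt \<kappa>\<close>, so what comes back is \<open>w\<close> divided by
    \<open>sqrt \<kappa>\<close>.\<close>
  have w: "(u t * ((q t * w t $ 1 + r t * w t $ 2) / sqrt \<kappa>) - r t * ((s t * w t $ 1 + u t * w t $ 2) / sqrt \<kappa>)) / \<kappa> = w t $ 1 / sqrt \<kappa>"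
    "(q t * ((s t * w t $ 1 + u t * w t $ 2) / sqrt \<kappa>) - s t * ((q t * w t $ 1 + r t * w t $ 2) / sqrt \<kappa>)) / \<kappa> = w t $ 2 / sqrt \<kappa>" for t
    using inv[of t "w t $ 1" "w t $ 2"] \<kappa> by (simp_all add: diff_divide_distrib[symmetric])
  have d: "((\<lambda>t. w t $ 1 / sqrt \<kappa>) has_real_derivative \<nu> * (w t $ 2 / sqrt \<kappa>)) (at t)"
    "((\<lambda>t. w t $ 2 / sqrt \<kappa>) has_real_derivative - \<nu> * (w t $ 1 / sqrt \<kappa>)) (at t)" for t
    using coordinates_derivative[OF z(1)[of t] z(2)[of t]] unfolding w by blast+
  have "((\<lambda>t. w t $ 1) has_real_derivative \<nu> * w t $ 2) (at t)" "((\<lambda>t. w t $ 2) has_real_derivative - \<nu> * w t $ 1) (at t)" for t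
    using DERIV_cmult[OF d(1)[of t], of "sqrt \<kappa>"] DERIV_cmult[OF d(2)[of t], of "sqrt \<kappa>"] \<kappa> by simp_all
  then show "linear_system_solution (\<lambda>t. rotation_generator \<nu>) w" by (simp add: rotation_linear_system_iff)
qed

lemma hill_solution_form:
  assumes "hill_solution a \<epsilon> x"
  obtains C D where "\<And>t. x t = q t * (C * cos (\<nu> * t) + D * sin (\<nu> * t)) + r t * (D * cos (\<nu> * t) - C * sin (\<nu> * t))"
proof -
  obtain y x'' where *: "\<forall>t. (x has_real_derivative y t) (at t) \<and> (y has_real_derivative x'' t) (at t) \<and> x'' t + \<epsilon> * a t * x t = 0"
    using assms unfolding hill_solution_def by blast
  have y: "\<And>t. (x has_real_derivative y t) (at t)" "\<And>t. (y has_real_derivative - \<epsilon> * a t * x t) (at t)"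
  proof -
    fix t
    show "(x has_real_derivative y t) (at t)" using * by blast
    have "x'' t = - \<epsilon> * a t * x t" using *[rule_format, of t] by simp
    then show "(y has_real_derivative - \<epsilon> * a t * x t) (at t)" using *[rule_format, of t] by metis
  qed
  define w1 where "w1 t = (u t * x t - r t * y t) / \<kappa>" for t
  define w2 where "w2 t = (q t * y t - s t * x t) / \<kappa>" for t
  have d: "(w1 has_real_derivative \<nu> * w2 t) (at t)" "(w2 has_real_derivative - \<nu> * w1 t) (at t)" for t
    using coordinates_derivative[OF y(1)[of t] y(2)[of t]] by (simp_all add: w1_def[abs_def] w2_def[abs_def])
  \<comment> \<open>Rotating the coordinates back by \<open>\<nu> * t\<close> gives constants; these
    initial values \<open>w1 0\<close> and \<open>w2 0\<close> become \<open>C\<close> and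
    \<open>D\<close>.\<close>
  have "((\<lambda>t. w1 t * cos (\<nu> * t) - w2 t * sin (\<nu> * t)) has_real_derivative 0) (at t)"
    "((\<lambda>t. w1 t * sin (\<nu> * t) + w2 t * cos (\<nu> * t)) has_real_derivative 0) (at t)" for t
    by ((rule derivative_eq_intros d refl)+, simp add: algebra_simps)+
  then have c: "w1 t * cos (\<nu> * t) - w2 t * sin (\<nu> * t) = w1 0" "w1 t * sin (\<nu> * t) + w2 t * cos (\<nu> * t) = w2 0" for t
    using DERIV_isconst_all[of "\<lambda>t. w1 t * cos (\<nu> * t) - w2 t * sin (\<nu> * t)" t 0]
      DERIV_isconst_all[of "\<lambda>t. w1 t * sin (\<nu> * t) + w2 t * cos (\<nu> * t)" t 0] by simp_all
  have rot: "A * (cc * cc) + A * (ss * ss) = A" if "cc\<^sup>2 + ss\<^sup>2 = 1" for A cc ss :: real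
    using that by (simp add: power2_eq_square distrib_left[symmetric])
  have w: "w1 t = w1 0 * cos (\<nu> * t) + w2 0 * sin (\<nu> * t)" "w2 t = w2 0 * cos (\<nu> * t) - w1 0 * sin (\<nu> * t)" for t
    unfolding c[of t, symmetric] using rot[of "cos (\<nu> * t)" "sin (\<nu> * t)"]
    by (simp_all add: algebra_simps)
  have "x t = q t * w1 t + r t * w2 t" for t
    using coordinates[of t "x t" "y t"] by (simp add: w1_def w2_def)
  then show thesis using that[of "w1 0" "w2 0"] w by metis
qed

end

context torus_flow
begin

lemma wiener_Re:
  assumes "wiener \<sigma> M f" "0 \<le> \<sigma>" shows "wiener \<sigma> M (\<lambda>t. of_real (Re (f t)))"
proof -
  have "(\<lambda>t. complex_of_real (Re (f t))) = (\<lambda>t. (1 / 2) * (f t + cnj (f t)))"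
    by (simp add: fun_eq_iff complex_eq_iff)
  then show ?thesis
    using wiener_cmult[OF wiener_add[OF assms(1) wiener_cnj[OF assms(1)] assms(2)] assms(2), of "1 / 2"] by simp
qed

lemma wiener_Im:
  assumes "wiener \<sigma> M f" "0 \<le> \<sigma>" shows "wiener \<sigma> M (\<lambda>t. of_real (Im (f t)))"
proof -
  have "(\<lambda>t. complex_of_real (Im (f t))) = (\<lambda>t. of_real (Re (- \<i> * f t)))" by simp
  then show ?thesis using wiener_Re[OF wiener_cmult[OF assms, of "- \<i>"] assms(2)] by simp
qed

text \<open>Decay at rate \<open>\<rho>\<close> leaves
  \<open>exp (- (\<rho> - \<sigma>) * index_len k)\<close> after weighting with
  \<open>\<sigma>\<close>, and this is summable over the lattice; hence the strict
  inequality.\<close>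

lemma analytic_quasi_periodic_imp_wiener:
  assumes f: "analytic_quasi_periodic \<rho> \<omega> f" and \<rho>: "0 < \<rho>" and \<sigma>: "\<sigma> < \<rho>"
  obtains A where "wiener \<sigma> A (\<lambda>t. of_real (f t))"
proof -
  obtain F :: "complex ^ 'i \<Rightarrow> complex" where F: "analytic_several_on F (strip \<rho>)"
    "\<And>\<theta> j. \<theta> \<in> strip \<rho> \<Longrightarrow> F (\<theta> + axis j (of_real (2 * pi))) = F \<theta>"
    "\<And>t. complex_of_real (f t) = F (\<chi> j. of_real (\<omega> $ j * t))"
    using f by (auto simp: analytic_quasi_periodic_def)
  obtain c M where decay: "\<And>k. cmod (c k) \<le> M * exp (- \<rho> * index_len k)"
    and exp: "\<And>\<theta>. \<theta> \<in> strip 0 \<Longrightarrow> ((\<lambda>k. c k * fourier_mode k \<theta>) has_sum F \<theta>) UNIV"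
    using fourier_expansion[OF \<rho> F(1,2)] by blast
  define e :: "nat \<Rightarrow> int ^ 'i" where "e = from_nat_into UNIV"
  have e: "bij_betw e UNIV UNIV"
    unfolding e_def by (rule bij_betw_from_nat_into[OF _ infinite_UNIV_vec[OF infinite_UNIV_int]]) simp
  define u where "u k = cmod (c k) * exp (\<sigma> * index_len k)" for k
  have "u summable_on UNIV"
  proof (rule summable_on_comparison_test[OF summable_on_cmult_right[OF summable_exp_index_len[of "\<rho> - \<sigma>"], of M]])
    show "u k \<le> M * exp (- (\<rho> - \<sigma>) * index_len k)" for k
    proof -
      have "u k \<le> M * exp (- \<rho> * index_len k) * exp (\<sigma> * index_len k)"
        unfolding u_def by (rule mult_right_mono[OF decay]) simp
      also have "\<dots> = M * exp (- (\<rho> - \<sigma>) * index_len k)"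
        by (simp add: exp_add[symmetric] algebra_simps)
      finally show ?thesis .
    qed
  qed (use \<sigma> in \<open>auto simp: u_def\<close>)
  then have "((\<lambda>n. u (e n)) has_sum infsum u UNIV) UNIV"
    unfolding has_sum_reindex_bij_betw[OF e, of u] by (rule has_sum_infsum)
  then have "fourier_rep \<sigma> (\<lambda>n. c (e n)) e (infsum u UNIV) (\<lambda>t. of_real (f t))"
  proof (rule fourier_repI)
    fix t
    have "(\<chi> j. complex_of_real (\<omega> $ j * t)) \<in> strip 0" by (simp add: strip_def)
    from exp[OF this]
    show "((\<lambda>n. c (e n) * cis ((\<Sum>j\<in>UNIV. of_int (e n $ j) * \<omega> $ j) * t)) has_sum of_real (f t)) UNIV"
      unfolding F(3) fourier_mode_flow
        has_sum_reindex_bij_betw[OF e, of "\<lambda>k. c k * cis ((\<Sum>j\<in>UNIV. of_int (k $ j) * \<omega> $ j) * t)"] .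
  qed (auto simp: u_def)
  then show thesis using that unfolding wiener_def by blast
qed

end

lemma has_average_imp_has_mean:
  assumes a: "has_average a m" and c: "continuous_on UNIV (\<lambda>t. complex_of_real (a t))"
  shows "has_mean (\<lambda>t. of_real (a t)) (of_real m)"
proof -
  have ca: "continuous_on UNIV a" using continuous_on_Re[OF c] by simp
  have "integral {-T..T} (\<lambda>t. complex_of_real (a t)) = of_real (integral {-T..T} a)" for T
  proof -
    have "a integrable_on {-T..T}" by (rule integrable_continuous_real) (rule continuous_on_subset[OF ca], simp)
    from integral_linear[OF this bounded_linear_of_real[where 'a = complex]] show ?thesis by (simp add: o_def)
  qed
  then have "integral {-T..T} (\<lambda>t. complex_of_real (a t)) / of_real (2 * T) =
      of_real (1 / (2 * T) * integral {-T..T} a)" for T by simp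
  moreover have "((\<lambda>T. complex_of_real (1 / (2 * T) * integral {-T..T} a)) \<longlongrightarrow> of_real m) at_top"
    using a unfolding has_average_def by (rule tendsto_of_real)
  ultimately show ?thesis unfolding has_mean_def by (simp only:)
qed

section \<open>Floquet solutions over the torus, the reduction and the general solution\<close>

locale torus_hill = hill_frequency_group "\<lambda>k. \<Sum>j\<in>UNIV. of_int (k $ j) * \<omega> $ j" index_len a abar \<sigma>\<^sub>0 A \<gamma> m
  for \<omega> :: "real ^ 'i::finite" and a abar \<sigma>\<^sub>0 A \<gamma> m
begin

sublocale torus_flow \<omega>
  by unfold_locales

context
  fixes \<nu> \<epsilon> \<sigma> M N :: real and w v :: "real \<Rightarrow> complex"
  assumes fl: "approx_floquet \<nu> (of_real \<epsilon>) (\<lambda>t. 0) w v" and \<sigma>: "0 < \<sigma>"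
    and w: "wiener \<sigma> M w" and v: "wiener \<sigma> N v" and \<nu>: "0 < \<nu>" "N \<le> \<nu> / 2"
begin

text \<open>The Floquet solution of Hill's equation is \<open>cis (\<nu> * t)\<close> times this
  factor.\<close>

definition floquet_factor :: "real \<Rightarrow> complex" where
  "floquet_factor t = exp (w t)"

text \<open>Not the derivative of \<open>floquet_factor\<close>, but what is left when
  \<open>cis (\<nu> * t)\<close> is split off the derivative of the solution.\<close>

definition floquet_factor' :: "real \<Rightarrow> complex" where
  "floquet_factor' t = (\<i> * of_real \<nu> + v t) * floquet_factor t"

lemma wiener_floquet_factor: "wiener \<sigma> (exp M) floquet_factor"
  unfolding floquet_factor_def[abs_def] using wiener_exp[OF w] \<sigma> by simp

lemma wiener_floquet_factor': "wiener \<sigma> ((cmod (\<i> * of_real \<nu>) + N) * exp M) floquet_factor'"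
  unfolding floquet_factor'_def[abs_def]
  using wiener_mult[OF wiener_add[OF wiener_const v] wiener_floquet_factor] \<sigma> by simp

lemma floquet_factor_derivative:
  "(floquet_factor has_vector_derivative floquet_factor' t - \<i> * of_real \<nu> * floquet_factor t) (at t)"
proof -
  have "(w has_vector_derivative v t) (at t)" using fl by (simp add: approx_floquet_def)
  from has_vector_derivative_exp[OF this, of 1] show ?thesis
    by (simp add: floquet_factor_def[abs_def] floquet_factor'_def algebra_simps)
qed

lemma floquet_factor'_derivative:
  "(floquet_factor' has_vector_derivative
     - of_real (\<epsilon> * a t) * floquet_factor t - \<i> * of_real \<nu> * floquet_factor' t) (at t)"
proof -
  have "(v has_vector_derivative 0 - 2 * \<i> * of_real \<nu> * v t - (v t)\<^sup>2 + (of_real \<nu>)\<^sup>2 - of_real \<epsilon> * of_real (a t)) (at t)"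
    using fl by (simp add: approx_floquet_def)
  from has_vector_derivative_mult[OF has_vector_derivative_add[OF has_vector_derivative_const[of "\<i> * of_real \<nu>"] this] floquet_factor_derivative]
  show ?thesis
    by (simp add: floquet_factor'_def[abs_def] algebra_simps power2_eq_square)
qed

lemma floquet_factor_wronskian:
  "Re (floquet_factor t) * Im (floquet_factor' t) - Im (floquet_factor t) * Re (floquet_factor' t) =
     (\<nu> + Im (v t)) * (cmod (floquet_factor t))\<^sup>2"
  unfolding cmod_power2 floquet_factor'_def by (simp add: algebra_simps power2_eq_square)

text \<open>The assumption \<open>N \<le> \<nu> / 2\<close> enters here: it keeps the Wronskian
  positive, so the real and imaginary parts of the solution are independent.\<close>

lemma Im_v: "\<nu> / 2 \<le> \<nu> + Im (v t)"
  using wiener_bound[OF v, of t] abs_Im_le_cmod[of "v t"] \<sigma> \<nu> by simp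

lemma floquet_frame_exists:
  obtains \<kappa> where "floquet_frame a (\<lambda>t. Re (floquet_factor t)) (\<lambda>t. Im (floquet_factor t))
    (\<lambda>t. Re (floquet_factor' t)) (\<lambda>t. Im (floquet_factor' t)) \<epsilon> \<nu> \<kappa>"
proof -
  define \<kappa> where "\<kappa> = (\<nu> + Im (v 0)) * (cmod (floquet_factor 0))\<^sup>2"
  have re: "((\<lambda>t. Re (f t)) has_real_derivative Re f') (at t)" and im: "((\<lambda>t. Im (f t)) has_real_derivative Im f') (at t)"
    if "(f has_vector_derivative f') (at t)" for f f' t
    unfolding has_real_derivative_iff_has_vector_derivative
    using bounded_linear.has_vector_derivative[OF bounded_linear_Re that]
      bounded_linear.has_vector_derivative[OF bounded_linear_Im that] by blast+
  have dq: "((\<lambda>t. Re (floquet_factor t)) has_real_derivative Re (floquet_factor' t) + \<nu> * Im (floquet_factor t)) (at t)"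
    and dr: "((\<lambda>t. Im (floquet_factor t)) has_real_derivative Im (floquet_factor' t) - \<nu> * Re (floquet_factor t)) (at t)"
    and ds: "((\<lambda>t. Re (floquet_factor' t)) has_real_derivative - \<epsilon> * a t * Re (floquet_factor t) + \<nu> * Im (floquet_factor' t)) (at t)"
    and du: "((\<lambda>t. Im (floquet_factor' t)) has_real_derivative - \<epsilon> * a t * Im (floquet_factor t) - \<nu> * Re (floquet_factor' t)) (at t)"
    for t
    using re[OF floquet_factor_derivative[of t]] im[OF floquet_factor_derivative[of t]]
      re[OF floquet_factor'_derivative[of t]] im[OF floquet_factor'_derivative[of t]] by simp_all
  have "((\<lambda>t. Re (floquet_factor t) * Im (floquet_factor' t) - Im (floquet_factor t) * Re (floquet_factor' t)) has_real_derivative 0) (at t)" for t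
    by ((rule derivative_eq_intros dq dr ds du refl)+) (simp add: algebra_simps)
  then have "Re (floquet_factor t) * Im (floquet_factor' t) - Im (floquet_factor t) * Re (floquet_factor' t) = \<kappa>" for t
    unfolding \<kappa>_def floquet_factor_wronskian[of 0, symmetric]
    using DERIV_isconst_all[of "\<lambda>t. Re (floquet_factor t) * Im (floquet_factor' t) - Im (floquet_factor t) * Re (floquet_factor' t)" t 0]
    by blast
  moreover have "0 < \<kappa>"
    using Im_v[of 0] \<nu> unfolding \<kappa>_def by (intro mult_pos_pos) (auto simp: floquet_factor_def)
  ultimately have "floquet_frame a (\<lambda>t. Re (floquet_factor t)) (\<lambda>t. Im (floquet_factor t))
    (\<lambda>t. Re (floquet_factor' t)) (\<lambda>t. Im (floquet_factor' t)) \<epsilon> \<nu> \<kappa>"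
    by unfold_locales (use dq dr ds du in auto)
  then show thesis by (rule that)
qed

lemma floquet_reduced: "reduced_to \<omega> (hill_matrix a \<epsilon>) (rotation_generator \<nu>)"
proof -
  obtain \<kappa> where "floquet_frame a (\<lambda>t. Re (floquet_factor t)) (\<lambda>t. Im (floquet_factor t))
    (\<lambda>t. Re (floquet_factor' t)) (\<lambda>t. Im (floquet_factor' t)) \<epsilon> \<nu> \<kappa>" by (rule floquet_frame_exists)
  then interpret F: floquet_frame a "\<lambda>t. Re (floquet_factor t)" "\<lambda>t. Im (floquet_factor t)"
    "\<lambda>t. Re (floquet_factor' t)" "\<lambda>t. Im (floquet_factor' t)" \<epsilon> \<nu> \<kappa> .
  have \<sigma>0: "0 \<le> \<sigma>" using \<sigma> by simp
  have scaled: "analytic_quasi_periodic (\<sigma> / 4) \<omega> (\<lambda>t. f t / sqrt \<kappa>)" if "wiener \<sigma> M' (\<lambda>t. of_real (f t))" for f M'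
    by (rule wiener_imp_analytic_quasi_periodic[OF _ \<sigma>])
       (use wiener_cmult[OF that \<sigma>0, of "of_real (1 / sqrt \<kappa>)"] in simp)
  have "analytic_quasi_periodic_matrix (\<sigma> / 4) \<omega> F.frame"
    unfolding analytic_quasi_periodic_matrix_def forall_2 F.frame_def
    using scaled[OF wiener_Re[OF wiener_floquet_factor \<sigma>0]] scaled[OF wiener_Im[OF wiener_floquet_factor \<sigma>0]]
      scaled[OF wiener_Re[OF wiener_floquet_factor' \<sigma>0]] scaled[OF wiener_Im[OF wiener_floquet_factor' \<sigma>0]]
    by simp
  moreover have "0 < \<sigma> / 4" using \<sigma> by simp
  ultimately show ?thesis
    unfolding reduced_to_def
    using hamiltonian_rotation_generator F.frame_symplectic F.frame_reduces by blast
qed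

lemma hill_solution_quasi_periodic:
  assumes "hill_solution a \<epsilon> x"
  shows "quasi_periodic (append_frequency \<omega> \<nu>) x"
proof -
  obtain \<kappa> where "floquet_frame a (\<lambda>t. Re (floquet_factor t)) (\<lambda>t. Im (floquet_factor t))
    (\<lambda>t. Re (floquet_factor' t)) (\<lambda>t. Im (floquet_factor' t)) \<epsilon> \<nu> \<kappa>" by (rule floquet_frame_exists)
  then interpret F: floquet_frame a "\<lambda>t. Re (floquet_factor t)" "\<lambda>t. Im (floquet_factor t)"
    "\<lambda>t. Re (floquet_factor' t)" "\<lambda>t. Im (floquet_factor' t)" \<epsilon> \<nu> \<kappa> .
  obtain C D where x: "\<And>t. x t = Re (floquet_factor t) * (C * cos (\<nu> * t) + D * sin (\<nu> * t)) +
      Im (floquet_factor t) * (D * cos (\<nu> * t) - C * sin (\<nu> * t))"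
    using F.hill_solution_form[OF assms] by blast
  obtain P :: "real ^ 'i \<Rightarrow> complex" where P: "continuous_on UNIV P"
    "\<And>\<theta> j. P (\<theta> + axis j (2 * pi)) = P \<theta>" "\<And>t. floquet_factor t = P (\<chi> j. \<omega> $ j * t)"
    using wiener_hull[OF wiener_floquet_factor] \<sigma> by (metis less_imp_le)
  \<comment> \<open>The hull has one more angle: the coordinate \<open>None\<close> carries
    \<open>\<nu> * t\<close>, the others carry the hull \<open>P\<close> of the Floquet
    factor.\<close>
  define \<pi> :: "real ^ ('i option) \<Rightarrow> real ^ 'i" where "\<pi> \<theta> = (\<chi> j. \<theta> $ Some j)" for \<theta>
  define H where "H \<theta> = Re (P (\<pi> \<theta>)) * (C * cos (\<theta> $ None) + D * sin (\<theta> $ None)) +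
      Im (P (\<pi> \<theta>)) * (D * cos (\<theta> $ None) - C * sin (\<theta> $ None))" for \<theta>
  have c\<pi>: "continuous_on UNIV \<pi>" unfolding \<pi>_def by (intro continuous_intros)
  have cP: "continuous_on UNIV (\<lambda>\<theta>. P (\<pi> \<theta>))" by (rule continuous_on_compose2[OF P(1) c\<pi>]) simp
  have "continuous_on UNIV H" unfolding H_def by (intro continuous_intros cP)
  moreover have "H (\<theta> + axis j (2 * pi)) = H \<theta>" for \<theta> j
  proof (cases j)
    case None
    then have "\<pi> (\<theta> + axis j (2 * pi)) = \<pi> \<theta>" by (simp add: \<pi>_def vec_eq_iff axis_def)
    then show ?thesis using None by (simp add: H_def)
  next
    case (Some i)
    then have "\<pi> (\<theta> + axis j (2 * pi)) = \<pi> \<theta> + axis i (2 * pi)" by (auto simp: \<pi>_def vec_eq_iff axis_def)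
    moreover have "(\<theta> + axis j (2 * pi)) $ None = \<theta> $ None" using Some by (simp add: axis_def)
    ultimately show ?thesis unfolding H_def by (simp only: P(2))
  qed
  moreover have "x t = H (\<chi> j. append_frequency \<omega> \<nu> $ j * t)" for t
  proof -
    have "\<pi> (\<chi> j. append_frequency \<omega> \<nu> $ j * t) = (\<chi> j. \<omega> $ j * t)"
      by (simp add: \<pi>_def append_frequency_def vec_eq_iff)
    then show ?thesis by (simp add: x H_def P(3) append_frequency_def)
  qed
  ultimately show ?thesis unfolding quasi_periodic_def by blast
qed

end

end

section \<open>Diophantine frequencies and the choice of the constants\<close>

lemma index_len_ge_1:
  assumes "k \<noteq> 0" shows "1 \<le> index_len k"
proof -
  obtain j where "k $ j \<noteq> 0" using assms by (auto simp: vec_eq_iff)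
  then have "1 \<le> \<bar>real_of_int (k $ j)\<bar>" by linarith
  then show ?thesis using component_le_index_len[of k j] by simp
qed

lemma index_len_triangle: "index_len (k + l) \<le> index_len k + index_len l"
  unfolding index_len_def of_int_add[symmetric] of_int_le_iff sum.distrib[symmetric]
  by (intro sum_mono) simp

theorem theorem4p4:
  fixes \<omega> :: "real ^ 'r" and a :: "real \<Rightarrow> real" and abar \<rho> \<alpha> \<tau> :: real
  assumes "\<rho> > 0"
    and "analytic_quasi_periodic \<rho> \<omega> a"
    and "has_average a abar" and "abar > 0"
    and "\<alpha> > 0" and "\<tau> > real CARD('r) - 1"
    and "diophantine \<omega> \<alpha> \<tau>"
  shows "\<exists>(G :: real set) (b :: real \<Rightarrow> real).
     G \<subseteq> {0<..} \<and> for_most_small (\<lambda>\<epsilon>. \<epsilon> \<in> G) \<and>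
     (\<forall>\<epsilon>\<in>G. b \<epsilon> > 0 \<and>
        (\<exists>B. reduced_to \<omega> (hill_matrix a \<epsilon>) B \<and>
             complex_eigenvalues B = {\<i> * of_real (sqrt (b \<epsilon>)), - (\<i> * of_real (sqrt (b \<epsilon>)))}) \<and>
        (\<forall>x. hill_solution a \<epsilon> x \<longrightarrow> quasi_periodic (append_frequency \<omega> (sqrt (b \<epsilon>))) x)) \<and>
     (\<lambda>\<epsilon>. b \<epsilon> - abar * \<epsilon>) \<in> O[at 0 within G](\<lambda>\<epsilon>. \<epsilon>\<^sup>2)"
proof -
  define d where "d k = (\<Sum>j\<in>UNIV. of_int (k $ j) * \<omega> $ j)" for k :: "int ^ 'r"
  define T where "T = nat \<lceil>\<tau>\<rceil>"
  define q where "q = 2 * CARD('r)"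
  \<comment> \<open>A resonant interval reaching below \<open>x\<close> belongs to an index of
    length \<open>L\<close> with \<open>1 / L ^ T\<close> of order \<open>x\<close> at most. The
    part \<open>3 * T\<close> then gives its width a factor \<open>x ^ 3\<close>, and the part
    \<open>q\<close> makes the widths summable.\<close>
  define m where "m = 3 * T + q"
  \<comment> \<open>Half of \<open>\<alpha>\<close>: if \<open>\<bar>d k + 2 * \<nu>\<bar>\<close>
    falls below \<open>\<gamma> / L ^ T\<close>, then \<open>2 * \<nu>\<close> must compensate at
    least half of \<open>\<bar>d k\<bar>\<close>, which bounds \<open>L ^ T\<close> from
    below.\<close>
  define \<gamma> where "\<gamma> = \<alpha> / 2"
  have \<gamma>: "0 < \<gamma>" using assms(5) by (simp add: \<gamma>_def)
  have dT: "\<alpha> \<le> \<bar>d k\<bar> * index_len k ^ T" if "k \<noteq> 0" for k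
  proof -
    have L: "1 \<le> index_len k" using that by (rule index_len_ge_1)
    have "\<alpha> / index_len k powr \<tau> \<le> \<bar>d k\<bar>"
      using assms(7) that by (simp add: diophantine_def d_def index_len_def)
    then have "\<alpha> \<le> \<bar>d k\<bar> * index_len k powr \<tau>" using L by (simp add: divide_le_eq)
    also have "\<dots> \<le> \<bar>d k\<bar> * index_len k powr real T"
      using L by (intro mult_left_mono powr_mono) (auto simp: T_def real_nat_ceiling_ge)
    also have "index_len k powr real T = index_len k ^ T" using L by (simp add: powr_realpow)
    finally show ?thesis .
  qed
  have d0: "d k \<noteq> 0" if "k \<noteq> 0" for k using dT[OF that] assms(5) by auto
  have dm: "\<gamma> \<le> \<bar>d k\<bar> * index_len k ^ m" if "k \<noteq> 0" for k
  proof -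
    have L: "1 \<le> index_len k" using that by (rule index_len_ge_1)
    have "\<alpha> \<le> \<bar>d k\<bar> * index_len k ^ T" by (rule dT[OF that])
    also have "\<dots> \<le> \<bar>d k\<bar> * index_len k ^ m" using L by (intro mult_left_mono power_increasing) (auto simp: m_def)
    finally show ?thesis using assms(5) by (simp add: \<gamma>_def)
  qed
  have fg: "frequency_group d index_len"
    by unfold_locales
       (use d0 index_len_triangle in \<open>auto simp: d_def index_len_nonneg ring_distribs sum.distrib index_len_def\<close>)
  then interpret FG: torus_flow \<omega> unfolding torus_flow_def d_def[abs_def] .
  define \<sigma>\<^sub>0 where "\<sigma>\<^sub>0 = min (\<rho> / 2) 1"
  have \<sigma>0: "0 < \<sigma>\<^sub>0" "\<sigma>\<^sub>0 \<le> 1" "\<sigma>\<^sub>0 < \<rho>" using assms(1) by (auto simp: \<sigma>\<^sub>0_def)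
  obtain A where A: "FG.wiener \<sigma>\<^sub>0 A (\<lambda>t. of_real (a t))"
    by (rule FG.analytic_quasi_periodic_imp_wiener[OF assms(2,1) \<sigma>0(3)])
  have am: "has_mean (\<lambda>t. of_real (a t)) (of_real abar)"
    by (rule has_average_imp_has_mean[OF assms(3) FG.wiener_continuous[OF A]]) (use \<sigma>0 in simp)
  interpret H: torus_hill \<omega> a abar \<sigma>\<^sub>0 A \<gamma> m
    by unfold_locales (use A am assms(4) \<sigma>0 \<gamma> dm in \<open>auto simp: d_def\<close>)
  obtain \<nu>\<^sub>1 C where \<nu>1: "0 < \<nu>\<^sub>1" "\<nu>\<^sub>1 \<le> 1" and C: "0 < C"
    and ex: "\<And>\<nu>. H.nonresonant \<nu> \<Longrightarrow> 0 < \<nu> \<Longrightarrow> \<nu> \<le> \<nu>\<^sub>1 \<Longrightarrow>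
      \<exists>\<epsilon> w v. FG.wiener (\<sigma>\<^sub>0 / 2) (C * \<nu>\<^sup>2) w \<and> FG.wiener (\<sigma>\<^sub>0 / 2) (C * \<nu>\<^sup>2) v \<and>
        cmod (\<epsilon> - of_real (\<nu>\<^sup>2 / abar)) \<le> C * \<nu> ^ 4 \<and> H.approx_floquet \<nu> \<epsilon> (\<lambda>t. 0) w v"
    by (rule H.floquet_exists) blast
  \<comment> \<open>The bounds provide, in this order: existence of the Floquet solution, smallness
    of \<open>w\<close> in the Wronskian estimate, positivity of the Wronskian, and comparability of
    the parameter with \<open>\<nu>\<^sup>2\<close>.\<close>
  define \<nu>\<^sub>2 where "\<nu>\<^sub>2 = Min {\<nu>\<^sub>1, H.\<beta>\<^sub>0 / C, 1 / (2 * C), 1 / (2 * abar * C)}"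
  have \<nu>2: "0 < \<nu>\<^sub>2" "\<nu>\<^sub>2 \<le> \<nu>\<^sub>1" "\<nu>\<^sub>2 \<le> H.\<beta>\<^sub>0 / C" "\<nu>\<^sub>2 \<le> 1 / (2 * C)" "\<nu>\<^sub>2 \<le> 1 / (2 * abar * C)"
    using \<nu>1 C assms(4) H.\<beta>\<^sub>0 by (auto simp: \<nu>\<^sub>2_def)
  define e :: "nat \<Rightarrow> int ^ 'r" where "e = from_nat_into UNIV"
  have e: "bij_betw e UNIV UNIV"
    unfolding e_def by (rule bij_betw_from_nat_into[OF _ infinite_UNIV_vec[OF infinite_UNIV_int]]) simp
  \<comment> \<open>Nonresonance means that \<open>\<nu>\<close> keeps distance \<open>r n\<close>
    from the centre \<open>c n = - d (e n) / 2\<close>; the radius 0 at index 0 imposes no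
    condition.\<close>
  define c where "c n = - d (e n) / 2" for n
  define r where "r n = (if e n = 0 then 0 else \<gamma> / (2 * index_len (e n) ^ m))" for n
  define s where "s n = 1 / (1 + index_len (e n)) ^ q" for n
  define N where "N = {\<nu>. 0 < \<nu> \<and> \<nu> \<le> \<nu>\<^sub>2 \<and> (\<forall>n. r n \<le> \<bar>\<nu> - c n\<bar>)}"
  have N\<nu>: "0 < \<nu>" "\<nu> \<le> \<nu>\<^sub>2" "\<nu> \<le> 1" "\<nu> \<le> \<nu>\<^sub>1" if "\<nu> \<in> N" for \<nu> using that \<nu>2 \<nu>1 by (auto simp: N_def)
  have nonres: "H.nonresonant \<nu>" if "\<nu> \<in> N" for \<nu>
    unfolding H.nonresonant_def
  proof (intro allI impI)
    fix k :: "int ^ 'r" assume k: "k \<noteq> 0"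
    obtain n where n: "e n = k" using e by (metis bij_betw_imp_surj_on imageE UNIV_I)
    have p: "0 < index_len k ^ m" using index_len_ge_1[OF k] by simp
    have "r n \<le> \<bar>\<nu> - c n\<bar>" using that by (simp add: N_def)
    then have "\<gamma> / (2 * index_len k ^ m) \<le> \<bar>d k + 2 * \<nu>\<bar> / 2" using k by (simp add: r_def c_def n)
    then have "\<gamma> \<le> \<bar>d k + 2 * \<nu>\<bar> * index_len k ^ m" using p by (simp add: field_simps)
    then show "\<gamma> \<le> \<bar>(\<Sum>j\<in>UNIV. of_int (k $ j) * \<omega> $ j) + 2 * \<nu>\<bar> * index_len k ^ m" by (simp add: d_def)
  qed
  have "\<forall>\<nu>. \<exists>y. \<nu> \<in> N \<longrightarrow> (case y of (\<epsilon>, w, v) \<Rightarrow> FG.wiener (\<sigma>\<^sub>0 / 2) (C * \<nu>\<^sup>2) w \<and> FG.wiener (\<sigma>\<^sub>0 / 2) (C * \<nu>\<^sup>2) v \<and>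
        cmod (\<epsilon> - of_real (\<nu>\<^sup>2 / abar)) \<le> C * \<nu> ^ 4 \<and> H.approx_floquet \<nu> \<epsilon> (\<lambda>t. 0) w v)"
    using ex nonres N\<nu> by (metis (no_types, lifting) case_prodI)
  from choice[OF this] obtain Y where Y: "\<forall>\<nu>. \<nu> \<in> N \<longrightarrow> (case Y \<nu> of (\<epsilon>, w, v) \<Rightarrow>
        FG.wiener (\<sigma>\<^sub>0 / 2) (C * \<nu>\<^sup>2) w \<and> FG.wiener (\<sigma>\<^sub>0 / 2) (C * \<nu>\<^sup>2) v \<and>
        cmod (\<epsilon> - of_real (\<nu>\<^sup>2 / abar)) \<le> C * \<nu> ^ 4 \<and> H.approx_floquet \<nu> \<epsilon> (\<lambda>t. 0) w v)" by (rule exE)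
  define z w v where "z \<nu> = fst (Y \<nu>)" and "w \<nu> = fst (snd (Y \<nu>))" and "v \<nu> = snd (snd (Y \<nu>))" for \<nu>
  have W: "FG.wiener (\<sigma>\<^sub>0 / 2) (C * \<nu>\<^sup>2) (w \<nu>)" and V: "FG.wiener (\<sigma>\<^sub>0 / 2) (C * \<nu>\<^sup>2) (v \<nu>)"
    and z: "cmod (z \<nu> - of_real (\<nu>\<^sup>2 / abar)) \<le> C * \<nu> ^ 4" and fl: "H.approx_floquet \<nu> (z \<nu>) (\<lambda>t. 0) (w \<nu>) (v \<nu>)"
    if "\<nu> \<in> N" for \<nu>
    using Y[rule_format, OF that] by (simp_all add: z_def w_def v_def split_beta)
  have small: "C * \<nu>\<^sup>2 \<le> H.\<beta>\<^sub>0" "C * \<nu>\<^sup>2 \<le> \<nu> / 2" "C * \<nu>\<^sup>2 \<le> 1" "C * \<nu>\<^sup>2 \<le> 1 / (2 * abar)" if "\<nu> \<in> N" for \<nu>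
  proof -
    note n = N\<nu>[OF that]
    have sq: "\<nu>\<^sup>2 \<le> \<nu>" using n by (simp add: power2_eq_square mult_left_le)
    have le: "C * \<nu> \<le> x" if "\<nu>\<^sub>2 \<le> x / C" for x
    proof -
      have "\<nu> * C \<le> \<nu>\<^sub>2 * C" using n C by (intro mult_right_mono) auto
      also have "\<dots> \<le> x" using that C by (simp add: pos_le_divide_eq)
      finally show ?thesis by (simp add: mult.commute)
    qed
    have le2: "C * \<nu>\<^sup>2 \<le> x" if "\<nu>\<^sub>2 \<le> x / C" for x
      by (rule order_trans[OF mult_left_mono[OF sq] le[OF that]]) (use C in simp)
    show "C * \<nu>\<^sup>2 \<le> H.\<beta>\<^sub>0" by (rule le2[OF \<nu>2(3)])
    have "\<nu>\<^sub>2 \<le> (1 / 2) / C" "\<nu>\<^sub>2 \<le> (1 / (2 * abar)) / C" using \<nu>2(4,5) by (simp_all add: mult.commute)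
    then show "C * \<nu>\<^sup>2 \<le> 1 / (2 * abar)" by (intro le2)
    have "C * \<nu> \<le> 1 / 2" by (rule le[OF \<open>\<nu>\<^sub>2 \<le> (1 / 2) / C\<close>])
    then have "(C * \<nu>) * \<nu> \<le> 1 / 2 * \<nu>" using n by (intro mult_right_mono) auto
    then show "C * \<nu>\<^sup>2 \<le> \<nu> / 2" by (simp add: power2_eq_square)
    then show "C * \<nu>\<^sup>2 \<le> 1" using n by simp
  qed
  have dist: "cmod (z \<nu> - cnj (z \<nu>')) \<le> 16 / abar * \<bar>\<nu> - \<nu>'\<bar>" if "\<nu> \<in> N" "\<nu>' \<in> N" for \<nu> \<nu>'
  proof (rule H.wronskian_average[OF fl[OF that(1)] fl[OF that(2)]])
    have s2: "0 \<le> \<sigma>\<^sub>0 / 2" using \<sigma>0 by simp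
    show "FG.wiener 0 H.\<beta>\<^sub>0 (w \<nu>)" "FG.wiener 0 H.\<beta>\<^sub>0 (w \<nu>')" "FG.wiener 0 1 (v \<nu>)" "FG.wiener 0 1 (v \<nu>')"
      using FG.wiener_mono[OF W s2 small(1)] FG.wiener_mono[OF V s2 small(3)] that by blast+
  qed (use N\<nu> that in \<open>auto intro: less_imp_le\<close>)
  define f where "f \<nu> = Re (z \<nu>)" for \<nu>
  \<comment> \<open>The case of equal exponents in \<open>dist\<close>: a parameter at distance 0
    from its conjugate is real.\<close>
  have zf: "z \<nu> = of_real (f \<nu>)" if "\<nu> \<in> N" for \<nu>
    using dist[OF that that] by (simp add: f_def complex_eq_iff)
  have f_near: "\<bar>f \<nu> - \<nu>\<^sup>2 / abar\<bar> \<le> C * \<nu> ^ 4" if "\<nu> \<in> N" for \<nu>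
    using z[OF that] unfolding zf[OF that] of_real_diff[symmetric] norm_of_real .
  have f_bounds: "1 / (2 * abar) * \<nu>\<^sup>2 \<le> f \<nu>" "f \<nu> \<le> 2 / abar * \<nu>\<^sup>2" if "\<nu> \<in> N" for \<nu>
  proof -
    have "C * \<nu> ^ 4 = C * \<nu>\<^sup>2 * \<nu>\<^sup>2" by (simp add: power2_eq_square power4_eq_xxxx)
    also have "\<dots> \<le> 1 / (2 * abar) * \<nu>\<^sup>2" using small(4)[OF that] by (intro mult_right_mono) auto
    finally have b: "C * \<nu> ^ 4 \<le> 1 / (2 * abar) * \<nu>\<^sup>2" .
    have eq: "\<nu>\<^sup>2 / abar = 2 * (1 / (2 * abar) * \<nu>\<^sup>2)" "2 / abar * \<nu>\<^sup>2 = 4 * (1 / (2 * abar) * \<nu>\<^sup>2)" by simp_all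
    have nn: "0 \<le> 1 / (2 * abar) * \<nu>\<^sup>2" using assms(4) by simp
    show "1 / (2 * abar) * \<nu>\<^sup>2 \<le> f \<nu>" "f \<nu> \<le> 2 / abar * \<nu>\<^sup>2"
      using f_near[OF that] b nn unfolding eq abs_le_iff by linarith+
  qed
  have f_lip: "\<bar>f \<nu> - f \<nu>'\<bar> \<le> 16 / abar * \<bar>\<nu> - \<nu>'\<bar>" if "\<nu> \<in> N" "\<nu>' \<in> N" for \<nu> \<nu>'
    using dist[OF that]
    unfolding zf[OF that(1)] zf[OF that(2)] complex_cnj_complex_of_real of_real_diff[symmetric] norm_of_real .
  \<comment> \<open>\<open>4 / \<alpha>\<close> comes from
    \<open>1 / L ^ T \<le> 4 / \<alpha> * x\<close>, cubed because of \<open>3 * T\<close>, and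
    \<open>2 ^ q\<close> from \<open>1 + L \<le> 2 * L\<close>.\<close>
  define B where "B = \<gamma> / 2 * (4 / \<alpha>) ^ 3 * 2 ^ q"
  have close: "r n \<le> B * x ^ 3 * s n" if \<nu>: "0 \<le> \<nu>" "\<nu> \<le> x" "\<bar>\<nu> - c n\<bar> < r n" for n \<nu> x
  proof -
    have k: "e n \<noteq> 0" using \<nu>(3) by (auto simp: r_def)
    define L where "L = index_len (e n)"
    have L: "1 \<le> L" unfolding L_def by (rule index_len_ge_1[OF k])
    have LT: "0 < L ^ T" "0 < L ^ m" "0 < L ^ q" using L by simp_all
    have "\<bar>d (e n) + 2 * \<nu>\<bar> < \<gamma> / L ^ m" using \<nu>(3) k by (simp add: r_def c_def L_def field_simps)
    also have "\<gamma> / L ^ m \<le> \<gamma> / L ^ T"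
      using L \<gamma> LT by (intro divide_left_mono power_increasing mult_pos_pos) (auto simp: m_def)
    finally have "\<bar>d (e n)\<bar> \<le> \<gamma> / L ^ T + 2 * x" using \<nu> by linarith
    moreover have "2 * \<gamma> / L ^ T \<le> \<bar>d (e n)\<bar>"
      using dT[OF k] LT by (simp add: \<gamma>_def L_def pos_divide_le_eq)
    ultimately have "\<gamma> / L ^ T \<le> 2 * x" by simp
    then have LT4: "1 / L ^ T \<le> 4 / \<alpha> * x" using assms(5) LT by (simp add: \<gamma>_def field_simps)
    have q2: "1 / L ^ q \<le> 2 ^ q * s n"
    proof -
      have "(1 + L) ^ q \<le> (2 * L) ^ q" using L by (intro power_mono) auto
      then show ?thesis using LT L by (simp add: s_def L_def[symmetric] power_mult_distrib field_simps)
    qed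
    have "r n = \<gamma> / 2 * ((1 / L ^ T) ^ 3 * (1 / L ^ q))"
      using k by (simp add: r_def L_def m_def power_add power_mult power_one_over mult.commute)
    also have "\<dots> \<le> \<gamma> / 2 * ((4 / \<alpha> * x) ^ 3 * (2 ^ q * s n))"
      using LT4 q2 LT \<gamma> assms(5) \<nu> by (intro mult_left_mono mult_mono power_mono) auto
    also have "\<dots> = B * x ^ 3 * s n" unfolding B_def power_mult_distrib[of "4 / \<alpha>" x] by simp
    finally show ?thesis .
  qed
  have fms: "for_most_small (\<lambda>\<epsilon>. \<epsilon> \<in> f ` N)"
    unfolding N_def
  proof (rule for_most_small_image[where B = B and s = s and p = "1 / (2 * abar)" and P = "2 / abar" and L = "16 / abar"])
    show "0 \<le> r n" for n using \<gamma> by (auto simp: r_def index_len_nonneg)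
    show "0 \<le> s n" for n by (simp add: s_def index_len_nonneg)
    show "summable s"
    proof (rule summable_on_imp_summable)
      show "s summable_on UNIV"
        unfolding s_def[abs_def] summable_on_reindex_bij_betw[OF e, of "\<lambda>k. 1 / (1 + index_len k) ^ q"]
        unfolding q_def by (rule summable_index_len)
    qed
    show "0 \<le> B" using \<gamma> assms(5) by (simp add: B_def)
    show "2 / abar * \<nu>\<^sub>2 \<le> 16 / abar" using \<nu>2 \<nu>1 assms(4) by (simp add: divide_right_mono)
  qed (use close f_bounds f_lip assms(4) \<nu>2 in \<open>auto simp: N_def\<close>)
  \<comment> \<open>An exponent for each good parameter; should several exponents give the same
    parameter, one is selected. Its square is the function \<open>b\<close>.\<close>
  define n where "n \<epsilon> = inv_into N f \<epsilon>" for \<epsilon>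
  have n: "n \<epsilon> \<in> N" "f (n \<epsilon>) = \<epsilon>" if "\<epsilon> \<in> f ` N" for \<epsilon>
    using that by (simp_all add: n_def inv_into_into f_inv_into_f)
  have pos: "0 < \<epsilon>" if "\<epsilon> \<in> f ` N" for \<epsilon>
  proof -
    have "0 < 1 / (2 * abar) * (n \<epsilon>)\<^sup>2" using N\<nu>[OF n(1)[OF that]] assms(4) by simp
    then show ?thesis using f_bounds(1)[OF n(1)[OF that]] n(2)[OF that] by simp
  qed
  have bigo: "(\<lambda>\<epsilon>. (n \<epsilon>)\<^sup>2 - abar * \<epsilon>) \<in> O[at 0 within f ` N](\<lambda>\<epsilon>. \<epsilon>\<^sup>2)"
  \<comment> \<open>\<open>C * \<nu> ^ 4\<close> bounds the distance of \<open>\<epsilon>\<close>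
    from \<open>\<nu>\<^sup>2 / abar\<close>; multiplication by \<open>abar\<close> and
    \<open>\<nu>\<^sup>2 \<le> 2 * abar * \<epsilon>\<close> give the constant.\<close>
  proof (rule bigoI[where c = "abar * C * (2 * abar)\<^sup>2"])
    have "norm ((n \<epsilon>)\<^sup>2 - abar * \<epsilon>) \<le> abar * C * (2 * abar)\<^sup>2 * norm (\<epsilon>\<^sup>2)" if \<epsilon>: "\<epsilon> \<in> f ` N" for \<epsilon>
    proof -
      note nN = n(1)[OF \<epsilon>]
      have "norm ((n \<epsilon>)\<^sup>2 - abar * \<epsilon>) = abar * \<bar>f (n \<epsilon>) - (n \<epsilon>)\<^sup>2 / abar\<bar>"
        unfolding n(2)[OF \<epsilon>] using assms(4) by (simp add: abs_mult[symmetric] abs_minus_commute field_simps)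
      also have "\<dots> \<le> abar * (C * n \<epsilon> ^ 4)" using f_near[OF nN] assms(4) by (intro mult_left_mono) auto
      also have "n \<epsilon> ^ 4 = ((n \<epsilon>)\<^sup>2)\<^sup>2" by (simp flip: power_mult)
      also have "abar * (C * ((n \<epsilon>)\<^sup>2)\<^sup>2) \<le> abar * (C * (2 * abar * \<epsilon>)\<^sup>2)"
      proof -
        have "(n \<epsilon>)\<^sup>2 \<le> 2 * abar * \<epsilon>" using f_bounds(1)[OF nN] n(2)[OF \<epsilon>] assms(4) by (simp add: field_simps)
        then show ?thesis using assms(4) C by (intro mult_left_mono power_mono) auto
      qed
      finally show ?thesis by (simp add: power_mult_distrib mult_ac)
    qed
    then show "\<forall>\<^sub>F \<epsilon> in at 0 within f ` N. norm ((n \<epsilon>)\<^sup>2 - abar * \<epsilon>) \<le> abar * C * (2 * abar)\<^sup>2 * norm (\<epsilon>\<^sup>2)"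
      by (simp add: eventually_at_filter)
  qed
  have main: "reduced_to \<omega> (hill_matrix a \<epsilon>) (rotation_generator (n \<epsilon>)) \<and>
      (\<forall>x. hill_solution a \<epsilon> x \<longrightarrow> quasi_periodic (append_frequency \<omega> (n \<epsilon>)) x)" if \<epsilon>: "\<epsilon> \<in> f ` N" for \<epsilon>
  proof -
    note nN = n(1)[OF \<epsilon>]
    have fl': "H.approx_floquet (n \<epsilon>) (of_real \<epsilon>) (\<lambda>t. 0) (w (n \<epsilon>)) (v (n \<epsilon>))"
      using fl[OF nN] unfolding zf[OF nN] n(2)[OF \<epsilon>] .
    have s2: "0 < \<sigma>\<^sub>0 / 2" using \<sigma>0 by simp
    show ?thesis
      using H.floquet_reduced[OF fl' s2 W[OF nN] V[OF nN] N\<nu>(1)[OF nN] small(2)[OF nN]]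
        H.hill_solution_quasi_periodic[OF fl' s2 W[OF nN] V[OF nN] N\<nu>(1)[OF nN] small(2)[OF nN]] by blast
  qed
  show ?thesis
  proof (intro exI[of _ "f ` N"] exI[of _ "\<lambda>\<epsilon>. (n \<epsilon>)\<^sup>2"] conjI ballI)
    show "f ` N \<subseteq> {0<..}" using pos by auto
    fix \<epsilon> assume \<epsilon>: "\<epsilon> \<in> f ` N"
    have np: "0 < n \<epsilon>" using N\<nu>(1)[OF n(1)[OF \<epsilon>]] .
    then have sq: "sqrt ((n \<epsilon>)\<^sup>2) = n \<epsilon>" by simp
    show "0 < (n \<epsilon>)\<^sup>2" using np by simp
    show "\<exists>B. reduced_to \<omega> (hill_matrix a \<epsilon>) B \<and>
        complex_eigenvalues B = {\<i> * of_real (sqrt ((n \<epsilon>)\<^sup>2)), - (\<i> * of_real (sqrt ((n \<epsilon>)\<^sup>2)))}"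
      unfolding sq using main[OF \<epsilon>] eigenvalues_rotation_generator[OF less_imp_neq[OF np, symmetric]] by blast
    show "\<forall>x. hill_solution a \<epsilon> x \<longrightarrow> quasi_periodic (append_frequency \<omega> (sqrt ((n \<epsilon>)\<^sup>2))) x"
      unfolding sq using main[OF \<epsilon>] by blast
  qed (fact fms bigo)+
qed

end
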